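(* Let $q>1$ and let $\Omega\subset\mathbb R^N$ be a domain with nonempty compact boundary satisfying the parabolic Wiener criterion. Then the set $\mathcal J_{Q^\Omega_\infty}$ admits a maximal element $\overline u_\Omega$, i.e. there exists $\overline u_\Omega\in\mathcal J_{Q^\Omega_\infty}$ such that $u\le\overline u_\Omega$ in $\Omega\times(0,\infty)$ for every $u\in\mathcal J_{Q^\Omega_\infty}$.
   Context: $\Omega$ satisfies the parabolic Wiener criterion (PWC) if every point of $\partial\Omega\times(0,\infty)$ is regular for the Dirichlet problem for the heat equation in $\Omega\times(0,\infty)$ (Ziemer's parabolic Wiener criterion), so that the Dirichlet problem is solvable with continuous attainment of any continuous lateral data. $\mathcal J_{Q^\Omega_\infty}$ is the set of nonnegative $v\in C(\overline\Omega\times(0,\infty))\cap C^{2,1}(\Omega\times(0,\infty))$ satisfying $\partial_tv-\Delta v+v^q=0$ in $\Omega\times(0,\infty)$ and $v=0$ on $\partial\Omega\times(0,\infty)$. *)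

theory Defs
  imports "HOL-Analysis.Analysis"
begin

definition pd :: "'n::finite \<Rightarrow> (real^'n \<Rightarrow> real) \<Rightarrow> real^'n \<Rightarrow> real" where
  "pd i f x = deriv (\<lambda>r. f (x + r *\<^sub>R axis i 1)) 0"

definition lap :: "(real^'n::finite \<Rightarrow> real \<Rightarrow> real) \<Rightarrow> real^'n \<Rightarrow> real \<Rightarrow> real" where
  "lap v x t = (\<Sum>i\<in>UNIV. pd i (pd i (\<lambda>y. v y t)) x)"

definition dt :: "(real^'n::finite \<Rightarrow> real \<Rightarrow> real) \<Rightarrow> real^'n \<Rightarrow> real \<Rightarrow> real" where
  "dt v x t = deriv (\<lambda>s. v x s) t"

definition C21 :: "((real^'n::finite) \<times> real) set \<Rightarrow> (real^'n \<Rightarrow> real \<Rightarrow> real) \<Rightarrow> bool" where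
  "C21 U v \<longleftrightarrow>
     continuous_on U (\<lambda>(x,t). v x t) \<and>
     (\<forall>(x,t)\<in>U. (\<lambda>s. v x s) differentiable (at t) \<and>
        (\<forall>i. (\<lambda>r. v (x + r *\<^sub>R axis i 1) t) differentiable (at 0) \<and>
          (\<forall>j. (\<lambda>r. pd i (\<lambda>y. v y t) (x + r *\<^sub>R axis j 1)) differentiable (at 0)))) \<and>
     continuous_on U (\<lambda>(x,t). dt v x t) \<and>
     (\<forall>i. continuous_on U (\<lambda>(x,t). pd i (\<lambda>y. v y t) x)) \<and>
     (\<forall>i j. continuous_on U (\<lambda>(x,t). pd j (pd i (\<lambda>y. v y t)) x))"

text \<open>Parabolic Wiener criterion: every point of the lateral boundary of
  \<Omega> \<times> (0,\<infinity>) is regular for the heat equation, i.e. the (bounded)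
  Dirichlet problem for the heat equation in \<Omega> \<times> (0,\<infinity>) is solvable
  with continuous attainment of any bounded continuous boundary data.\<close>
definition PWC :: "(real^'n::finite) set \<Rightarrow> bool" where
  "PWC \<Omega> \<longleftrightarrow>
    (\<forall>g :: real^'n \<Rightarrow> real \<Rightarrow> real.
       continuous_on (closure \<Omega> \<times> {0..}) (\<lambda>(x,t). g x t) \<and>
       bounded ((\<lambda>(x,t). g x t) ` (closure \<Omega> \<times> {0..})) \<longrightarrow>
       (\<exists>h :: real^'n \<Rightarrow> real \<Rightarrow> real.
          continuous_on (closure \<Omega> \<times> {0..}) (\<lambda>(x,t). h x t) \<and>
          bounded ((\<lambda>(x,t). h x t) ` (closure \<Omega> \<times> {0..})) \<and>
          C21 (\<Omega> \<times> {0<..}) h \<and>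
          (\<forall>x\<in>\<Omega>. \<forall>t>0. dt h x t = lap h x t) \<and>
          (\<forall>x\<in>frontier \<Omega>. \<forall>t\<ge>0. h x t = g x t) \<and>
          (\<forall>x\<in>\<Omega>. h x 0 = g x 0)))"

definition J :: "real \<Rightarrow> (real^'n::finite) set \<Rightarrow> (real^'n \<Rightarrow> real \<Rightarrow> real) set" where
  "J q \<Omega> = {v. (\<forall>x\<in>closure \<Omega>. \<forall>t>0. 0 \<le> v x t) \<and>
     continuous_on (closure \<Omega> \<times> {0<..}) (\<lambda>(x,t). v x t) \<and>
     C21 (\<Omega> \<times> {0<..}) v \<and>
     (\<forall>x\<in>\<Omega>. \<forall>t>0. dt v x t - lap v x t + (v x t) powr q = 0) \<and>
     (\<forall>x\<in>frontier \<Omega>. \<forall>t>0. v x t = 0)}"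

end

theory Submission
  imports Defs
begin

text \<open>
  By a Keller--Osserman barrier every element of \<open>J q \<Omega>\<close> lies below the spatially constant solution
  \<open>\<phi>(t) = ((q - 1) t) powr (- 1 / (q - 1))\<close>. For \<open>a > 0\<close> let \<open>u\<^sub>a\<close> solve the equation after time \<open>a\<close> with
  initial value \<open>\<phi>(a)\<close> and lateral data that decrease continuously from \<open>\<phi>(a)\<close> to \<open>0\<close> on \<open>[a, 2a]\<close>.
  By comparison \<open>u\<^sub>a\<close> dominates \<open>J q \<Omega>\<close>, stays below \<open>\<phi>\<close> and decreases as \<open>a \<rightarrow> 0\<close>; its limit is the
  maximal element.

  Existence and compactness rest on the maximum principle alone. Brandt's reflection argument bounds
  the spatial gradient of a solution of \<open>v\<^sub>t - \<Delta>v = f\<close> by the suprema of \<open>v\<close> and \<open>f\<close>. Hence a locally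
  uniform limit of classical solutions with locally uniformly convergent right-hand sides is \<open>C\<^sup>1\<close> in
  space; if the limiting right-hand side is \<open>C\<^sup>1\<close> in space, difference quotients give the second
  derivatives, and a barrier gives the time derivative. The inhomogeneous linear problem is solved
  explicitly for trigonometric right-hand sides, which are dense, the parabolic Wiener criterion
  correcting the boundary values.
\<close>

section \<open>Maximum principles\<close>

text \<open>\<open>PWC\<close> supplies only homogeneous solutions with prescribed bounded boundary
  values, so every source has to be removed before it can be used, and the nonlinearity has to be
  made bounded and Lipschitz first; a priori bounds later show that the truncation was inactive. The
  boundary of \<open>\<Omega>\<close> is compact but \<open>\<Omega>\<close> may be unbounded.
  Comparison is therefore proved for differences bounded above, with a growing caloric function as
  penalty. Picard iteration converges in the norm with weight exp(l t)(1 + |x|^2): sources are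
  approximated well only on balls, the quadratic factor absorbs the error outside, and the
  exponential gives contraction on all of [0,T] at once. The gradient estimate is powerful because
  it is linear: applied to the difference of two approximants, it turns uniform closeness into
  closeness of gradients. One derivative of the source then suffices, and -w^q inherits it from w
  itself, so no Hoelder theory enters. The approximating problems start at time a > 0 because
  neither infinite initial values nor a jump between initial and lateral values is admissible data
  for \<open>PWC\<close>.\<close>

text \<open>A relational, pointwise heat operator: derivatives enter as witnesses, so that linear
  combinations, shifts and reflections carry no side conditions about \<open>deriv\<close>. Second
  derivatives along the axes at the single point are all that a maximum argument needs.\<close>

definition heat_at :: "(real^'n::finite \<Rightarrow> real \<Rightarrow> real) \<Rightarrow> real^'n \<Rightarrow> real \<Rightarrow> real \<Rightarrow> bool" where
  "heat_at v x t f \<longleftrightarrow> (\<exists>p A. ((\<lambda>s. v x s) has_real_derivative p) (at t) \<and>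
     (\<forall>i. \<exists>g. (\<forall>\<^sub>F r in nhds 0. ((\<lambda>r. v (x + r *\<^sub>R axis i 1) t) has_real_derivative g r) (at r)) \<and>
        (g has_real_derivative A i) (at 0)) \<and>
     f = p - (\<Sum>i\<in>UNIV. A i))"

lemma heat_atI:
  assumes "((\<lambda>s. v x s) has_real_derivative p) (at t)"
    and "\<And>i. \<forall>\<^sub>F r in nhds 0. ((\<lambda>r. v (x + r *\<^sub>R axis i 1) t) has_real_derivative g i r) (at r)"
    and "\<And>i. (g i has_real_derivative A i) (at 0)"
    and "f = p - (\<Sum>i\<in>UNIV. A i)"
  shows "heat_at v x t f"
  unfolding heat_at_def
  apply (rule exI[of _ p], rule exI[of _ A])
  using assms by blast

lemma heat_atE:
  assumes "heat_at v x t f"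
  obtains p A g where "((\<lambda>s. v x s) has_real_derivative p) (at t)"
    and "\<And>i. \<forall>\<^sub>F r in nhds 0. ((\<lambda>r. v (x + r *\<^sub>R axis i 1) t) has_real_derivative g i r) (at r)"
    and "\<And>i. (g i has_real_derivative A i) (at 0)"
    and "f = p - (\<Sum>i\<in>UNIV. A i)"
proof -
  obtain p A where *: "((\<lambda>s. v x s) has_real_derivative p) (at t)" "f = p - (\<Sum>i\<in>UNIV. A i)"
    and "\<forall>i. \<exists>g. (\<forall>\<^sub>F r in nhds 0. ((\<lambda>r. v (x + r *\<^sub>R axis i 1) t) has_real_derivative g r) (at r)) \<and>
        (g has_real_derivative A i) (at 0)"
    using assms unfolding heat_at_def by blast
  from choice[OF this(3)] show ?thesis using that * by blast
qed

lemma isCont_eventually_nhds: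
  assumes "isCont f a" "eventually P (nhds b)" "f a = b"
  shows "\<forall>\<^sub>F x in nhds a. P (f x)"
  using assms tendsto_at_iff_tendsto_nhds[of f a] by (auto simp: isCont_def filterlim_iff)

lemma heat_at_add:
  assumes "heat_at v x t f" "heat_at w x t h"
  shows "heat_at (\<lambda>x t. v x t + w x t) x t (f + h)"
proof -
  obtain p A g where a: "((\<lambda>s. v x s) has_real_derivative p) (at t)"
    "\<And>i. \<forall>\<^sub>F r in nhds 0. ((\<lambda>r. v (x + r *\<^sub>R axis i 1) t) has_real_derivative g i r) (at r)"
    "\<And>i. (g i has_real_derivative A i) (at 0)" "f = p - (\<Sum>i\<in>UNIV. A i)"
    using heat_atE[OF assms(1)] by blast
  obtain p' A' g' where b: "((\<lambda>s. w x s) has_real_derivative p') (at t)"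
    "\<And>i. \<forall>\<^sub>F r in nhds 0. ((\<lambda>r. w (x + r *\<^sub>R axis i 1) t) has_real_derivative g' i r) (at r)"
    "\<And>i. (g' i has_real_derivative A' i) (at 0)" "h = p' - (\<Sum>i\<in>UNIV. A' i)"
    using heat_atE[OF assms(2)] by blast
  show ?thesis
  proof (rule heat_atI[where p = "p + p'" and g = "\<lambda>i r. g i r + g' i r" and A = "\<lambda>i. A i + A' i"])
    show "\<forall>\<^sub>F r in nhds 0. ((\<lambda>r. v (x + r *\<^sub>R axis i 1) t + w (x + r *\<^sub>R axis i 1) t)
        has_real_derivative g i r + g' i r) (at r)" for i
      using eventually_conj[OF a(2)[of i] b(2)[of i]]
      by eventually_elim (auto intro!: derivative_intros)
  qed (use a b in \<open>auto intro!: derivative_intros simp: sum.distrib\<close>)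
qed

lemma heat_at_cmult:
  assumes "heat_at v x t f"
  shows "heat_at (\<lambda>x t. c * v x t) x t (c * f)"
proof -
  obtain p A g where a: "((\<lambda>s. v x s) has_real_derivative p) (at t)"
    "\<And>i. \<forall>\<^sub>F r in nhds 0. ((\<lambda>r. v (x + r *\<^sub>R axis i 1) t) has_real_derivative g i r) (at r)"
    "\<And>i. (g i has_real_derivative A i) (at 0)" "f = p - (\<Sum>i\<in>UNIV. A i)"
    using heat_atE[OF assms(1)] by blast
  show ?thesis
  proof (rule heat_atI[where p = "c * p" and g = "\<lambda>i r. c * g i r" and A = "\<lambda>i. c * A i"])
    show "\<forall>\<^sub>F r in nhds 0. ((\<lambda>r. c * v (x + r *\<^sub>R axis i 1) t) has_real_derivative c * g i r) (at r)" for i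
      using a(2)[of i] by eventually_elim (auto intro!: DERIV_cmult)
  qed (use a in \<open>auto intro!: DERIV_cmult simp: sum_distrib_left right_diff_distrib\<close>)
qed

lemma heat_at_minus: "heat_at v x t f \<Longrightarrow> heat_at (\<lambda>x t. - v x t) x t (- f)"
  using heat_at_cmult[of v x t f "-1"] by simp

lemma heat_at_diff:
  assumes "heat_at v x t f" "heat_at w x t h"
  shows "heat_at (\<lambda>x t. v x t - w x t) x t (f - h)"
  using heat_at_add[OF assms(1) heat_at_minus[OF assms(2)]] by simp

lemma heat_at_time:
  assumes "(\<phi> has_real_derivative p) (at t)"
  shows "heat_at (\<lambda>x. \<phi>) x t p"
  by (rule heat_atI[where p = p and g = "\<lambda>i r. 0" and A = "\<lambda>i. 0"]) (use assms in auto)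

lemma heat_at_const: "heat_at (\<lambda>x t. c) x t 0"
  by (rule heat_at_time) auto

lemma heat_at_sum:
  assumes "finite S" "\<And>k. k \<in> S \<Longrightarrow> heat_at (v k) x t (f k)"
  shows "heat_at (\<lambda>x t. \<Sum>k\<in>S. v k x t) x t (\<Sum>k\<in>S. f k)"
  using assms by (induction S rule: finite_induct) (auto intro: heat_at_const heat_at_add)

text \<open>Profiles of one coordinate are the building blocks of the barriers: the squared
  distance, the concave quadratic in the gradient estimate, and the functions that blow up on the
  faces of a cube.\<close>

lemma heat_at_coord:
  fixes x :: "real^'n::finite"
  assumes "\<forall>\<^sub>F s in nhds (x $ k). (g has_real_derivative g1 s) (at s)"
    and "(g1 has_real_derivative g2) (at (x $ k))"
  shows "heat_at (\<lambda>x t. g (x $ k)) x t (- g2)"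
proof (rule heat_atI[where p = 0 and g = "\<lambda>i r. if i = k then g1 (x $ k + r) else 0"
      and A = "\<lambda>i. if i = k then g2 else 0"])
  fix i
  show "\<forall>\<^sub>F r in nhds 0. ((\<lambda>r. g ((x + r *\<^sub>R axis i 1) $ k)) has_real_derivative
      (if i = k then g1 (x $ k + r) else 0)) (at r)"
  proof (cases "i = k")
    case True
    have "isCont (\<lambda>r. x $ k + r) 0" by (intro continuous_intros)
    from isCont_eventually_nhds[OF this assms(1)]
    have "\<forall>\<^sub>F r in nhds 0. (g has_real_derivative g1 (x $ k + r)) (at (x $ k + r))" by simp
    then show ?thesis
      by eventually_elim (use True in \<open>auto simp: DERIV_shift add.commute\<close>)
  qed (auto simp: axis_def)
  show "((\<lambda>r. if i = k then g1 (x $ k + r) else 0) has_real_derivative (if i = k then g2 else 0)) (at 0)"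
    using assms(2) DERIV_shift[of g1 g2 0 "x $ k"] by (auto simp: add.commute)
qed auto

lemma heat_at_shift:
  assumes "heat_at v (x + h) (t + a) f"
  shows "heat_at (\<lambda>x t. v (x + h) (t + a)) x t f"
proof -
  obtain p A g where a: "((\<lambda>s. v (x + h) s) has_real_derivative p) (at (t + a))"
    "\<And>i. \<forall>\<^sub>F r in nhds 0. ((\<lambda>r. v (x + h + r *\<^sub>R axis i 1) (t + a)) has_real_derivative g i r) (at r)"
    "\<And>i. (g i has_real_derivative A i) (at 0)" "f = p - (\<Sum>i\<in>UNIV. A i)"
    using heat_atE[OF assms(1)] by blast
  show ?thesis
  proof (rule heat_atI[where p = p and g = g and A = A])
    show "((\<lambda>s. v (x + h) (s + a)) has_real_derivative p) (at t)"
      using a(1) DERIV_shift[of "v (x + h)" p t a] by simp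
    show "\<forall>\<^sub>F r in nhds 0. ((\<lambda>r. v (x + r *\<^sub>R axis i 1 + h) (t + a)) has_real_derivative g i r) (at r)" for i
      using a(2)[of i] by (simp add: add_ac)
  qed (use a in auto)
qed

lemma heat_at_sqdist: "heat_at (\<lambda>x t. (norm (x - c))\<^sup>2) (x::real^'n::finite) t (- 2 * real CARD('n))"
proof -
  have e: "(norm (y - c))\<^sup>2 = (\<Sum>k\<in>UNIV. (y $ k - c $ k)\<^sup>2)" for y :: "real^'n"
    unfolding norm_vec_def L2_set_def by (subst real_sqrt_pow2) (auto intro: sum_nonneg)
  have "heat_at (\<lambda>x t. \<Sum>k\<in>UNIV. (x $ k - c $ k)\<^sup>2) x t (\<Sum>k\<in>(UNIV::'n set). - 2)"
  proof (rule heat_at_sum)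
    fix k
    show "heat_at (\<lambda>x t. (x $ k - c $ k)\<^sup>2) x t (- 2)"
      by (rule heat_at_coord[where g = "\<lambda>s. (s - c $ k)\<^sup>2" and ?g1.0 = "\<lambda>s. 2 * (s - c $ k)"])
         (auto intro!: derivative_eq_intros always_eventually)
  qed auto
  then show ?thesis unfolding e by (simp add: mult.commute)
qed

text \<open>Under reflection in a coordinate hyperplane the first derivative changes sign and the
  second does not, so the heat operator is invariant. This is what permits
  antisymmetrisation.\<close>

lemma heat_at_flip:
  fixes x :: "real^'n::finite"
  defines "R \<equiv> \<lambda>c k (x::real^'n). \<chi> j. if j = k then 2 * c - x $ j else x $ j"
  assumes "heat_at v (R c k x) t f"
  shows "heat_at (\<lambda>x t. v (R c k x) t) x t f"
proof -
  obtain p A g where a: "((\<lambda>s. v (R c k x) s) has_real_derivative p) (at t)"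
    "\<And>i. \<forall>\<^sub>F r in nhds 0. ((\<lambda>r. v (R c k x + r *\<^sub>R axis i 1) t) has_real_derivative g i r) (at r)"
    "\<And>i. (g i has_real_derivative A i) (at 0)" "f = p - (\<Sum>i\<in>UNIV. A i)"
    using heat_atE[OF assms(2)] by blast
  have R: "R c k (x + r *\<^sub>R axis i 1) = R c k x + (if i = k then - r else r) *\<^sub>R axis i 1" for i r
    by (auto simp: R_def vec_eq_iff axis_def)
  show ?thesis
  proof (rule heat_atI[where p = p and g = "\<lambda>i r. if i = k then - g i (- r) else g i r" and A = A])
    fix i
    show "\<forall>\<^sub>F r in nhds 0. ((\<lambda>r. v (R c k (x + r *\<^sub>R axis i 1)) t) has_real_derivative
       (if i = k then - g i (- r) else g i r)) (at r)"
    proof (cases "i = k")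
      case True
      have "isCont (\<lambda>r::real. - r) 0" by (intro continuous_intros)
      from isCont_eventually_nhds[OF this a(2)[of i]]
      have "\<forall>\<^sub>F r in nhds 0. ((\<lambda>r. v (R c k x + r *\<^sub>R axis i 1) t) has_real_derivative g i (- r)) (at (- r))"
        by simp
      then show ?thesis
        by eventually_elim (use True in \<open>auto simp: R DERIV_mirror\<close>)
    qed (use a(2)[of i] in \<open>auto simp: R\<close>)
    show "((\<lambda>r. if i = k then - g i (- r) else g i r) has_real_derivative A i) (at 0)"
    proof (cases "i = k")
      case True
      have "((\<lambda>r. g i (- r)) has_real_derivative - A i) (at 0)"
        using a(3)[of i] DERIV_mirror[of "\<lambda>r. g i r" "A i" 0] by simp
      then have "((\<lambda>r. - g i (- r)) has_real_derivative A i) (at 0)"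
        using DERIV_minus by fastforce
      then show ?thesis using True by simp
    qed (use a(3)[of i] in auto)
  qed (use a in auto)
qed

section \<open>Interior maxima and comparison on compact and unbounded cylinders\<close>

text \<open>The derivative \<open>g\<close> vanishes at the maximum. Were \<open>A\<close> positive,
  \<open>g\<close> would be positive just to the right of 0, and the mean value theorem would make
  \<open>u\<close> exceed \<open>u 0\<close> there.\<close>

lemma second_derivative_nonpos_at_max:
  fixes u :: "real \<Rightarrow> real"
  assumes d: "\<forall>\<^sub>F r in nhds 0. (u has_real_derivative g r) (at r)"
    and d2: "(g has_real_derivative A) (at 0)"
    and mx: "\<forall>\<^sub>F r in nhds 0. u r \<le> u 0"
  shows "A \<le> 0"
proof (rule ccontr)
  assume "\<not> A \<le> 0" then have A: "A > 0" by simp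
  obtain e where e: "e > 0" "\<And>r. \<bar>r\<bar> < e \<Longrightarrow> (u has_real_derivative g r) (at r) \<and> u r \<le> u 0"
    using eventually_conj[OF d mx] unfolding eventually_nhds_metric by (auto simp: dist_real_def)
  have g0: "g 0 = 0"
    by (rule DERIV_local_max[of u "g 0" 0 e]) (use e in auto)
  obtain d where dd: "d > 0" "\<And>h. 0 < h \<Longrightarrow> h < d \<Longrightarrow> g 0 < g (0 + h)"
    using DERIV_pos_inc_right[OF d2 A] by blast
  define h where "h = min d e / 2"
  have h: "0 < h" "h < d" "h < e" using dd(1) e(1) by (auto simp: h_def)
  have "\<exists>z. 0 < z \<and> z < h \<and> u h - u 0 = (h - 0) * g z"
    by (rule MVT2) (use h e in auto)
  then obtain z where z: "0 < z" "z < h" "u h - u 0 = h * g z" by auto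
  have "g z > 0" using dd(2)[of z] z h g0 by auto
  then have "u h > u 0" using z h by (smt (verit) mult_pos_pos)
  with e(2)[of h] h show False by auto
qed

text \<open>Only earlier times are compared, so the maximum may sit at the final time of a cylinder,
  where the time derivative is nonnegative rather than zero.\<close>

lemma heat_at_max_nonneg:
  assumes h: "heat_at v x t f"
    and sp: "\<And>i. \<forall>\<^sub>F r in nhds 0. v (x + r *\<^sub>R axis i 1) t \<le> v x t"
    and tm: "a < t" "\<And>s. a < s \<Longrightarrow> s < t \<Longrightarrow> v x s \<le> v x t"
  shows "f \<ge> 0"
proof -
  obtain p A g where a: "((\<lambda>s. v x s) has_real_derivative p) (at t)"
    "\<And>i. \<forall>\<^sub>F r in nhds 0. ((\<lambda>r. v (x + r *\<^sub>R axis i 1) t) has_real_derivative g i r) (at r)"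
    "\<And>i. (g i has_real_derivative A i) (at 0)" "f = p - (\<Sum>i\<in>UNIV. A i)"
    using heat_atE[OF h] by blast
  have "A i \<le> 0" for i
    by (rule second_derivative_nonpos_at_max[OF a(2)[of i] a(3)]) (use sp[of i] in simp)
  then have "(\<Sum>i\<in>UNIV. A i) \<le> 0" by (intro sum_nonpos) auto
  moreover have "p \<ge> 0"
  proof (rule ccontr)
    assume "\<not> p \<ge> 0"
    then obtain d where d: "d > 0" "\<And>h. 0 < h \<Longrightarrow> h < d \<Longrightarrow> v x t < v x (t - h)"
      using DERIV_neg_dec_left[OF a(1)] by auto
    define h where "h = min d (t - a) / 2"
    have "0 < h" "h < d" "h < t - a" using d tm(1) by (auto simp: h_def)
    with d(2)[of h] tm(2)[of "t - h"] show False by auto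
  qed
  ultimately show ?thesis using a(4) by linarith
qed

text \<open>Subtracting \<open>e * (t - a)\<close> makes the heat operator strictly negative at a
  positive maximum. The differential inequality is asked for only where \<open>w x t > 0\<close>,
  because for the difference of two semilinear solutions monotonicity gives a sign only
  there.\<close>

lemma max_principle:
  fixes w :: "real^'n::finite \<Rightarrow> real \<Rightarrow> real"
  assumes K: "compact K" "open W" "W \<subseteq> K"
    and cont: "continuous_on (K \<times> {a..b}) (\<lambda>(x,t). w x t)"
    and bd: "\<And>x t. x \<in> K \<Longrightarrow> a \<le> t \<Longrightarrow> t \<le> b \<Longrightarrow> x \<notin> W \<or> t = a \<Longrightarrow> w x t \<le> 0"
    and sub: "\<And>x t. x \<in> W \<Longrightarrow> a < t \<Longrightarrow> t \<le> b \<Longrightarrow> w x t > 0 \<Longrightarrow> \<exists>f\<le>0. heat_at w x t f"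
    and xt: "x \<in> K" "a \<le> t" "t \<le> b"
  shows "w x t \<le> 0"
proof -
  have main: "w x t - e * (t - a) \<le> 0" if e: "e > 0" for e
  proof (rule ccontr)
    assume neg: "\<not> w x t - e * (t - a) \<le> 0"
    let ?W = "\<lambda>x t. w x t - e * (t - a)"
    have "continuous_on (K \<times> {a..b}) (\<lambda>z. (\<lambda>(x,t). w x t) z - e * (snd z - a))"
      using cont by (intro continuous_intros)
    moreover have "compact (K \<times> {a..b})" using K by (intro compact_Times) auto
    moreover have "K \<times> {a..b} \<noteq> {}" using xt by auto
    ultimately obtain z where z: "z \<in> K \<times> {a..b}"
      "\<And>y. y \<in> K \<times> {a..b} \<Longrightarrow> (\<lambda>(x,t). w x t) y - e * (snd y - a) \<le> (\<lambda>(x,t). w x t) z - e * (snd z - a)"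
      using continuous_attains_sup by (metis (no_types, lifting))
    obtain y s where ys: "z = (y, s)" by fastforce
    have y: "y \<in> K" "a \<le> s" "s \<le> b" using z ys by auto
    have mx: "?W y' s' \<le> ?W y s" if "y' \<in> K" "a \<le> s'" "s' \<le> b" for y' s'
      using z(2)[of "(y', s')"] that ys by auto
    have pos: "?W y s > 0" using mx[OF xt] neg by linarith
    have "e * (s - a) \<ge> 0" using e y by auto
    then have wp: "w y s > 0" using pos by linarith
    then have yW: "y \<in> W" and sa: "a < s" using bd[OF y] y by force+
    obtain f where f: "f \<le> 0" "heat_at w y s f" using sub[OF yW sa y(3) wp] by auto
    have h1: "heat_at (\<lambda>x t. e * (t - a)) y s e"
      by (rule heat_at_time) (auto intro!: derivative_eq_intros)
    have h2: "heat_at ?W y s (f - e)" by (rule heat_at_diff[OF f(2) h1])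
    have "f - e \<ge> 0"
    proof (rule heat_at_max_nonneg[OF h2 _ sa])
      fix i
      have "isCont (\<lambda>r. y + r *\<^sub>R axis i (1::real)) 0" by (intro continuous_intros)
      from isCont_eventually_nhds[OF this eventually_nhds_in_open[OF K(2) yW]]
      have "\<forall>\<^sub>F r in nhds 0. y + r *\<^sub>R axis i 1 \<in> W" by simp
      then show "\<forall>\<^sub>F r in nhds 0. ?W (y + r *\<^sub>R axis i 1) s \<le> ?W y s"
        by eventually_elim (use mx y K(3) in blast)
    qed (use mx y in auto)
    with f(1) e show False by linarith
  qed
  show ?thesis
  proof (rule ccontr)
    assume "\<not> w x t \<le> 0"
    then have p: "w x t > 0" by simp
    \<comment> \<open>The tilt is chosen so small that it removes less than the positive value
      \<open>w x t\<close>; the added 1 covers \<open>t = a\<close>.\<close>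
    have "w x t * (t - a) < w x t * (2 * (t - a + 1))"
      using p xt(2) by (intro mult_strict_left_mono) auto
    then have "w x t - (w x t / (2 * (t - a + 1))) * (t - a) > 0"
      using xt(2) by (simp add: pos_divide_less_eq)
    with main[of "w x t / (2 * (t - a + 1))"] p xt(2) show False by (simp add: field_simps)
  qed
qed

text \<open>A Phragmen-Lindelof argument: a small multiple of the caloric function
  \<open>|x|^2 + 2 N (t - a)\<close>, with N the dimension, exceeds the bound \<open>B\<close> on a
  large sphere. The compact version then applies inside the ball, and the multiple tends to
  0.\<close>

lemma max_principle_unbounded:
  fixes w :: "real^'n::finite \<Rightarrow> real \<Rightarrow> real"
  assumes "open \<Omega>"
    and cont: "continuous_on (closure \<Omega> \<times> {a..b}) (\<lambda>(x,t). w x t)"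
    and bdd: "\<And>x t. x \<in> closure \<Omega> \<Longrightarrow> a \<le> t \<Longrightarrow> t \<le> b \<Longrightarrow> w x t \<le> B"
    and init: "\<And>x. x \<in> \<Omega> \<Longrightarrow> w x a \<le> 0"
    and lat: "\<And>x t. x \<in> frontier \<Omega> \<Longrightarrow> a \<le> t \<Longrightarrow> t \<le> b \<Longrightarrow> w x t \<le> 0"
    and sub: "\<And>x t. x \<in> \<Omega> \<Longrightarrow> a < t \<Longrightarrow> t \<le> b \<Longrightarrow> w x t > 0 \<Longrightarrow> \<exists>f\<le>0. heat_at w x t f"
    and xt: "x \<in> closure \<Omega>" "a \<le> t" "t \<le> b"
  shows "w x t \<le> 0"
proof -
  let ?N = "real CARD('n)"
  have main: "w x t \<le> e * ((norm x)\<^sup>2 + 2 * ?N * (t - a))" if e: "e > 0" for e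
  proof -
    obtain R where R: "R > norm x" "e * R\<^sup>2 \<ge> B" "R > 0"
    proof -
      \<comment> \<open>\<open>R \<ge> 1\<close> gives \<open>R^2 \<ge> R\<close>, hence
        \<open>e R^2 \<ge> e R \<ge> |B|\<close>.\<close>
      define R where "R = norm x + 1 + \<bar>B\<bar> / e"
      have R1: "R \<ge> 1" and RB: "R \<ge> \<bar>B\<bar> / e" using e by (auto simp: R_def)
      have "R \<le> R\<^sup>2" using R1 by (simp add: power2_eq_square)
      then have "\<bar>B\<bar> / e \<le> R\<^sup>2" using RB by linarith
      then have "B \<le> e * R\<^sup>2" using e by (simp add: field_simps abs_le_iff)
      with R1 show ?thesis using that[of R] \<open>B \<le> e * R\<^sup>2\<close> R1 e by (smt (verit) R_def divide_nonneg_pos)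
    qed
    have "w x t - e * ((norm (x - 0))\<^sup>2 + 2 * ?N * (t - a)) \<le> 0"
    proof (rule max_principle[where x = x and t = t
          and w = "\<lambda>x t. w x t - e * ((norm (x - 0))\<^sup>2 + 2 * ?N * (t - a))" and K = "closure \<Omega> \<inter> cball 0 R" and W = "\<Omega> \<inter> ball 0 R" and a = a and b = b])
      show "compact (closure \<Omega> \<inter> cball 0 R)" by (simp add: closed_Int_compact)
      show "\<Omega> \<inter> ball 0 R \<subseteq> closure \<Omega> \<inter> cball 0 R" using closure_subset by auto
      have "continuous_on ((closure \<Omega> \<inter> cball 0 R) \<times> {a..b})
          (\<lambda>z. (\<lambda>(x,t). w x t) z - e * ((norm (fst z - 0))\<^sup>2 + 2 * ?N * (snd z - a)))"
        by (intro continuous_intros continuous_on_subset[OF cont]) auto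
      then show "continuous_on ((closure \<Omega> \<inter> cball 0 R) \<times> {a..b})
          (\<lambda>(x,t). w x t - e * ((norm (x - 0))\<^sup>2 + 2 * ?N * (t - a)))"
        by (simp add: case_prod_beta)
      show "w x t - e * ((norm (x - 0))\<^sup>2 + 2 * ?N * (t - a)) \<le> 0"
        if A: "x \<in> closure \<Omega> \<inter> cball 0 R" "a \<le> t" "t \<le> b" "x \<notin> \<Omega> \<inter> ball 0 R \<or> t = a" for x t
      proof -
        have n: "e * ((norm (x - 0))\<^sup>2 + 2 * ?N * (t - a)) \<ge> e * (norm x)\<^sup>2"
          using e that by (intro mult_left_mono) auto
        consider "x \<notin> \<Omega>" | "x \<in> \<Omega>" "t = a" | "norm x \<ge> R" using A(4) by (auto simp: not_less)
        then show ?thesis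
        proof cases
          case 1
          then have "x \<in> frontier \<Omega>"
            using that(1) \<open>open \<Omega>\<close> by (auto simp: frontier_def interior_open)
          then show ?thesis using lat[of x t] that n e by (smt (verit) zero_le_power2 mult_nonneg_nonneg)
        next
          case 2
          then show ?thesis using init[of x] n e by (smt (verit) zero_le_power2 mult_nonneg_nonneg)
        next
          case 3
          then have "e * (norm x)\<^sup>2 \<ge> e * R\<^sup>2" using e R by (intro mult_left_mono power_mono) auto
          then show ?thesis using n R bdd[of x t] that by auto
        qed
      qed
      show "\<exists>f\<le>0. heat_at (\<lambda>x t. w x t - e * ((norm (x - 0))\<^sup>2 + 2 * ?N * (t - a))) x t f"
        if x: "x \<in> \<Omega> \<inter> ball 0 R" "a < t" "t \<le> b" and p: "w x t - e * ((norm (x - 0))\<^sup>2 + 2 * ?N * (t - a)) > 0" for x t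
      proof -
        have "e * ((norm (x - 0))\<^sup>2 + 2 * ?N * (t - a)) \<ge> 0" using e x by (intro mult_nonneg_nonneg) auto
        then obtain f where f: "f \<le> 0" "heat_at w x t f" using sub[of x t] x p by force
        have "heat_at (\<lambda>x t. 2 * ?N * (t - a)) x t (2 * ?N)"
          by (rule heat_at_time) (auto intro!: derivative_eq_intros)
        from heat_at_diff[OF f(2) heat_at_cmult[OF heat_at_add[OF heat_at_sqdist[of 0] this], of e]] f(1)
        show ?thesis by auto
      qed
    qed (use xt R assms(1) in \<open>auto simp: less_imp_le\<close>)
    then show ?thesis by simp
  qed
  show ?thesis
  proof (rule ccontr)
    assume "\<not> w x t \<le> 0"
    then have p: "w x t > 0" by simp
    define C where "C = (norm x)\<^sup>2 + 2 * ?N * (t - a)"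
    have C: "C \<ge> 0" using xt by (auto simp: C_def)
    have "w x t \<le> w x t / (2 * (C + 1)) * C" using main[of "w x t / (2 * (C + 1))"] p C unfolding C_def[symmetric] by auto
    moreover have "w x t * C < w x t * (2 * (C + 1))"
      using p C by (intro mult_strict_left_mono) auto
    ultimately show False using C by (simp add: pos_le_divide_eq)
  qed
qed

section \<open>Interior estimates and generalised solutions\<close>

text \<open>Cubes serve better than balls here: half a cube is again a box, reflections through the
  centre along an axis preserve it, and its faces can be treated one coordinate at a time.\<close>

definition cube :: "real^'n::finite \<Rightarrow> real \<Rightarrow> (real^'n) set" where
  "cube x d = cbox (\<chi> j. x $ j - d) (\<chi> j. x $ j + d)"

lemma mem_cube: "y \<in> cube x d \<longleftrightarrow> (\<forall>j. \<bar>y $ j - x $ j\<bar> \<le> d)"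
  by (auto simp: cube_def mem_box_cart abs_le_iff algebra_simps)

lemma compact_cube: "compact (cube x d)"
  by (simp add: cube_def compact_cbox)

lemma cube_mono: "d \<le> e \<Longrightarrow> cube x d \<subseteq> cube x e"
  unfolding subset_iff mem_cube by (meson order_trans)

lemma sq_component_le_norm: "(x $ j)\<^sup>2 \<le> (norm (x::real^'n::finite))\<^sup>2"
  using component_le_norm_cart[of x j] by (metis abs_le_square_iff abs_norm_cancel)

text \<open>Antisymmetrising \<open>v\<close> about the hyperplane through \<open>x0\<close> orthogonal to the \<open>i\<close>-th axis gives a
  function vanishing there, which a quadratic barrier on the half cube controls (Brandt's method).\<close>

lemma interior_gradient_estimate:
  fixes v :: "real^'n::finite \<Rightarrow> real \<Rightarrow> real"
  assumes d: "d > 0" and r: "0 \<le> r" "r \<le> d"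
    and cont: "continuous_on (cube x0 d \<times> {t0 - d\<^sup>2..t0}) (\<lambda>(x,t). v x t)"
    and heat: "\<And>x t. x \<in> cube x0 d \<Longrightarrow> t0 - d\<^sup>2 \<le> t \<Longrightarrow> t \<le> t0 \<Longrightarrow> heat_at v x t (f x t)"
    and M: "\<And>x t. x \<in> cube x0 d \<Longrightarrow> t0 - d\<^sup>2 \<le> t \<Longrightarrow> t \<le> t0 \<Longrightarrow> \<bar>v x t\<bar> \<le> M"
    and F: "\<And>x t. x \<in> cube x0 d \<Longrightarrow> t0 - d\<^sup>2 \<le> t \<Longrightarrow> t \<le> t0 \<Longrightarrow> \<bar>f x t\<bar> \<le> F"
  shows "v (x0 + r *\<^sub>R axis i 1) t0 - v (x0 - r *\<^sub>R axis i 1) t0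
      \<le> r * (F * d + (2 * real CARD('n) + 3) * M / d)"
proof -
  let ?N = "real CARD('n)"
  let ?T = "{t0 - d\<^sup>2..t0}"
  define c where "c = x0 $ i"
  define R :: "real^'n \<Rightarrow> real^'n" where "R = (\<lambda>x. \<chi> j. if j = i then 2 * c - x $ j else x $ j)"
  define a :: "real^'n" where "a = (\<chi> j. if j = i then c else x0 $ j - d)"
  define b :: "real^'n" where "b = (\<chi> j. x0 $ j + d)"
  \<comment> \<open>\<open>k\<close> is tuned so that the heat operator of \<open>\<psi>\<close> is
    exactly \<open>2 * F\<close>, the most that the source of the antisymmetrised function can
    reach, after the quadratic summand has cost \<open>2 M / d^2 (2 N + 1)\<close>.\<close>
  define k where "k = F + M / d\<^sup>2 * (1 + 2 * ?N)"
  \<comment> \<open>On the outer faces and at the initial time the first summand alone reaches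
    \<open>2 * M\<close>, which bounds \<open>v x t - v (R x) t\<close>. The second is concave in
    \<open>x $ i\<close>, vanishes on the reflecting hyperplane and supplies the positive heat
    operator.\<close>
  define \<psi> where "\<psi> = (\<lambda>x t. 2 * M / d\<^sup>2 * ((norm (x - x0))\<^sup>2 - (t - t0)) + k * ((x $ i - c) * (d - (x $ i - c))))"
  have x0c: "x0 \<in> cube x0 d" using d by (auto simp: mem_cube)
  have M0: "M \<ge> 0" using M[OF x0c, of t0] by fastforce
  have F0: "F \<ge> 0" using F[OF x0c, of t0] by fastforce
  have k0: "k \<ge> 0" using M0 F0 by (auto simp: k_def)
  have sub: "cbox a b \<subseteq> cube x0 d"
  proof
    fix x assume x: "x \<in> cbox a b"
    show "x \<in> cube x0 d" unfolding mem_cube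
    proof
      fix j
      have "a $ j \<le> x $ j \<and> x $ j \<le> b $ j" using x by (auto simp: mem_box_cart)
      then show "\<bar>x $ j - x0 $ j\<bar> \<le> d" using d by (auto simp: a_def b_def c_def split: if_splits)
    qed
  qed
  have Rc: "R x \<in> cube x0 d" if "x \<in> cube x0 d" for x
    unfolding mem_cube
  proof
    fix j
    have "\<bar>x $ j - x0 $ j\<bar> \<le> d" using that by (auto simp: mem_cube)
    then show "\<bar>R x $ j - x0 $ j\<bar> \<le> d" by (auto simp: R_def c_def)
  qed
  have xi: "0 \<le> x $ i - c \<and> x $ i - c \<le> d" if "x \<in> cbox a b" for x
  proof -
    have "a $ i \<le> x $ i \<and> x $ i \<le> b $ i" using that by (auto simp: mem_box_cart)
    then show ?thesis by (auto simp: a_def b_def c_def)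
  qed
  have contR: "continuous_on A (\<lambda>z. R (fst z))" for A :: "((real^'n) \<times> real) set"
    unfolding R_def
  proof (rule continuous_on_vec_lambda)
    fix j show "continuous_on A (\<lambda>z. if j = i then 2 * c - fst z $ j else fst z $ j)"
      by (cases "j = i") (auto intro!: continuous_intros)
  qed
  have "v x t - v (R x) t - \<psi> x t \<le> 0" if "x \<in> cbox a b" "t0 - d\<^sup>2 \<le> t" "t \<le> t0" for x t
  proof (rule max_principle[where x = x and t = t and w = "\<lambda>x t. v x t - v (R x) t - \<psi> x t"
        and K = "cbox a b" and W = "box a b" and a = "t0 - d\<^sup>2" and b = t0])
    have 1: "continuous_on (cbox a b \<times> ?T) (\<lambda>z. (\<lambda>(x,t). v x t) z)"
      by (rule continuous_on_subset[OF cont]) (use sub in auto)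
    have 2: "continuous_on (cbox a b \<times> ?T) (\<lambda>z. (\<lambda>(x,t). v x t) (R (fst z), snd z))"
      by (rule continuous_on_compose2[OF cont])
         (use sub Rc in \<open>auto intro!: continuous_intros contR\<close>)
    have "continuous_on (cbox a b \<times> ?T)
        (\<lambda>z. (\<lambda>(x,t). v x t) z - (\<lambda>(x,t). v x t) (R (fst z), snd z) - \<psi> (fst z) (snd z))"
      unfolding \<psi>_def by (intro continuous_on_diff 1 2 continuous_intros)
    then show "continuous_on (cbox a b \<times> ?T) (\<lambda>(x,t). v x t - v (R x) t - \<psi> x t)"
      by (simp add: case_prod_beta)
  next
    fix x t assume x: "x \<in> cbox a b" and t: "t0 - d\<^sup>2 \<le> t" "t \<le> t0" and bd: "x \<notin> box a b \<or> t = t0 - d\<^sup>2"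
    have z: "v x t - v (R x) t \<le> 2 * M"
      using M[of x t] M[of "R x" t] x sub Rc[of x] t by (auto simp: abs_le_iff)
    have k1: "k * ((x $ i - c) * (d - (x $ i - c))) \<ge> 0" using k0 xi[OF x] by auto
    have "0 \<le> (norm (x - x0))\<^sup>2 - (t - t0)" using t by (smt (verit) zero_le_power2)
    then have p0: "\<psi> x t \<ge> 0" unfolding \<psi>_def using k1 M0 by (intro add_nonneg_nonneg[OF mult_nonneg_nonneg]) auto
    have big: "\<psi> x t \<ge> 2 * M" if "(norm (x - x0))\<^sup>2 - (t - t0) \<ge> d\<^sup>2"
    proof -
      have "2 * M / d\<^sup>2 * d\<^sup>2 \<le> 2 * M / d\<^sup>2 * ((norm (x - x0))\<^sup>2 - (t - t0))"
        using that M0 by (intro mult_left_mono) auto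
      then show ?thesis using k1 d by (auto simp: \<psi>_def)
    qed
    consider "t = t0 - d\<^sup>2" | "x \<notin> box a b" using bd by auto
    then show "v x t - v (R x) t - \<psi> x t \<le> 0"
    proof cases
      case 1 then show ?thesis using big z by auto
    next
      case 2
      then obtain j where j: "\<not> (a $ j < x $ j \<and> x $ j < b $ j)" by (auto simp: mem_box_cart)
      have j2: "a $ j \<le> x $ j \<and> x $ j \<le> b $ j" using x by (auto simp: mem_box_cart)
      show ?thesis
      proof (cases "j = i \<and> x $ i = c")
        case True
        then have "R x = x" by (auto simp: R_def vec_eq_iff)
        then show ?thesis using p0 by simp
      next
        case False
        then have "\<bar>x $ j - x0 $ j\<bar> = d" using j j2 d by (auto simp: a_def b_def c_def split: if_splits)
        then have "d\<^sup>2 = ((x - x0) $ j)\<^sup>2" using d by (metis power2_abs vector_minus_component)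
        then have "d\<^sup>2 \<le> (norm (x - x0))\<^sup>2" using sq_component_le_norm[of "x - x0" j] by simp
        then show ?thesis using big z t by auto
      qed
    qed
  next
    fix x t assume x: "x \<in> box a b" and t: "t0 - d\<^sup>2 < t" "t \<le> t0"
    have xc: "x \<in> cube x0 d" using x sub box_subset_cbox by blast
    have h1: "heat_at v x t (f x t)" using heat[OF xc] t by auto
    have "heat_at v (R x) t (f (R x) t)" using heat[OF Rc[OF xc]] t by auto
    from heat_at_flip[OF this[unfolded R_def]]
    have h2: "heat_at (\<lambda>x t. v (R x) t) x t (f (R x) t)" by (simp add: R_def)
    have h3: "heat_at (\<lambda>x t. t - t0) x t 1"
      by (rule heat_at_time) (auto intro!: derivative_eq_intros)
    have h4: "heat_at (\<lambda>x t. (x $ i - c) * (d - (x $ i - c))) x t (- (- 2))"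
      by (rule heat_at_coord[where g = "\<lambda>s. (s - c) * (d - (s - c))" and ?g1.0 = "\<lambda>s. d - 2 * (s - c)"])
         (auto intro!: derivative_eq_intros always_eventually)
    have h5: "heat_at \<psi> x t (2 * M / d\<^sup>2 * (- 2 * ?N - 1) + k * 2)"
      unfolding \<psi>_def
      using heat_at_add[OF heat_at_cmult[OF heat_at_diff[OF heat_at_sqdist h3]] heat_at_cmult[OF h4],
          of "2 * M / d\<^sup>2" x0 k]
      unfolding minus_minus .
    have e: "2 * M / d\<^sup>2 * (- 2 * ?N - 1) + k * 2 = 2 * F"
      using d by (simp add: k_def field_simps)
    have "f x t - f (R x) t - 2 * F \<le> 0"
      using F[OF xc, of t] F[OF Rc[OF xc], of t] t by auto
    then show "\<exists>f\<le>0. heat_at (\<lambda>x t. v x t - v (R x) t - \<psi> x t) x t f"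
      using heat_at_diff[OF heat_at_diff[OF h1 h2] h5] unfolding e by blast
  qed (use that in \<open>auto simp: box_subset_cbox\<close>)
  moreover have "x0 + r *\<^sub>R axis i 1 \<in> cbox a b"
    using r d by (auto simp: mem_box_cart a_def b_def c_def axis_def)
  moreover have "R (x0 + r *\<^sub>R axis i 1) = x0 - r *\<^sub>R axis i 1"
    by (auto simp: R_def vec_eq_iff axis_def c_def)
  ultimately have "v (x0 + r *\<^sub>R axis i 1) t0 - v (x0 - r *\<^sub>R axis i 1) t0 \<le> \<psi> (x0 + r *\<^sub>R axis i 1) t0"
    by (smt (verit) zero_le_power2)
  also have "\<psi> (x0 + r *\<^sub>R axis i 1) t0 = 2 * M / d\<^sup>2 * r\<^sup>2 + k * (r * (d - r))"
    by (simp add: \<psi>_def c_def)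
  also have "\<dots> \<le> 2 * M / d\<^sup>2 * (r * d) + k * (r * d)"
    using r k0 M0 by (intro add_mono mult_left_mono) (auto simp: power2_eq_square intro!: mult_left_mono)
  also have "\<dots> = r * (F * d + (2 * ?N + 3) * M / d)"
    using d by (simp add: k_def field_simps power2_eq_square)
  finally show ?thesis .
qed

text \<open>\<open>K\<close> need not be open, but \<open>heat_at\<close> looks at a full
  neighbourhood along each axis. Continuity of the gradient is included because it is what survives
  uniform approximation and becomes continuity of the gradient of a generalised solution.\<close>

definition caloric_on :: "((real^'n::finite) \<times> real) set \<Rightarrow> (real^'n \<Rightarrow> real \<Rightarrow> real) \<Rightarrow> (real^'n \<Rightarrow> real \<Rightarrow> real) \<Rightarrow> bool" where
  "caloric_on K v f \<longleftrightarrow> continuous_on K (\<lambda>(x,t). v x t) \<and>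
     (\<forall>(x,t)\<in>K. heat_at v x t (f x t)) \<and>
     (\<forall>i. continuous_on K (\<lambda>(x,t). pd i (\<lambda>y. v y t) x))"

text \<open>Generalised solutions of \<open>w\<^sub>t - \<Delta>w = F\<close>: a linear class, closed under locally uniform limits,
  to which the interior gradient estimate extends.\<close>

definition wsol :: "((real^'n::finite) \<times> real) set \<Rightarrow> (real^'n \<Rightarrow> real \<Rightarrow> real) \<Rightarrow> (real^'n \<Rightarrow> real \<Rightarrow> real) \<Rightarrow> bool" where
  "wsol U w F \<longleftrightarrow> (\<forall>K e. compact K \<and> K \<subseteq> U \<and> e > 0 \<longrightarrow>
     (\<exists>v f. caloric_on K v f \<and> (\<forall>(x,t)\<in>K. \<bar>v x t - w x t\<bar> \<le> e \<and> \<bar>f x t - F x t\<bar> \<le> e)))"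

lemma heat_at_pd:
  assumes "heat_at v x t f"
  shows "((\<lambda>r. v (x + r *\<^sub>R axis i 1) t) has_real_derivative pd i (\<lambda>y. v y t) x) (at 0)"
proof -
  obtain g where "\<forall>\<^sub>F r in nhds 0. ((\<lambda>r. v (x + r *\<^sub>R axis i 1) t) has_real_derivative g r) (at r)"
    using assms unfolding heat_at_def by blast
  then have "((\<lambda>r. v (x + r *\<^sub>R axis i 1) t) has_real_derivative g 0) (at 0)"
    by (rule eventually_nhds_x_imp_x)
  then show ?thesis unfolding pd_def by (simp add: DERIV_imp_deriv)
qed

lemma caloric_on_subset: "caloric_on K v f \<Longrightarrow> L \<subseteq> K \<Longrightarrow> caloric_on L v f"
  unfolding caloric_on_def by (blast intro: continuous_on_subset)

lemma caloric_on_heat: "caloric_on K v f \<Longrightarrow> (x,t) \<in> K \<Longrightarrow> heat_at v x t (f x t)"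
  unfolding caloric_on_def by blast

lemma wsolE:
  assumes "wsol U w F" "compact K" "K \<subseteq> U" "e > 0"
  obtains v f where "caloric_on K v f" "\<And>x t. (x,t) \<in> K \<Longrightarrow> \<bar>v x t - w x t\<bar> \<le> e"
    "\<And>x t. (x,t) \<in> K \<Longrightarrow> \<bar>f x t - F x t\<bar> \<le> e"
proof -
  have "\<exists>v f. caloric_on K v f \<and> (\<forall>(x,t)\<in>K. \<bar>v x t - w x t\<bar> \<le> e \<and> \<bar>f x t - F x t\<bar> \<le> e)"
    using assms unfolding wsol_def by simp
  then show ?thesis using that by blast
qed

lemma caloric_on_cmult:
  assumes "caloric_on K v f"
  shows "caloric_on K (\<lambda>x t. c * v x t) (\<lambda>x t. c * f x t)"
  unfolding caloric_on_def
proof (intro conjI allI)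
  show "continuous_on K (\<lambda>(x,t). c * v x t)"
    using assms unfolding caloric_on_def case_prod_beta by (auto intro!: continuous_intros)
  show "\<forall>(x,t)\<in>K. heat_at (\<lambda>x t. c * v x t) x t (c * f x t)"
    using assms unfolding caloric_on_def by (auto intro: heat_at_cmult)
  fix i
  have C: "continuous_on K (\<lambda>z. c * (case z of (x,t) \<Rightarrow> pd i (\<lambda>y. v y t) x))"
    using assms unfolding caloric_on_def by (intro continuous_intros) auto
  have E: "pd i (\<lambda>y. c * v y t) x = c * pd i (\<lambda>y. v y t) x" if "(x,t) \<in> K" for x t
    using heat_at_pd[OF caloric_on_heat[OF assms that], of i]
    unfolding pd_def by (intro DERIV_imp_deriv DERIV_cmult)
  show "continuous_on K (\<lambda>(x,t). pd i (\<lambda>y. c * v y t) x)"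
    by (rule continuous_on_eq[OF C]) (auto simp: E)
qed

lemma caloric_on_diff:
  assumes "caloric_on K v f" "caloric_on K w h"
  shows "caloric_on K (\<lambda>x t. v x t - w x t) (\<lambda>x t. f x t - h x t)"
  unfolding caloric_on_def
proof (intro conjI allI)
  show "continuous_on K (\<lambda>(x,t). v x t - w x t)"
    using assms unfolding caloric_on_def case_prod_beta by (auto intro!: continuous_intros)
  show "\<forall>(x,t)\<in>K. heat_at (\<lambda>x t. v x t - w x t) x t (f x t - h x t)"
    using assms unfolding caloric_on_def by (auto intro: heat_at_diff)
  fix i
  have C: "continuous_on K (\<lambda>z. (case z of (x,t) \<Rightarrow> pd i (\<lambda>y. v y t) x) - (case z of (x,t) \<Rightarrow> pd i (\<lambda>y. w y t) x))"
    using assms unfolding caloric_on_def by (intro continuous_intros) auto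
  have E: "pd i (\<lambda>y. v y t - w y t) x = pd i (\<lambda>y. v y t) x - pd i (\<lambda>y. w y t) x" if "(x,t) \<in> K" for x t
    using heat_at_pd[OF caloric_on_heat[OF assms(1) that], of i] heat_at_pd[OF caloric_on_heat[OF assms(2) that], of i]
    unfolding pd_def by (intro DERIV_imp_deriv DERIV_diff)
  show "continuous_on K (\<lambda>(x,t). pd i (\<lambda>y. v y t - w y t) x)"
    by (rule continuous_on_eq[OF C]) (auto simp: E)
qed

lemma caloric_on_shift:
  assumes v: "caloric_on L v f" and L: "\<And>x t. (x,t) \<in> K \<Longrightarrow> (x + h, t + a) \<in> L"
  shows "caloric_on K (\<lambda>x t. v (x + h) (t + a)) (\<lambda>x t. f (x + h) (t + a))"
  unfolding caloric_on_def
proof (intro conjI allI)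
  have s: "continuous_on K (\<lambda>z. (fst z + h, snd z + a))" by (intro continuous_intros)
  have im: "(\<lambda>z. (fst z + h, snd z + a)) ` K \<subseteq> L" using L by auto
  show "continuous_on K (\<lambda>(x,t). v (x + h) (t + a))"
    using continuous_on_compose2[OF _ s im, of "\<lambda>(x,t). v x t"] v
    by (auto simp: caloric_on_def case_prod_beta)
  show "\<forall>(x,t)\<in>K. heat_at (\<lambda>x t. v (x + h) (t + a)) x t (f (x + h) (t + a))"
    using caloric_on_heat[OF v L] by (auto intro!: heat_at_shift)
  fix i
  have e: "pd i (\<lambda>y. v (y + h) (t + a)) x = pd i (\<lambda>y. v y (t + a)) (x + h)" for x t
    unfolding pd_def by (simp add: add_ac)
  show "continuous_on K (\<lambda>(x,t). pd i (\<lambda>y. v (y + h) (t + a)) x)"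
    unfolding e using continuous_on_compose2[OF _ s im, of "\<lambda>(x,t). pd i (\<lambda>y. v y t) x"] v
    by (auto simp: caloric_on_def case_prod_beta)
qed

text \<open>\<open>- v\<close> obeys the same bounds as \<open>v\<close>, so the one-sided estimate
  becomes two-sided, for \<open>r\<close> of either sign.\<close>

lemma caloric_lipschitz:
  fixes v :: "real^'n::finite \<Rightarrow> real \<Rightarrow> real"
  assumes d: "d > 0" and r: "\<bar>r\<bar> \<le> d"
    and v: "caloric_on (cube y d \<times> {t - d\<^sup>2..t}) v f"
    and M: "\<And>x s. x \<in> cube y d \<Longrightarrow> t - d\<^sup>2 \<le> s \<Longrightarrow> s \<le> t \<Longrightarrow> \<bar>v x s\<bar> \<le> M"
    and F: "\<And>x s. x \<in> cube y d \<Longrightarrow> t - d\<^sup>2 \<le> s \<Longrightarrow> s \<le> t \<Longrightarrow> \<bar>f x s\<bar> \<le> F"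
  shows "\<bar>v (y + r *\<^sub>R axis i 1) t - v (y - r *\<^sub>R axis i 1) t\<bar> \<le> \<bar>r\<bar> * (F * d + (2 * real CARD('n) + 3) * M / d)"
proof -
  have 1: "v (y + \<bar>r\<bar> *\<^sub>R axis i 1) t - v (y - \<bar>r\<bar> *\<^sub>R axis i 1) t \<le> \<bar>r\<bar> * (F * d + (2 * real CARD('n) + 3) * M / d)"
    by (rule interior_gradient_estimate[where f = f]) (use assms in \<open>auto simp: caloric_on_def\<close>)
  have 2: "(-1) * v (y + \<bar>r\<bar> *\<^sub>R axis i 1) t - (-1) * v (y - \<bar>r\<bar> *\<^sub>R axis i 1) t \<le> \<bar>r\<bar> * (F * d + (2 * real CARD('n) + 3) * M / d)"
    by (rule interior_gradient_estimate[where f = "\<lambda>x t. (-1) * f x t"])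
       (use assms caloric_on_cmult[OF v, of "-1"] in \<open>auto simp: caloric_on_def\<close>)
  show ?thesis using 1 2 by (cases "r \<ge> 0") (auto simp: abs_le_iff)
qed

text \<open>The half-side \<open>2 * d\<close> leaves room for the cubes of half-side
  \<open>d\<close> around all points within \<open>d\<close> of the centre, on which the gradient
  estimate is applied.\<close>

lemma compact_cylinder_neighbourhood:
  fixes K :: "((real^'n::finite) \<times> real) set"
  assumes "compact K" "open U" "K \<subseteq> U"
  obtains d L where "0 < d" "d \<le> 1" "compact L" "K \<subseteq> L" "L \<subseteq> U"
    "\<And>x t y s. (x,t) \<in> K \<Longrightarrow> y \<in> cube x (2 * d) \<Longrightarrow> \<bar>s - t\<bar> \<le> d \<Longrightarrow> (y,s) \<in> L"
proof -
  let ?N = "real CARD('n)"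
  obtain e where e: "e > 0" "(\<Union>x\<in>K. cball x e) \<subseteq> U"
    using compact_subset_open_imp_cball_epsilon_subset[OF assms] by metis
  \<comment> \<open>A cube of half-side \<open>2 * d\<close> lies in a ball of radius
    \<open>2 N d\<close> (by the l1 norm), and the time offset adds \<open>d\<close>; the sum must
    not exceed \<open>e\<close>.\<close>
  define d where "d = min 1 (e / (2 * ?N + 1))"
  have d: "0 < d" "d \<le> 1" using e(1) by (auto simp: d_def intro!: divide_pos_pos)
  have "d \<le> e / (2 * ?N + 1)" by (simp add: d_def)
  then have de: "2 * ?N * d + d \<le> e" by (simp add: field_simps add_pos_nonneg pos_le_divide_eq)
  show ?thesis
  proof (rule that[OF d compact_minkowski_sum_cball[OF assms(1)] _ e(2)])
    show "K \<subseteq> (\<Union>x\<in>K. cball x e)" using e(1) by (auto intro!: bexI)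
    fix x t y s assume a: "(x,t) \<in> K" "y \<in> cube x (2 * d)" "\<bar>s - t\<bar> \<le> d"
    have "norm (x - y) \<le> (\<Sum>j\<in>UNIV. \<bar>(x - y) $ j\<bar>)" by (rule norm_le_l1_cart)
    also have "\<dots> \<le> (\<Sum>j\<in>(UNIV::'n set). 2 * d)"
      using a(2) by (intro sum_mono) (auto simp: mem_cube abs_minus_commute)
    finally have n: "norm (x - y) \<le> 2 * ?N * d" by simp
    have "dist (x,t) (y,s) \<le> dist x y + dist t s"
      unfolding dist_Pair_Pair by (rule sqrt_sum_squares_le_sum) auto
    also have "\<dots> \<le> e" using n a(3) de by (auto simp: dist_norm abs_minus_commute)
    finally show "(y,s) \<in> (\<Union>x\<in>K. cball x e)" using a(1) by (auto simp: dist_commute)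
  qed
qed

lemma continuous_on_uniform_approx:
  fixes f :: "'a::topological_space \<Rightarrow> real"
  assumes "\<And>e. e > 0 \<Longrightarrow> \<exists>g. continuous_on K g \<and> (\<forall>z\<in>K. \<bar>g z - f z\<bar> \<le> e)"
  shows "continuous_on K f"
proof -
  have "\<forall>n. \<exists>g. continuous_on K g \<and> (\<forall>z\<in>K. \<bar>g z - f z\<bar> \<le> inverse (real (Suc n)))"
    by (intro allI assms) simp
  then obtain g where g: "\<And>n. continuous_on K (g n)" "\<And>n z. z \<in> K \<Longrightarrow> \<bar>g n z - f z\<bar> \<le> inverse (real (Suc n))"
    by metis
  have "uniform_limit K g f sequentially"
    unfolding uniform_limit_iff
  proof (intro allI impI)
    fix e :: real assume "e > 0"
    then have "\<forall>\<^sub>F n in sequentially. inverse (real (Suc n)) < e"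
      using LIMSEQ_inverse_real_of_nat by (auto intro: order_tendstoD)
    then show "\<forall>\<^sub>F n in sequentially. \<forall>z\<in>K. dist (g n z) (f z) < e"
      by eventually_elim (use g(2) in \<open>fastforce simp: dist_real_def intro: le_less_trans\<close>)
  qed
  then show ?thesis by (rule uniform_limit_theorem[rotated]) (auto simp: g)
qed

lemma continuous_on_open_compactI:
  fixes f :: "'a::euclidean_space \<Rightarrow> real"
  assumes "open U" "\<And>K. compact K \<Longrightarrow> K \<subseteq> U \<Longrightarrow> continuous_on K f"
  shows "continuous_on U f"
proof (rule continuous_at_imp_continuous_on, rule ballI)
  fix z assume "z \<in> U"
  then obtain e where e: "e > 0" "cball z e \<subseteq> U" using \<open>open U\<close> open_contains_cball by blast
  show "isCont f z"
    by (rule continuous_on_interior[OF assms(2)[OF compact_cball e(2)]]) (use e in \<open>auto simp: interior_cball\<close>)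
qed

section \<open>Derivatives of generalised solutions in space\<close>

text \<open>The last clause is the gain: uniform closeness becomes closeness of increments. A finer
  approximant \<open>v'\<close> differs from \<open>v\<close> by a caloric function that is small
  and has a small source, hence a small gradient; letting \<open>v'\<close> tend to \<open>w\<close>
  transfers the bound to \<open>w - v\<close>.\<close>

lemma wsol_caloric_approx:
  fixes w :: "real^'n::finite \<Rightarrow> real \<Rightarrow> real"
  assumes U: "open U" and w: "wsol U w F" and K: "compact K" "K \<subseteq> U" and e: "e > 0"
  obtains v f d where "d > 0" "caloric_on K v f"
    "\<And>x t. (x,t) \<in> K \<Longrightarrow> \<bar>v x t - w x t\<bar> \<le> e"
    "\<And>x t. (x,t) \<in> K \<Longrightarrow> \<bar>f x t - F x t\<bar> \<le> e"
    "\<And>x t i r. (x,t) \<in> K \<Longrightarrow> \<bar>r\<bar> \<le> d \<Longrightarrow>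
       \<bar>(w (x + r *\<^sub>R axis i 1) t - v (x + r *\<^sub>R axis i 1) t) - (w x t - v x t)\<bar> \<le> e * \<bar>r\<bar>"
proof -
  let ?N = "real CARD('n)"
  obtain d L where d: "0 < d" "d \<le> 1" and L: "compact L" "K \<subseteq> L" "L \<subseteq> U"
    "\<And>x t y s. (x,t) \<in> K \<Longrightarrow> y \<in> cube x (2 * d) \<Longrightarrow> \<bar>s - t\<bar> \<le> d \<Longrightarrow> (y,s) \<in> L"
    using compact_cylinder_neighbourhood[OF K(1) U K(2)] by metis
  \<comment> \<open>\<open>B\<close> is the constant of the gradient estimate for unit bounds on
    function and source; \<open>\<eta>\<close> is scaled so that an error \<open>\<eta>\<close>
    costs a slope of at most \<open>e\<close>.\<close>
  define B where "B = d + (2 * ?N + 3) / d"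
  have B: "B > 0" using d by (auto simp: B_def intro!: add_pos_pos divide_pos_pos)
  define \<eta> where "\<eta> = min e (e / B)"
  have \<eta>: "0 < \<eta>" "\<eta> \<le> e" "\<eta> * B \<le> e" using e B by (auto simp: \<eta>_def min_def field_simps)
  obtain v f where v: "caloric_on L v f" "\<And>x t. (x,t) \<in> L \<Longrightarrow> \<bar>v x t - w x t\<bar> \<le> \<eta>"
    "\<And>x t. (x,t) \<in> L \<Longrightarrow> \<bar>f x t - F x t\<bar> \<le> \<eta>"
    using wsolE[OF w L(1,3) \<eta>(1)] by blast
  show ?thesis
  proof (rule that[OF d(1) caloric_on_subset[OF v(1) L(2)]])
    fix x t assume xt: "(x,t) \<in> K"
    show "\<bar>v x t - w x t\<bar> \<le> e" "\<bar>f x t - F x t\<bar> \<le> e" using v(2,3) xt L(2) \<eta> by force+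
    fix i r assume r: "\<bar>r\<bar> \<le> d"
    let ?X = "\<bar>(w (x + r *\<^sub>R axis i 1) t - v (x + r *\<^sub>R axis i 1) t) - (w x t - v x t)\<bar>"
    \<comment> \<open>The gradient estimate compares points symmetric about a centre, so it is
      applied around the midpoint of the segment.\<close>
    define y where "y = x + (r/2) *\<^sub>R axis i 1"
    have cy: "cube y d \<subseteq> cube x (2 * d)"
    proof
      fix z assume z: "z \<in> cube y d"
      show "z \<in> cube x (2 * d)" unfolding mem_cube
      proof
        fix j have "\<bar>z $ j - y $ j\<bar> \<le> d" using z by (auto simp: mem_cube)
        then show "\<bar>z $ j - x $ j\<bar> \<le> 2 * d" using r d
          by (auto simp: y_def axis_def split: if_splits)
      qed
    qed
    have "d\<^sup>2 \<le> d" using d by (simp add: power2_eq_square mult_left_le)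
    then have cyl: "cube y d \<times> {t - d\<^sup>2..t} \<subseteq> L" using L(4)[OF xt] cy by auto
    have 1: "?X \<le> e * \<bar>r\<bar> / 2 + \<delta> * (B + 2)" if \<delta>: "\<delta> > 0" for \<delta>
    proof -
      obtain v' f' where v': "caloric_on L v' f'" "\<And>x t. (x,t) \<in> L \<Longrightarrow> \<bar>v' x t - w x t\<bar> \<le> \<delta>"
        "\<And>x t. (x,t) \<in> L \<Longrightarrow> \<bar>f' x t - F x t\<bar> \<le> \<delta>"
        using wsolE[OF w L(1,3) \<delta>] by blast
      have "\<bar>(v' (y + (r/2) *\<^sub>R axis i 1) t - v (y + (r/2) *\<^sub>R axis i 1) t)
            - (v' (y - (r/2) *\<^sub>R axis i 1) t - v (y - (r/2) *\<^sub>R axis i 1) t)\<bar>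
          \<le> \<bar>r/2\<bar> * ((\<delta> + \<eta>) * d + (2 * ?N + 3) * (\<delta> + \<eta>) / d)"
      proof (rule caloric_lipschitz[OF d(1)])
        show "\<bar>r/2\<bar> \<le> d" using r d by auto
        show "caloric_on (cube y d \<times> {t - d\<^sup>2..t}) (\<lambda>x t. v' x t - v x t) (\<lambda>x t. f' x t - f x t)"
          by (rule caloric_on_subset[OF caloric_on_diff[OF v'(1) v(1)] cyl])
        fix z s assume "z \<in> cube y d" "t - d\<^sup>2 \<le> s" "s \<le> t"
        then have "(z,s) \<in> L" using cyl by auto
        then show "\<bar>v' z s - v z s\<bar> \<le> \<delta> + \<eta>" "\<bar>f' z s - f z s\<bar> \<le> \<delta> + \<eta>"
          using v(2,3) v'(2,3) by (smt (verit))+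
      qed
      moreover have "(\<delta> + \<eta>) * d + (2 * ?N + 3) * (\<delta> + \<eta>) / d = (\<delta> + \<eta>) * B"
        using d by (simp add: B_def field_simps)
      moreover have "y + (r/2) *\<^sub>R axis i 1 = x + r *\<^sub>R axis i 1" "y - (r/2) *\<^sub>R axis i 1 = x"
        by (auto simp: y_def vec_eq_iff)
      ultimately have "\<bar>(v' (x + r *\<^sub>R axis i 1) t - v (x + r *\<^sub>R axis i 1) t) - (v' x t - v x t)\<bar>
          \<le> \<bar>r/2\<bar> * ((\<delta> + \<eta>) * B)" by simp
      also have "\<dots> = \<bar>r/2\<bar> * (\<delta> * B) + \<bar>r/2\<bar> * (\<eta> * B)" by (simp add: algebra_simps)
      \<comment> \<open>The \<open>\<delta>\<close> part may lose its factor \<open>|r|\<close>,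
        since \<open>\<delta>\<close> tends to 0 while \<open>r\<close> stays fixed; the
        \<open>\<eta>\<close> part has to keep it.\<close>
      also have "\<dots> \<le> 1 * (\<delta> * B) + \<bar>r/2\<bar> * e"
        using r d \<delta> B \<eta> by (intro add_mono mult_right_mono mult_left_mono) auto
      finally have "\<bar>(v' (x + r *\<^sub>R axis i 1) t - v (x + r *\<^sub>R axis i 1) t) - (v' x t - v x t)\<bar>
          \<le> \<delta> * B + \<bar>r\<bar> / 2 * e" by simp
      moreover have "(x + r *\<^sub>R axis i 1, t) \<in> L"
        by (rule L(4)[OF xt]) (use r d in \<open>auto simp: mem_cube axis_def\<close>)
      then have "\<bar>v' (x + r *\<^sub>R axis i 1) t - w (x + r *\<^sub>R axis i 1) t\<bar> \<le> \<delta>" by (rule v')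
      moreover have "\<bar>v' x t - w x t\<bar> \<le> \<delta>" using v'(2) xt L(2) by auto
      ultimately show ?thesis by (simp add: algebra_simps abs_le_iff)
    qed
    have "?X \<le> e * \<bar>r\<bar> / 2"
    proof (rule field_le_epsilon)
      fix \<epsilon> :: real assume "\<epsilon> > 0"
      then show "?X \<le> e * \<bar>r\<bar> / 2 + \<epsilon>" using 1[of "\<epsilon> / (B + 2)"] B by auto
    qed
    also have "\<dots> \<le> e * \<bar>r\<bar>" using e by simp
    finally show "?X \<le> e * \<bar>r\<bar>" .
  qed
qed

lemma DERIV_close:
  fixes u v :: "real \<Rightarrow> real"
  assumes "(u has_real_derivative a) (at 0)" "(v has_real_derivative b) (at 0)" "d > 0"
    and "\<And>r. \<bar>r\<bar> \<le> d \<Longrightarrow> \<bar>(u r - v r) - (u 0 - v 0)\<bar> \<le> e * \<bar>r\<bar>"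
  shows "\<bar>a - b\<bar> \<le> e"
proof -
  have "((\<lambda>r. u r - v r) has_real_derivative (a - b)) (at 0)" using assms(1,2) by (rule DERIV_diff)
  then have "((\<lambda>r. ((u r - v r) - (u 0 - v 0)) / (r - 0)) \<longlongrightarrow> a - b) (at 0)"
    by (simp add: has_field_derivative_iff)
  then have "((\<lambda>r. \<bar>((u r - v r) - (u 0 - v 0)) / (r - 0)\<bar>) \<longlongrightarrow> \<bar>a - b\<bar>) (at 0)"
    by (rule tendsto_rabs)
  moreover have "\<forall>\<^sub>F r in at 0. \<bar>((u r - v r) - (u 0 - v 0)) / (r - 0)\<bar> \<le> e"
    unfolding eventually_at
    by (intro exI[of _ d] conjI assms(3))
       (use assms(4) in \<open>auto simp: dist_real_def pos_divide_le_eq abs_divide\<close>)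
  ultimately show ?thesis by (rule tendsto_upperbound) auto
qed

text \<open>By \<open>DERIV_close\<close> the derivatives of ever better first-order approximants
  form a Cauchy sequence, and its limit is the derivative. No candidate has to be known in
  advance.\<close>

lemma differentiable_if_close:
  fixes w :: "real \<Rightarrow> real"
  assumes "\<And>e. e > 0 \<Longrightarrow> \<exists>v b d. (v has_real_derivative b) (at 0) \<and> d > 0 \<and>
      (\<forall>r. \<bar>r\<bar> \<le> d \<longrightarrow> \<bar>(w r - v r) - (w 0 - v 0)\<bar> \<le> e * \<bar>r\<bar>)"
  shows "w differentiable (at 0)"
proof -
  have "\<forall>n. \<exists>v b d. (v has_real_derivative b) (at 0) \<and> d > 0 \<and>
      (\<forall>r. \<bar>r\<bar> \<le> d \<longrightarrow> \<bar>(w r - v r) - (w 0 - v 0)\<bar> \<le> inverse (real (Suc n)) * \<bar>r\<bar>)"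
    by (intro allI assms) simp
  then obtain v b d where v: "\<And>n. (v n has_real_derivative b n) (at 0)" "\<And>n. d n > 0"
    "\<And>n r. \<bar>r\<bar> \<le> d n \<Longrightarrow> \<bar>(w r - v n r) - (w 0 - v n 0)\<bar> \<le> inverse (real (Suc n)) * \<bar>r\<bar>"
    by metis
  have bb: "\<bar>b n - b m\<bar> \<le> inverse (real (Suc n)) + inverse (real (Suc m))" for n m
  proof (rule DERIV_close[OF v(1)[of n] v(1)[of m], of "min (d n) (d m)"])
    show "min (d n) (d m) > 0" using v(2) by simp
    fix r assume "\<bar>r\<bar> \<le> min (d n) (d m)"
    then have "\<bar>(w r - v n r) - (w 0 - v n 0)\<bar> \<le> inverse (real (Suc n)) * \<bar>r\<bar>"
       "\<bar>(w r - v m r) - (w 0 - v m 0)\<bar> \<le> inverse (real (Suc m)) * \<bar>r\<bar>"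
      by (intro v(3); simp)+
    then show "\<bar>v n r - v m r - (v n 0 - v m 0)\<bar> \<le> (inverse (real (Suc n)) + inverse (real (Suc m))) * \<bar>r\<bar>"
      unfolding distrib_right by linarith
  qed
  have "Cauchy b"
    unfolding Cauchy_def dist_real_def
  proof (intro allI impI)
    fix e :: real assume "e > 0"
    then obtain N where N: "inverse (real (Suc N)) < e / 2" using reals_Archimedean[of "e/2"] by auto
    have "\<bar>b m - b n\<bar> < e" if "m \<ge> N" "n \<ge> N" for m n
    proof -
      have "inverse (real (Suc m)) \<le> inverse (real (Suc N))" "inverse (real (Suc n)) \<le> inverse (real (Suc N))"
        using that by (auto intro!: le_imp_inverse_le)
      then show ?thesis using bb[of m n] N by linarith
    qed
    then show "\<exists>N. \<forall>m\<ge>N. \<forall>n\<ge>N. \<bar>b m - b n\<bar> < e" by blast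
  qed
  then obtain l where l: "b \<longlonglongrightarrow> l" using Cauchy_convergent_iff convergent_def by blast
  have "(w has_real_derivative l) (at 0)"
    unfolding has_field_derivative_iff
  proof (rule LIM_I)
    fix e :: real assume e: "e > 0"
    have "\<forall>\<^sub>F n in sequentially. inverse (real (Suc n)) < e / 3"
      by (rule order_tendstoD[OF LIMSEQ_inverse_real_of_nat]) (use e in simp)
    moreover have "\<forall>\<^sub>F n in sequentially. \<bar>b n - l\<bar> < e / 3"
      using tendstoD[OF l, of "e/3"] e by (auto simp: dist_real_def)
    ultimately obtain n where n: "inverse (real (Suc n)) < e / 3" "\<bar>b n - l\<bar> < e / 3"
      using eventually_happens'[OF _ eventually_conj] by (metis (no_types, lifting) sequentially_bot)
    have "((\<lambda>r. (v n r - v n 0) / (r - 0)) \<longlongrightarrow> b n) (at 0)"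
      using v(1)[of n] by (simp add: has_field_derivative_iff)
    from LIM_D[OF this, of "e/3"] e obtain s where s: "s > 0"
      "\<And>r. r \<noteq> 0 \<Longrightarrow> \<bar>r\<bar> < s \<Longrightarrow> \<bar>(v n r - v n 0) / r - b n\<bar> < e / 3" by auto
    show "\<exists>s>0. \<forall>r. r \<noteq> 0 \<and> norm (r - 0) < s \<longrightarrow> norm ((w r - w 0) / (r - 0) - l) < e"
    proof (intro exI[of _ "min s (d n)"] conjI allI impI)
      show "0 < min s (d n)" using s v(2) by simp
      fix r :: real assume r: "r \<noteq> 0 \<and> norm (r - 0) < min s (d n)"
      have "\<bar>((w r - v n r) - (w 0 - v n 0)) / r\<bar> \<le> inverse (real (Suc n))"
        using v(3)[of r n] r by (auto simp: abs_divide pos_divide_le_eq)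
      moreover have "(w r - w 0) / r = ((w r - v n r) - (w 0 - v n 0)) / r + (v n r - v n 0) / r"
        using r by (simp add: field_simps)
      moreover have "\<bar>(v n r - v n 0) / r - b n\<bar> < e / 3" using s(2)[of r] r by simp
      ultimately have "\<bar>(w r - w 0) / r - l\<bar> < e" using n by linarith
      then show "norm ((w r - w 0) / (r - 0) - l) < e" by simp
    qed
  qed
  then show ?thesis using real_differentiable_def by blast
qed

definition has_pd :: "'n::finite \<Rightarrow> ((real^'n) \<times> real) set \<Rightarrow> (real^'n \<Rightarrow> real \<Rightarrow> real) \<Rightarrow> (real^'n \<Rightarrow> real \<Rightarrow> real) \<Rightarrow> bool" where
  "has_pd i U w G \<longleftrightarrow> (\<forall>(x,t)\<in>U. ((\<lambda>r. w (x + r *\<^sub>R axis i 1) t) has_real_derivative G x t) (at 0)) \<and>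
     continuous_on U (\<lambda>(x,t). G x t)"

lemma wsol_continuous:
  assumes U: "open U" and w: "wsol U w F"
  shows "continuous_on U (\<lambda>(x,t). w x t)"
proof (rule continuous_on_open_compactI[OF U])
  fix K assume K: "compact K" "K \<subseteq> U"
  show "continuous_on K (\<lambda>(x,t). w x t)"
  proof (rule continuous_on_uniform_approx)
    fix e :: real assume "e > 0"
    from wsolE[OF w K this] obtain v f where "caloric_on K v f"
      "\<And>x t. (x,t) \<in> K \<Longrightarrow> \<bar>v x t - w x t\<bar> \<le> e" by metis
    then show "\<exists>g. continuous_on K g \<and> (\<forall>z\<in>K. \<bar>g z - (case z of (x,t) \<Rightarrow> w x t)\<bar> \<le> e)"
      by (intro exI[of _ "\<lambda>(x,t). v x t"]) (auto simp: caloric_on_def)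
  qed
qed

text \<open>Existence uses approximants at a single point, viewed as a compact set; continuity uses
  them on a general compact set, where their continuous gradients are uniformly close to that of
  \<open>w\<close>.\<close>

lemma wsol_has_pd:
  assumes U: "open U" and w: "wsol U w F"
  shows "has_pd i U w (\<lambda>x t. pd i (\<lambda>y. w y t) x)"
proof -
  have D: "((\<lambda>r. w (x + r *\<^sub>R axis i 1) t) has_real_derivative pd i (\<lambda>y. w y t) x) (at 0)"
    if xt: "(x,t) \<in> U" for x t
  proof -
    have "(\<lambda>r. w (x + r *\<^sub>R axis i 1) t) differentiable (at 0)"
    proof (rule differentiable_if_close)
      fix e :: real assume e: "e > 0"
      have "compact {(x,t)}" "{(x,t)} \<subseteq> U" using xt by auto
      from wsol_caloric_approx[OF U w this e]
      obtain v f d where v: "d > 0" "caloric_on {(x,t)} v f"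
        "\<And>y s i r. (y,s) \<in> {(x,t)} \<Longrightarrow> \<bar>r\<bar> \<le> d \<Longrightarrow>
           \<bar>(w (y + r *\<^sub>R axis i 1) s - v (y + r *\<^sub>R axis i 1) s) - (w y s - v y s)\<bar> \<le> e * \<bar>r\<bar>"
        by metis
      show "\<exists>v b d. (v has_real_derivative b) (at 0) \<and> d > 0 \<and>
         (\<forall>r. \<bar>r\<bar> \<le> d \<longrightarrow> \<bar>w (x + r *\<^sub>R axis i 1) t - v r - (w (x + 0 *\<^sub>R axis i 1) t - v 0)\<bar> \<le> e * \<bar>r\<bar>)"
        by (rule exI[of _ "\<lambda>r. v (x + r *\<^sub>R axis i 1) t"], rule exI, rule exI[of _ d])
           (use v(1,3) heat_at_pd[OF caloric_on_heat[OF v(2)], of x t i] in auto)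
    qed
    then show ?thesis
      unfolding pd_def by (simp add: DERIV_deriv_iff_real_differentiable)
  qed
  moreover have "continuous_on U (\<lambda>(x,t). pd i (\<lambda>y. w y t) x)"
  proof (rule continuous_on_open_compactI[OF U], rule continuous_on_uniform_approx)
    fix K and e :: real assume K: "compact K" "K \<subseteq> U" and e: "e > 0"
    obtain v f d where v: "d > 0" "caloric_on K v f"
      "\<And>y s i r. (y,s) \<in> K \<Longrightarrow> \<bar>r\<bar> \<le> d \<Longrightarrow>
         \<bar>(w (y + r *\<^sub>R axis i 1) s - v (y + r *\<^sub>R axis i 1) s) - (w y s - v y s)\<bar> \<le> e * \<bar>r\<bar>"
      using wsol_caloric_approx[OF U w K e] by metis
    have "\<bar>pd i (\<lambda>y. v y t) x - pd i (\<lambda>y. w y t) x\<bar> \<le> e" if xt: "(x,t) \<in> K" for x t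
    proof (rule DERIV_close[OF heat_at_pd[OF caloric_on_heat[OF v(2) xt]] D v(1)])
      show "(x,t) \<in> U" using xt K by auto
      fix r assume "\<bar>r\<bar> \<le> d"
      from v(3)[OF xt this, of i]
      show "\<bar>v (x + r *\<^sub>R axis i 1) t - w (x + r *\<^sub>R axis i 1) t
          - (v (x + 0 *\<^sub>R axis i 1) t - w (x + 0 *\<^sub>R axis i 1) t)\<bar> \<le> e * \<bar>r\<bar>"
        by simp
    qed
    then show "\<exists>g. continuous_on K g \<and> (\<forall>z\<in>K. \<bar>g z - (case z of (x,t) \<Rightarrow> pd i (\<lambda>y. w y t) x)\<bar> \<le> e)"
      using v(2) by (intro exI[of _ "\<lambda>(x,t). pd i (\<lambda>y. v y t) x"]) (auto simp: caloric_on_def)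
  qed
  ultimately show ?thesis unfolding has_pd_def by auto
qed

lemma has_pd_DERIV:
  assumes "has_pd i U g G" "(x + s *\<^sub>R axis i 1, t) \<in> U"
  shows "((\<lambda>r. g (x + r *\<^sub>R axis i 1) t) has_real_derivative G (x + s *\<^sub>R axis i 1) t) (at s)"
proof -
  have "((\<lambda>r. g (x + s *\<^sub>R axis i 1 + r *\<^sub>R axis i 1) t) has_real_derivative G (x + s *\<^sub>R axis i 1) t) (at 0)"
    using assms unfolding has_pd_def by blast
  then have "((\<lambda>r. g (x + (r + s) *\<^sub>R axis i 1) t) has_real_derivative G (x + s *\<^sub>R axis i 1) t) (at 0)"
    by (simp add: scaleR_add_left add_ac)
  then show ?thesis
    using DERIV_shift[of "\<lambda>r. g (x + r *\<^sub>R axis i 1) t" _ 0 s] by simp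
qed

text \<open>The mean value theorem turns the quotient into a nearby value of \<open>G\<close>, and
  uniform continuity of \<open>G\<close> on \<open>L\<close> makes the error uniform.\<close>

lemma has_pd_difference_quotient:
  fixes g :: "real^'n::finite \<Rightarrow> real \<Rightarrow> real"
  assumes g: "has_pd i U g G" and L: "compact L" "L \<subseteq> U" and e: "e > 0"
  obtains d where "d > 0"
    "\<And>x t h. 0 < h \<Longrightarrow> h < d \<Longrightarrow> (\<And>r. \<bar>r\<bar> \<le> h \<Longrightarrow> (x + r *\<^sub>R axis i 1, t) \<in> L) \<Longrightarrow>
      \<bar>(g (x + h *\<^sub>R axis i 1) t - g (x - h *\<^sub>R axis i 1) t) / (2 * h) - G x t\<bar> \<le> e"
proof -
  have "uniformly_continuous_on L (\<lambda>(x,t). G x t)"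
    using g L unfolding has_pd_def by (blast intro: compact_uniformly_continuous continuous_on_subset)
  then obtain d where d: "d > 0"
    "\<And>z z'. z \<in> L \<Longrightarrow> z' \<in> L \<Longrightarrow> dist z' z < d \<Longrightarrow> dist (case z' of (x,t) \<Rightarrow> G x t) (case z of (x,t) \<Rightarrow> G x t) < e"
    unfolding uniformly_continuous_on_def using e by metis
  show ?thesis
  proof (rule that[OF d(1)])
    fix x t h assume h: "0 < h" "h < d" and xL: "\<And>r. \<bar>r\<bar> \<le> h \<Longrightarrow> (x + r *\<^sub>R axis i 1, t) \<in> L"
    have "\<exists>z>-h. z < h \<and> g (x + h *\<^sub>R axis i 1) t - g (x + (- h) *\<^sub>R axis i 1) t = (h - (- h)) * G (x + z *\<^sub>R axis i 1) t"
      by (rule MVT2) (use h xL L in \<open>auto intro!: has_pd_DERIV[OF g] simp del: scaleR_minus_left\<close>)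
    then obtain z where z: "- h < z" "z < h"
      "g (x + h *\<^sub>R axis i 1) t - g (x + (- h) *\<^sub>R axis i 1) t = (h - (- h)) * G (x + z *\<^sub>R axis i 1) t" by blast
    have 1: "(x + z *\<^sub>R axis i 1, t) \<in> L" using xL[of z] z by auto
    have 2: "(x, t) \<in> L" using xL[of 0] h by auto
    have "dist (x + z *\<^sub>R axis i 1, t) (x, t) < d"
      using z h by (simp add: dist_Pair_Pair dist_norm)
    from d(2)[OF 2 1 this] have "\<bar>G (x + z *\<^sub>R axis i 1) t - G x t\<bar> < e" by (simp add: dist_real_def)
    moreover have "(g (x + h *\<^sub>R axis i 1) t - g (x - h *\<^sub>R axis i 1) t) / (2 * h) = G (x + z *\<^sub>R axis i 1) t"
      using z(3) h by (simp add: field_simps)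
    ultimately show "\<bar>(g (x + h *\<^sub>R axis i 1) t - g (x - h *\<^sub>R axis i 1) t) / (2 * h) - G x t\<bar> \<le> e"
      by simp
  qed
qed

text \<open>The equation is differentiated through symmetric difference quotients of the
  approximants: these are caloric again, whereas nothing is known about the derivatives of an
  approximant as solutions.\<close>

lemma wsol_pd:
  fixes w :: "real^'n::finite \<Rightarrow> real \<Rightarrow> real"
  assumes U: "open U" and w: "wsol U w F" and F: "has_pd i U F G"
  shows "wsol U (\<lambda>x t. pd i (\<lambda>y. w y t) x) G"
  unfolding wsol_def
proof (intro allI impI, elim conjE)
  fix K and e :: real assume K: "compact K" "K \<subseteq> U" and e: "e > 0"
  obtain d L where d: "0 < d" "d \<le> 1" and L: "compact L" "K \<subseteq> L" "L \<subseteq> U"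
    "\<And>x t y s. (x,t) \<in> K \<Longrightarrow> y \<in> cube x (2 * d) \<Longrightarrow> \<bar>s - t\<bar> \<le> d \<Longrightarrow> (y,s) \<in> L"
    using compact_cylinder_neighbourhood[OF K(1) U K(2)] by metis
  have seg: "(x + r *\<^sub>R axis i 1, t) \<in> L" if "(x,t) \<in> K" "\<bar>r\<bar> \<le> d" for x t r
    by (rule L(4)[OF that(1)]) (use that d in \<open>auto simp: mem_cube axis_def\<close>)
  have e2: "e / 2 > 0" using e by simp
  obtain d1 where d1: "d1 > 0"
    "\<And>x t h. 0 < h \<Longrightarrow> h < d1 \<Longrightarrow> (\<And>r. \<bar>r\<bar> \<le> h \<Longrightarrow> (x + r *\<^sub>R axis i 1, t) \<in> L) \<Longrightarrow>
      \<bar>(w (x + h *\<^sub>R axis i 1) t - w (x - h *\<^sub>R axis i 1) t) / (2 * h) - pd i (\<lambda>y. w y t) x\<bar> \<le> e / 2"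
    using has_pd_difference_quotient[OF wsol_has_pd[OF U w, of i] L(1,3) e2] by blast
  obtain d2 where d2: "d2 > 0"
    "\<And>x t h. 0 < h \<Longrightarrow> h < d2 \<Longrightarrow> (\<And>r. \<bar>r\<bar> \<le> h \<Longrightarrow> (x + r *\<^sub>R axis i 1, t) \<in> L) \<Longrightarrow>
      \<bar>(F (x + h *\<^sub>R axis i 1) t - F (x - h *\<^sub>R axis i 1) t) / (2 * h) - G x t\<bar> \<le> e / 2"
    using has_pd_difference_quotient[OF F L(1,3) e2] by blast
  define h where "h = min d (min d1 d2) / 2"
  have h: "0 < h" "h < d" "h < d1" "h < d2" using d d1(1) d2(1) by (auto simp: h_def)
  \<comment> \<open>The order matters: \<open>h\<close> is fixed first, from the derivatives of
    \<open>w\<close> and \<open>F\<close>. The approximant is then taken so close that division by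
    \<open>2 * h\<close> leaves an error of at most \<open>e / 2\<close>.\<close>
  have "e * h / 2 > 0" using e h by simp
  from wsolE[OF w L(1,3) this] obtain v f where v: "caloric_on L v f"
    "\<And>x t. (x,t) \<in> L \<Longrightarrow> \<bar>v x t - w x t\<bar> \<le> e * h / 2" "\<And>x t. (x,t) \<in> L \<Longrightarrow> \<bar>f x t - F x t\<bar> \<le> e * h / 2"
    by metis
  define Q where "Q = (\<lambda>(u::real^'n \<Rightarrow> real \<Rightarrow> real) x t. 1 / (2 * h) * (u (x + h *\<^sub>R axis i 1) (t + 0) - u (x + (- h) *\<^sub>R axis i 1) (t + 0)))"
  have c: "caloric_on K (Q v) (Q f)"
    unfolding Q_def
    by (intro caloric_on_cmult caloric_on_diff caloric_on_shift[OF v(1)]) (use seg h in \<open>auto simp del: scaleR_minus_left\<close>)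
  have Qd: "\<bar>Q u x t - Q u' x t\<bar> \<le> e / 2"
    if u: "\<And>x t. (x,t) \<in> L \<Longrightarrow> \<bar>u x t - u' x t\<bar> \<le> e * h / 2" and xt: "(x,t) \<in> K" for u u' x t
  proof -
    have "\<bar>u (x + h *\<^sub>R axis i 1) t - u' (x + h *\<^sub>R axis i 1) t\<bar> \<le> e * h / 2"
      "\<bar>u (x + (- h) *\<^sub>R axis i 1) t - u' (x + (- h) *\<^sub>R axis i 1) t\<bar> \<le> e * h / 2"
      using h by (intro u seg[OF xt]; simp)+
    then have "\<bar>(u (x + h *\<^sub>R axis i 1) t - u (x + (- h) *\<^sub>R axis i 1) t)
        - (u' (x + h *\<^sub>R axis i 1) t - u' (x + (- h) *\<^sub>R axis i 1) t)\<bar> \<le> e * h" by linarith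
    moreover have "Q u x t - Q u' x t = ((u (x + h *\<^sub>R axis i 1) t - u (x + (- h) *\<^sub>R axis i 1) t)
        - (u' (x + h *\<^sub>R axis i 1) t - u' (x + (- h) *\<^sub>R axis i 1) t)) / (2 * h)"
      by (simp add: Q_def diff_divide_distrib)
    ultimately show ?thesis using h by (simp add: abs_divide pos_divide_le_eq mult.commute)
  qed
  have Qw: "Q u x t = (u (x + h *\<^sub>R axis i 1) t - u (x - h *\<^sub>R axis i 1) t) / (2 * h)" for u x t
    by (simp add: Q_def)
  have "\<bar>Q v x t - pd i (\<lambda>y. w y t) x\<bar> \<le> e \<and> \<bar>Q f x t - G x t\<bar> \<le> e" if xt: "(x,t) \<in> K" for x t
  proof -
    have s: "\<And>r. \<bar>r\<bar> \<le> h \<Longrightarrow> (x + r *\<^sub>R axis i 1, t) \<in> L" using seg[OF xt] h by auto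
    have "\<bar>Q w x t - pd i (\<lambda>y. w y t) x\<bar> \<le> e / 2" "\<bar>Q F x t - G x t\<bar> \<le> e / 2"
      unfolding Qw using d1(2)[OF h(1,3) s] d2(2)[OF h(1,4) s] by auto
    then show ?thesis using Qd[of v w, OF v(2) xt] Qd[of f F, OF v(3) xt] by (intro conjI; linarith)
  qed
  then show "\<exists>v f. caloric_on K v f \<and> (\<forall>(x,t)\<in>K. \<bar>v x t - pd i (\<lambda>y. w y t) x\<bar> \<le> e \<and> \<bar>f x t - G x t\<bar> \<le> e)"
    using c by blast
qed

section \<open>Regularity of generalised solutions\<close>

text \<open>Two times occur so that a profile frozen at time \<open>s\<close> can serve as a barrier
  at every later time.\<close>

lemma heat_at_has_pd:
  fixes u v :: "real^'n::finite \<Rightarrow> real \<Rightarrow> real"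
  assumes U: "open U" "(x,s) \<in> U"
    and W: "\<And>i. has_pd i U v (W i)" "\<And>i. has_pd i U (W i) (WW i)"
    and p: "((\<lambda>s. u x s) has_real_derivative p) (at t)"
    and uv: "\<And>y. u y t = v y s"
  shows "heat_at u x t (p - (\<Sum>i\<in>UNIV. WW i x s))"
proof (rule heat_atI[where g = "\<lambda>i r. W i (x + r *\<^sub>R axis i 1) s" and A = "\<lambda>i. WW i x s" and p = p])
  show "((\<lambda>s. u x s) has_real_derivative p) (at t)" by (rule p)
  fix i
  have "isCont (\<lambda>r. (x + r *\<^sub>R axis i (1::real), s)) 0" by (intro continuous_intros)
  from isCont_eventually_nhds[OF this eventually_nhds_in_open[OF U]]
  have "\<forall>\<^sub>F r in nhds 0. (x + r *\<^sub>R axis i 1, s) \<in> U" by simp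
  then show "\<forall>\<^sub>F r in nhds 0. ((\<lambda>r. u (x + r *\<^sub>R axis i 1) t) has_real_derivative W i (x + r *\<^sub>R axis i 1) s) (at r)"
    by eventually_elim (unfold uv, rule has_pd_DERIV[OF W(1)])
  show "((\<lambda>r. W i (x + r *\<^sub>R axis i 1) s) has_real_derivative WW i x s) (at 0)"
    using has_pd_DERIV[OF W(2), of x 0 i s] U by simp
qed simp

text \<open>The comparison function is \<open>g\<close> plus linear growth plus
  \<open>m / \<rho>^2 (|x - x0|^2 + 2 N (\<tau> - s))\<close>. The last term reaches
  \<open>m\<close> on the faces, where only the weak bound \<open>lat\<close> is available, yet at
  the centre it costs just \<open>2 N m (t - s) / \<rho>^2\<close>.\<close>

lemma time_barrier:
  fixes v :: "real^'n::finite \<Rightarrow> real \<Rightarrow> real"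
  assumes st: "s \<le> t" and \<rho>: "\<rho> > 0" and m: "m \<ge> 0"
    and cont: "continuous_on (cube x0 \<rho> \<times> {s..t}) (\<lambda>(x,t). v x t)" "continuous_on (cube x0 \<rho>) g"
    and heat: "\<And>x \<tau>. x \<in> cube x0 \<rho> \<Longrightarrow> s \<le> \<tau> \<Longrightarrow> \<tau> \<le> t \<Longrightarrow> heat_at v x \<tau> (f x \<tau>)"
    and F: "\<And>x \<tau>. x \<in> cube x0 \<rho> \<Longrightarrow> s \<le> \<tau> \<Longrightarrow> \<tau> \<le> t \<Longrightarrow> f x \<tau> \<le> F"
    and g: "\<And>x \<tau>. x \<in> cube x0 \<rho> \<Longrightarrow> \<exists>l\<le>D. heat_at (\<lambda>x t. g x) x \<tau> (- l)"
    and init: "\<And>x. x \<in> cube x0 \<rho> \<Longrightarrow> v x s \<le> g x"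
    and lat: "\<And>x \<tau>. x \<in> cube x0 \<rho> \<Longrightarrow> s \<le> \<tau> \<Longrightarrow> \<tau> \<le> t \<Longrightarrow> v x \<tau> \<le> g x + (\<tau> - s) * (F + D) + m"
  shows "v x0 t \<le> g x0 + (t - s) * (F + D + 2 * real CARD('n) * m / \<rho>\<^sup>2)"
proof -
  let ?N = "real CARD('n)"
  define a :: "real^'n" where "a = (\<chi> j. x0 $ j - \<rho>)"
  define b :: "real^'n" where "b = (\<chi> j. x0 $ j + \<rho>)"
  have cb: "cube x0 \<rho> = cbox a b" by (simp add: cube_def a_def b_def)
  have x0: "x0 \<in> cube x0 \<rho>" using \<rho> by (simp add: mem_cube)
  define w where "w = (\<lambda>x \<tau>. v x \<tau> - (g x + (\<tau> - s) * (F + D) + m / \<rho>\<^sup>2 * ((norm (x - x0))\<^sup>2 + 2 * ?N * (\<tau> - s))))"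
  have "w x0 t \<le> 0"
  proof (rule max_principle[where x = x0 and t = t and K = "cbox a b" and W = "box a b" and a = s and b = t])
    have "continuous_on (cube x0 \<rho> \<times> {s..t}) (\<lambda>z. g (fst z))"
      by (rule continuous_on_compose2[OF cont(2)]) (auto intro!: continuous_intros)
    then have "continuous_on (cube x0 \<rho> \<times> {s..t}) (\<lambda>z. (case z of (x,t) \<Rightarrow> v x t) -
       (g (fst z) + (snd z - s) * (F + D) + m / \<rho>\<^sup>2 * ((norm (fst z - x0))\<^sup>2 + 2 * ?N * (snd z - s))))"
      by (intro continuous_intros cont(1))
    then show "continuous_on (cbox a b \<times> {s..t}) (\<lambda>(x,t). w x t)"
      by (simp add: w_def case_prod_beta cb)
  next
    fix x \<tau> assume x: "x \<in> cbox a b" and \<tau>: "s \<le> \<tau>" "\<tau> \<le> t" and bd: "x \<notin> box a b \<or> \<tau> = s"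
    have xc: "x \<in> cube x0 \<rho>" using x cb by simp
    show "w x \<tau> \<le> 0"
    proof (cases "\<tau> = s")
      case True
      have "m / \<rho>\<^sup>2 * (norm (x - x0))\<^sup>2 \<ge> 0" using m by auto
      then show ?thesis using init[OF xc] True by (auto simp: w_def)
    next
      case False
      then obtain j where j: "\<not> (a $ j < x $ j \<and> x $ j < b $ j)" using bd by (auto simp: mem_box_cart)
      have "a $ j \<le> x $ j \<and> x $ j \<le> b $ j" using x by (auto simp: mem_box_cart)
      then have "\<bar>x $ j - x0 $ j\<bar> = \<rho>" using j \<rho> by (auto simp: a_def b_def)
      then have "\<rho>\<^sup>2 = ((x - x0) $ j)\<^sup>2" by (metis power2_abs vector_minus_component)
      then have "\<rho>\<^sup>2 \<le> (norm (x - x0))\<^sup>2 + 2 * ?N * (\<tau> - s)"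
        using sq_component_le_norm[of "x - x0" j] \<tau> by (simp add: add_increasing2)
      then have "m / \<rho>\<^sup>2 * \<rho>\<^sup>2 \<le> m / \<rho>\<^sup>2 * ((norm (x - x0))\<^sup>2 + 2 * ?N * (\<tau> - s))"
        using m by (intro mult_left_mono) auto
      moreover have "m / \<rho>\<^sup>2 * \<rho>\<^sup>2 = m" using \<rho> by simp
      ultimately show ?thesis using lat[OF xc \<tau>] by (simp add: w_def)
    qed
  next
    fix x \<tau> assume x: "x \<in> box a b" and \<tau>: "s < \<tau>" "\<tau> \<le> t"
    have xc: "x \<in> cube x0 \<rho>" using x cb box_subset_cbox by blast
    obtain l where l: "l \<le> D" "heat_at (\<lambda>x t. g x) x \<tau> (- l)" using g[OF xc] by blast
    have h1: "heat_at (\<lambda>x \<tau>. (\<tau> - s) * (F + D)) x \<tau> (F + D)"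
      by (rule heat_at_time) (auto intro!: derivative_eq_intros)
    have h2: "heat_at (\<lambda>x \<tau>. 2 * ?N * (\<tau> - s)) x \<tau> (2 * ?N)"
      by (rule heat_at_time) (auto intro!: derivative_eq_intros)
    have "heat_at w x \<tau> (f x \<tau> - (- l + (F + D) + m / \<rho>\<^sup>2 * (- 2 * ?N + 2 * ?N)))"
      unfolding w_def
      by (intro heat_at_diff heat_at_add heat_at_cmult heat l h1 h2 heat_at_sqdist) (use xc \<tau> in auto)
    moreover have "f x \<tau> - (- l + (F + D) + m / \<rho>\<^sup>2 * (- 2 * ?N + 2 * ?N)) \<le> 0"
      using F[OF xc, of \<tau>] \<tau> l by auto
    ultimately show "\<exists>f\<le>0. heat_at w x \<tau> f" by blast
  qed (use st x0 in \<open>auto simp: box_subset_cbox cb\<close>)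
  moreover have "(t - s) * (F + D) + m / \<rho>\<^sup>2 * (2 * ?N * (t - s)) = (t - s) * (F + D + 2 * ?N * m / \<rho>\<^sup>2)"
    by (simp add: algebra_simps diff_divide_distrib)
  ultimately show ?thesis by (simp add: w_def)
qed

lemma wsol_minus:
  assumes "wsol U w F"
  shows "wsol U (\<lambda>x t. - w x t) (\<lambda>x t. - F x t)"
  unfolding wsol_def
proof (intro allI impI, elim conjE)
  fix K and e :: real assume K: "compact K" "K \<subseteq> U" "e > 0"
  from wsolE[OF assms this] obtain v f where v: "caloric_on K v f"
    "\<And>x t. (x,t) \<in> K \<Longrightarrow> \<bar>v x t - w x t\<bar> \<le> e" "\<And>x t. (x,t) \<in> K \<Longrightarrow> \<bar>f x t - F x t\<bar> \<le> e" by metis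
  have "caloric_on K (\<lambda>x t. - v x t) (\<lambda>x t. - f x t)"
    using caloric_on_cmult[OF v(1), of "-1"] by simp
  then show "\<exists>v f. caloric_on K v f \<and> (\<forall>(x,t)\<in>K. \<bar>v x t - - w x t\<bar> \<le> e \<and> \<bar>f x t - - F x t\<bar> \<le> e)"
    using v(2,3)
    by (intro exI[of _ "\<lambda>x t. - v x t"] exI[of _ "\<lambda>x t. - f x t"]) (auto simp: abs_minus_commute)
qed

lemma has_pd_minus:
  assumes "has_pd i U w G"
  shows "has_pd i U (\<lambda>x t. - w x t) (\<lambda>x t. - G x t)"
  using assms unfolding has_pd_def case_prod_beta by (auto intro!: DERIV_minus continuous_on_minus)

text \<open>Uniform closeness of approximants says nothing about time derivatives. The barrier
  therefore starts from \<open>w x s\<close> itself, whose Laplacian is already known to be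
  continuous. The bound holds for all \<open>s \<le> t\<close> in the window, so both one-sided
  quotients at \<open>t0\<close> are covered.\<close>

lemma wsol_time_increment_le:
  fixes w :: "real^'n::finite \<Rightarrow> real \<Rightarrow> real"
  assumes U: "open U" "(x0,t0) \<in> U" and w: "wsol U w F"
    and W: "\<And>i. has_pd i U w (W i)" "\<And>i. has_pd i U (W i) (WW i)"
    and F: "continuous_on U (\<lambda>(x,t). F x t)" and e: "e > 0"
  obtains \<delta> where "\<delta> > 0"
    "\<And>s t. t0 - \<delta> \<le> s \<Longrightarrow> s \<le> t \<Longrightarrow> t \<le> t0 + \<delta> \<Longrightarrow>
      w x0 t - w x0 s \<le> (t - s) * ((\<Sum>i\<in>UNIV. WW i x0 t0) + F x0 t0 + e)"
proof -
  let ?N = "real CARD('n)"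
  define S where "S = (\<lambda>(x,t). \<Sum>i\<in>UNIV. WW i x t)"
  \<comment> \<open>Four equal shares: two for the source (variation of \<open>F\<close> and its
    approximation), one for the variation of the Laplacian, one for the faces of the cube.\<close>
  define e' where "e' = e / 4"
  have e': "e' > 0" using e by (simp add: e'_def)
  have S: "continuous_on U S"
    using W(2) unfolding S_def has_pd_def case_prod_beta by (auto intro!: continuous_intros)
  define V where "V = {z\<in>U. S z < S (x0,t0) + e' \<and> (case z of (x,t) \<Rightarrow> F x t) < F x0 t0 + e'}"
  have "V = {z\<in>U. S z \<in> {..<S (x0,t0) + e'}} \<inter> {z\<in>U. (case z of (x,t) \<Rightarrow> F x t) \<in> {..<F x0 t0 + e'}}"
    by (auto simp: V_def)
  moreover have "open {z\<in>U. S z \<in> {..<S (x0,t0) + e'}}"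
    using continuous_open_preimage[OF S U(1), of "{..<S (x0,t0) + e'}"] by (simp add: vimage_def Int_def)
  moreover have "open {z\<in>U. (case z of (x,t) \<Rightarrow> F x t) \<in> {..<F x0 t0 + e'}}"
    using continuous_open_preimage[OF F U(1), of "{..<F x0 t0 + e'}"] by (simp add: vimage_def Int_def)
  ultimately have oV: "open V" by auto
  have zV: "{(x0,t0)} \<subseteq> V" using U e' by (auto simp: V_def)
  obtain d L where d: "0 < d" "d \<le> 1" and L: "compact L" "L \<subseteq> V"
    "\<And>y s. y \<in> cube x0 (2 * d) \<Longrightarrow> \<bar>s - t0\<bar> \<le> d \<Longrightarrow> (y,s) \<in> L"
    using compact_cylinder_neighbourhood[OF _ oV zV] by (metis compact_sing insertI1)
  have LU: "L \<subseteq> U" using L(2) by (auto simp: V_def)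
  \<comment> \<open>With this \<open>m\<close> the slope \<open>2 N m / d^2\<close> caused by the
    faces equals \<open>e'\<close>.\<close>
  define m where "m = e' * d\<^sup>2 / (2 * ?N)"
  have m: "m > 0" using e' d by (simp add: m_def)
  have contw: "continuous_on L (\<lambda>(x,t). w x t)"
    using wsol_continuous[OF U(1) w] LU by (rule continuous_on_subset)
  then have "uniformly_continuous_on L (\<lambda>(x,t). w x t)" using L(1) by (intro compact_uniformly_continuous)
  then obtain d1 where d1: "d1 > 0"
    "\<And>z z'. z \<in> L \<Longrightarrow> z' \<in> L \<Longrightarrow> dist z' z < d1 \<Longrightarrow> dist (case z' of (x,t) \<Rightarrow> w x t) (case z of (x,t) \<Rightarrow> w x t) < m/2"
    unfolding uniformly_continuous_on_def using m by (metis half_gt_zero)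
  define B where "B = (F x0 t0 + 2 * e') + (S (x0,t0) + e')"
  \<comment> \<open>Within the window both the variation of \<open>w\<close> in time and the linear
    growth \<open>(\<tau> - s) * B\<close> stay below \<open>m / 2\<close>, which gives the lateral
    bound required by \<open>time_barrier\<close>.\<close>
  define \<delta> where "\<delta> = min d (min (d1/3) (m / (4 * (\<bar>B\<bar> + 1))))"
  have \<delta>: "\<delta> > 0" "\<delta> \<le> d" "2 * \<delta> < d1" using d d1(1) m by (auto simp: \<delta>_def)
  have "\<delta> \<le> m / (4 * (\<bar>B\<bar> + 1))" by (simp add: \<delta>_def)
  then have "\<delta> * (4 * (\<bar>B\<bar> + 1)) \<le> m" by (simp add: pos_le_divide_eq)
  then have \<delta>B: "2 * \<delta> * \<bar>B\<bar> \<le> m / 2" using \<delta>(1) by (simp add: algebra_simps)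
  have cc: "cube x0 d \<subseteq> cube x0 (2 * d)" by (rule cube_mono) (use d in simp)
  show ?thesis
  proof (rule that[OF \<delta>(1)])
    fix s t assume st: "t0 - \<delta> \<le> s" "s \<le> t" "t \<le> t0 + \<delta>"
    have inL: "(x,\<tau>) \<in> L" if "x \<in> cube x0 d" "s \<le> \<tau>" "\<tau> \<le> t" for x \<tau>
      using L(3)[of x \<tau>] that st \<delta> cc by auto
    have x0: "x0 \<in> cube x0 d" using d by (simp add: mem_cube)
    have main: "w x0 t \<le> w x0 s + (t - s) * (B + e') + 2 * \<eta>" if \<eta>: "0 < \<eta>" "\<eta> \<le> e'" for \<eta>
    proof -
      from wsolE[OF w L(1) LU \<eta>(1)] obtain v f where v: "caloric_on L v f"
        "\<And>x t. (x,t) \<in> L \<Longrightarrow> \<bar>v x t - w x t\<bar> \<le> \<eta>" "\<And>x t. (x,t) \<in> L \<Longrightarrow> \<bar>f x t - F x t\<bar> \<le> \<eta>" by metis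
      have "v x0 t \<le> (w x0 s + \<eta>) + (t - s) * ((F x0 t0 + 2 * e') + (S (x0,t0) + e') + 2 * ?N * m / d\<^sup>2)"
      proof (rule time_barrier[where f = f and g = "\<lambda>x. w x s + \<eta>", OF st(2) d(1)])
        show "0 \<le> m" using m by simp
        have "cube x0 d \<times> {s..t} \<subseteq> L" using inL by auto
        then show "continuous_on (cube x0 d \<times> {s..t}) (\<lambda>(x,t). v x t)"
          using v(1) unfolding caloric_on_def by (blast intro: continuous_on_subset)
        have "continuous_on (cube x0 d) (\<lambda>x. (\<lambda>(x,t). w x t) (x, s))"
          by (rule continuous_on_compose2[OF contw]) (use inL st in \<open>auto intro!: continuous_intros\<close>)
        then show "continuous_on (cube x0 d) (\<lambda>x. w x s + \<eta>)" by (auto intro!: continuous_intros)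
      next
        fix x \<tau> assume x: "x \<in> cube x0 d" and \<tau>: "s \<le> \<tau>" "\<tau> \<le> t"
        note xL = inL[OF x \<tau>]
        have xs: "(x,s) \<in> L" using inL[OF x] st by auto
        show "heat_at v x \<tau> (f x \<tau>)" by (rule caloric_on_heat[OF v(1) xL])
        have "F x \<tau> < F x0 t0 + e'" using xL L(2) by (auto simp: V_def)
        then show "f x \<tau> \<le> F x0 t0 + 2 * e'" using v(3)[OF xL] \<eta> by (simp add: abs_le_iff)
        have "dist (x,\<tau>) (x,s) < d1" using \<tau> st \<delta> by (simp add: dist_Pair_Pair dist_real_def)
        from d1(2)[OF xs xL this] have "\<bar>w x \<tau> - w x s\<bar> < m / 2" by (simp add: dist_real_def)
        then have "w x \<tau> \<le> w x s + m / 2" by linarith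
        moreover have "\<bar>(\<tau> - s) * B\<bar> \<le> 2 * \<delta> * \<bar>B\<bar>"
          unfolding abs_mult using \<tau> st by (intro mult_right_mono) auto
        ultimately have "w x \<tau> \<le> w x s + (\<tau> - s) * B + m" using \<delta>B by linarith
        then show "v x \<tau> \<le> w x s + \<eta> + (\<tau> - s) * (F x0 t0 + 2 * e' + (S (x0,t0) + e')) + m"
          using v(2)[OF xL] unfolding B_def by (simp add: abs_le_iff)
      next
        fix x assume x: "x \<in> cube x0 d"
        show "v x s \<le> w x s + \<eta>" using v(2)[of x s] inL[OF x, of s] st by (auto simp: abs_le_iff)
      next
        fix x \<tau> assume x: "x \<in> cube x0 d"
        have xs: "(x,s) \<in> L" using inL[OF x] st by auto
        have "heat_at (\<lambda>x t. w x s) x \<tau> (0 - (\<Sum>i\<in>UNIV. WW i x s))"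
          by (rule heat_at_has_pd[OF U(1) _ W]) (use xs LU in auto)
        from heat_at_add[OF this heat_at_const[of \<eta>]]
        have "heat_at (\<lambda>x t. w x s + \<eta>) x \<tau> (- S (x,s))" by (simp add: S_def)
        moreover have "S (x,s) \<le> S (x0,t0) + e'" using xs L(2) by (auto simp: V_def)
        ultimately show "\<exists>l\<le>S (x0,t0) + e'. heat_at (\<lambda>x t. w x s + \<eta>) x \<tau> (- l)" by blast
      qed
      moreover have "2 * ?N * m / d\<^sup>2 = e'" using d by (simp add: m_def)
      moreover have "w x0 t \<le> v x0 t + \<eta>" using v(2)[OF inL[OF x0, of t]] st by (auto simp: abs_le_iff)
      ultimately show ?thesis by (simp add: B_def)
    qed
    have "w x0 t \<le> w x0 s + (t - s) * (B + e')"
    proof (rule field_le_epsilon)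
      fix \<epsilon> :: real assume "\<epsilon> > 0"
      then show "w x0 t \<le> w x0 s + (t - s) * (B + e') + \<epsilon>"
        using main[of "min e' (\<epsilon>/2)"] e' by auto
    qed
    then show "w x0 t - w x0 s \<le> (t - s) * ((\<Sum>i\<in>UNIV. WW i x0 t0) + F x0 t0 + e)"
      by (simp add: B_def S_def e'_def algebra_simps)
  qed
qed

lemma wsol_time_derivative:
  fixes w :: "real^'n::finite \<Rightarrow> real \<Rightarrow> real"
  assumes U: "open U" "(x0,t0) \<in> U" and w: "wsol U w F"
    and W: "\<And>i. has_pd i U w (W i)" "\<And>i. has_pd i U (W i) (WW i)"
    and F: "continuous_on U (\<lambda>(x,t). F x t)"
  shows "((\<lambda>s. w x0 s) has_real_derivative ((\<Sum>i\<in>UNIV. WW i x0 t0) + F x0 t0)) (at t0)"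
proof -
  let ?A = "(\<Sum>i\<in>UNIV. WW i x0 t0) + F x0 t0"
  show ?thesis
    unfolding has_field_derivative_iff
  proof (rule LIM_I)
    fix e :: real assume e: "e > 0"
    then have e2: "e / 2 > 0" by simp
    have F': "continuous_on U (\<lambda>(x,t). - F x t)" using F unfolding case_prod_beta by (rule continuous_on_minus)
    obtain d1 where d1: "d1 > 0" "\<And>s t. t0 - d1 \<le> s \<Longrightarrow> s \<le> t \<Longrightarrow> t \<le> t0 + d1 \<Longrightarrow>
        w x0 t - w x0 s \<le> (t - s) * (?A + e/2)"
      using wsol_time_increment_le[OF U w W F e2] by blast
    obtain d2 where d2: "d2 > 0" "\<And>s t. t0 - d2 \<le> s \<Longrightarrow> s \<le> t \<Longrightarrow> t \<le> t0 + d2 \<Longrightarrow>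
        - w x0 t - - w x0 s \<le> (t - s) * ((\<Sum>i\<in>UNIV. - WW i x0 t0) + - F x0 t0 + e/2)"
      using wsol_time_increment_le[OF U wsol_minus[OF w] has_pd_minus[OF W(1)] has_pd_minus[OF W(2)] F' e2] by blast
    show "\<exists>s>0. \<forall>t. t \<noteq> t0 \<and> norm (t - t0) < s \<longrightarrow> norm ((w x0 t - w x0 t0) / (t - t0) - ?A) < e"
    proof (intro exI[of _ "min d1 d2"] conjI allI impI)
      show "min d1 d2 > 0" using d1 d2 by simp
      fix t assume t: "t \<noteq> t0 \<and> norm (t - t0) < min d1 d2"
      have "\<bar>(w x0 t - w x0 t0) / (t - t0) - ?A\<bar> \<le> e / 2"
      proof (cases "t > t0")
        case True
        have "w x0 t - w x0 t0 \<le> (t - t0) * (?A + e/2)" using d1(2)[of t0 t] t True by auto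
        moreover have "w x0 t - w x0 t0 \<ge> (t - t0) * (?A - e/2)"
          using d2(2)[of t0 t] t True by (auto simp: sum_negf algebra_simps)
        ultimately have "(w x0 t - w x0 t0) / (t - t0) \<le> ?A + e/2" "(w x0 t - w x0 t0) / (t - t0) \<ge> ?A - e/2"
          using True by (simp_all add: pos_divide_le_eq pos_le_divide_eq mult.commute)
        then show ?thesis by linarith
      next
        case False
        then have lt: "t < t0" using t by auto
        have "w x0 t0 - w x0 t \<le> (t0 - t) * (?A + e/2)" using d1(2)[of t t0] t lt by auto
        moreover have "w x0 t0 - w x0 t \<ge> (t0 - t) * (?A - e/2)"
          using d2(2)[of t t0] t lt by (auto simp: sum_negf algebra_simps)
        ultimately have "(w x0 t0 - w x0 t) / (t0 - t) \<le> ?A + e/2" "(w x0 t0 - w x0 t) / (t0 - t) \<ge> ?A - e/2"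
          using lt by (simp_all add: pos_divide_le_eq pos_le_divide_eq mult.commute)
        moreover have "(w x0 t - w x0 t0) / (t - t0) = (w x0 t0 - w x0 t) / (t0 - t)"
          using lt by (metis minus_diff_eq minus_divide_divide)
        ultimately show ?thesis by linarith
      qed
      then show "norm ((w x0 t - w x0 t0) / (t - t0) - ?A) < e" using e by simp
    qed
  qed
qed

text \<open>A bootstrap in two rounds: the first derivatives of \<open>w\<close> are continuous, so
  \<open>f (w x t)\<close> can be differentiated in space; by \<open>wsol_pd\<close> each
  \<open>W i\<close> is then a generalised solution too, and its continuous derivatives are all
  second derivatives of \<open>w\<close>, mixed ones included.\<close>

theorem wsol_semilinear_regular:
  fixes w :: "real^'n::finite \<Rightarrow> real \<Rightarrow> real"
  assumes U: "open U" and w: "wsol U w (\<lambda>x t. f (w x t))"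
    and f: "\<And>s. (f has_real_derivative f' s) (at s)" "continuous_on UNIV f'"
  shows "C21 U w" "\<And>x t. (x,t) \<in> U \<Longrightarrow> dt w x t - lap w x t = f (w x t)"
proof -
  define W where "W = (\<lambda>i x t. pd i (\<lambda>y. w y t) x)"
  have cw: "continuous_on U (\<lambda>(x,t). w x t)" by (rule wsol_continuous[OF U w])
  have hW: "has_pd i U w (W i)" for i using wsol_has_pd[OF U w] by (simp add: W_def)
  have "has_pd i U (\<lambda>x t. f (w x t)) (\<lambda>x t. f' (w x t) * W i x t)" for i
    unfolding has_pd_def
  proof safe
    fix x t assume "(x,t) \<in> U"
    then have "((\<lambda>r. w (x + r *\<^sub>R axis i 1) t) has_real_derivative W i x t) (at 0)"
      using hW[of i] unfolding has_pd_def by blast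
    from DERIV_chain2[OF _ this, of f] f(1)
    show "((\<lambda>r. f (w (x + r *\<^sub>R axis i 1) t)) has_real_derivative f' (w x t) * W i x t) (at 0)" by simp
  next
    have "continuous_on U (\<lambda>z. f' (case z of (x,t) \<Rightarrow> w x t) * (case z of (x,t) \<Rightarrow> W i x t))"
      using hW[of i] unfolding has_pd_def
      by (intro continuous_on_mult continuous_on_compose2[OF f(2) cw]) auto
    then show "continuous_on U (\<lambda>(x,t). f' (w x t) * W i x t)" by (simp add: case_prod_beta)
  qed
  from wsol_pd[OF U w this] have wW: "wsol U (W i) (\<lambda>x t. f' (w x t) * W i x t)" for i by (simp add: W_def)
  have hWW: "has_pd j U (W i) (\<lambda>x t. pd j (\<lambda>y. W i y t) x)" for i j
    by (rule wsol_has_pd[OF U wW])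
  have "continuous_on UNIV f" using f(1) by (meson DERIV_isCont continuous_at_imp_continuous_on)
  from continuous_on_compose2[OF this cw]
  have cf: "continuous_on U (\<lambda>(x,t). f (w x t))" by (simp add: case_prod_beta)
  have lapW: "lap w x t = (\<Sum>i\<in>UNIV. pd i (\<lambda>y. W i y t) x)" for x t by (simp add: lap_def W_def)
  have D: "((\<lambda>s. w x s) has_real_derivative (lap w x t + f (w x t))) (at t)" if "(x,t) \<in> U" for x t
    unfolding lapW by (rule wsol_time_derivative[OF U that w hW hWW cf])
  have dtw: "dt w x t = lap w x t + f (w x t)" if "(x,t) \<in> U" for x t
    unfolding dt_def using D[OF that] by (rule DERIV_imp_deriv)
  then show "\<And>x t. (x,t) \<in> U \<Longrightarrow> dt w x t - lap w x t = f (w x t)" by simp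
  have "continuous_on U (\<lambda>z. (\<Sum>i\<in>UNIV. case z of (x,t) \<Rightarrow> pd i (\<lambda>y. W i y t) x) + (case z of (x,t) \<Rightarrow> f (w x t)))"
    using hWW cf unfolding has_pd_def by (intro continuous_intros) auto
  then have cdt: "continuous_on U (\<lambda>(x,t). dt w x t)"
    by (rule continuous_on_eq) (auto simp: dtw lapW)
  have "(\<lambda>s. w x s) differentiable (at t)" if "(x,t) \<in> U" for x t
    using D[OF that] real_differentiable_def by blast
  moreover have "(\<lambda>r. w (x + r *\<^sub>R axis i 1) t) differentiable (at 0)" if "(x,t) \<in> U" for x t i
    using hW[of i] that real_differentiable_def unfolding has_pd_def by blast
  moreover have "(\<lambda>r. pd i (\<lambda>y. w y t) (x + r *\<^sub>R axis j 1)) differentiable (at 0)" if "(x,t) \<in> U" for x t i j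
    using hWW[of j i] that real_differentiable_def unfolding has_pd_def W_def by blast
  moreover have "continuous_on U (\<lambda>(x,t). pd i (\<lambda>y. w y t) x)" for i
    using hW[of i] by (simp add: has_pd_def W_def)
  moreover have "continuous_on U (\<lambda>(x,t). pd j (pd i (\<lambda>y. w y t)) x)" for i j
    using hWW[of j i] by (simp add: has_pd_def W_def)
  ultimately show "C21 U w" unfolding C21_def using cw cdt by blast
qed

lemma C21_has_pd:
  assumes "C21 U v"
  shows "has_pd i U v (\<lambda>x t. pd i (\<lambda>y. v y t) x)"
    "has_pd i U (\<lambda>x t. pd i (\<lambda>y. v y t) x) (\<lambda>x t. pd i (pd i (\<lambda>y. v y t)) x)"
proof -
  have "(\<lambda>r. v (x + r *\<^sub>R axis i 1) t) differentiable (at 0)"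
    "(\<lambda>r. pd i (\<lambda>y. v y t) (x + r *\<^sub>R axis i 1)) differentiable (at 0)" if "(x,t) \<in> U" for x t
    using assms that unfolding C21_def by blast+
  then show "has_pd i U v (\<lambda>x t. pd i (\<lambda>y. v y t) x)"
    "has_pd i U (\<lambda>x t. pd i (\<lambda>y. v y t) x) (\<lambda>x t. pd i (pd i (\<lambda>y. v y t)) x)"
    using assms unfolding has_pd_def C21_def pd_def by (auto simp: DERIV_deriv_iff_real_differentiable)
qed

lemma C21_heat_at:
  assumes "C21 U v" "open U" "(x,t) \<in> U"
  shows "heat_at v x t (dt v x t - lap v x t)"
  unfolding lap_def
proof (rule heat_at_has_pd[OF assms(2,3) C21_has_pd[OF assms(1)]])
  show "((\<lambda>s. v x s) has_real_derivative dt v x t) (at t)"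
    using assms unfolding C21_def dt_def by (auto simp: DERIV_deriv_iff_real_differentiable)
qed simp

lemma C21_caloric_on:
  assumes "C21 U v" "open U" "K \<subseteq> U" "\<And>x t. (x,t) \<in> K \<Longrightarrow> dt v x t - lap v x t = f x t"
  shows "caloric_on K v f"
  unfolding caloric_on_def
proof (intro conjI allI)
  show "continuous_on K (\<lambda>(x,t). v x t)" "continuous_on K (\<lambda>(x,t). pd i (\<lambda>y. v y t) x)" for i
    using assms unfolding C21_def by (blast intro: continuous_on_subset)+
  show "\<forall>(x,t)\<in>K. heat_at v x t (f x t)"
    using C21_heat_at[OF assms(1,2)] assms(3,4) by (metis (mono_tags, lifting) case_prodI2 subsetD)
qed

section \<open>The linear Dirichlet problem\<close>

text \<open>Phases absorb the sines, and frequencies range over the whole space without any period,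
  so the product-to-sum formula keeps products in the class and polynomials in sines belong to
  it.\<close>

inductive trig :: "('a::euclidean_space \<Rightarrow> real) \<Rightarrow> bool" where
  trig_cos: "trig (\<lambda>z. c * cos (u \<bullet> z + \<alpha>))"
| trig_add: "trig p \<Longrightarrow> trig q \<Longrightarrow> trig (\<lambda>z. p z + q z)"

lemma trig_const: "trig (\<lambda>z. c)"
  using trig_cos[of c 0 0] by simp

lemma trig_cmult: "trig p \<Longrightarrow> trig (\<lambda>z. a * p z)"
proof (induction rule: trig.induct)
  case (trig_cos c u \<alpha>)
  show ?case using trig.trig_cos[of "a * c" u \<alpha>] by (simp add: mult.assoc)
next
  case (trig_add p q)
  then show ?case using trig.trig_add[of "\<lambda>z. a * p z" "\<lambda>z. a * q z"] by (simp add: distrib_left)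
qed

lemma trig_sin: "trig (\<lambda>z. sin (u \<bullet> z))"
proof -
  have "cos (u \<bullet> z + - (pi/2)) = sin (u \<bullet> z)" for z by (subst cos_add) simp
  then show ?thesis using trig_cos[of 1 u "- (pi/2)"] by simp
qed

lemma trig_mult:
  assumes "trig p" "trig q"
  shows "trig (\<lambda>z. p z * q z)"
  using assms
proof (induction rule: trig.induct)
  case (trig_cos c u \<alpha>)
  from trig_cos show ?case
  proof (induction rule: trig.induct)
    case (trig_cos d v \<beta>)
    have "c * cos (u \<bullet> z + \<alpha>) * (d * cos (v \<bullet> z + \<beta>))
        = (c * d / 2) * cos ((u - v) \<bullet> z + (\<alpha> - \<beta>)) + (c * d / 2) * cos ((u + v) \<bullet> z + (\<alpha> + \<beta>))" for z
    proof -
      have "c * cos (u \<bullet> z + \<alpha>) * (d * cos (v \<bullet> z + \<beta>)) = c * d * (cos (u \<bullet> z + \<alpha>) * cos (v \<bullet> z + \<beta>))"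
        by simp
      also have "\<dots> = c * d * ((cos (u \<bullet> z + \<alpha> - (v \<bullet> z + \<beta>)) + cos (u \<bullet> z + \<alpha> + (v \<bullet> z + \<beta>))) / 2)"
        by (simp only: cos_times_cos)
      finally show ?thesis by (simp add: inner_diff_left inner_add_left algebra_simps)
    qed
    then have eq: "(\<lambda>z. c * cos (u \<bullet> z + \<alpha>) * (d * cos (v \<bullet> z + \<beta>)))
        = (\<lambda>z. (c * d / 2) * cos ((u - v) \<bullet> z + (\<alpha> - \<beta>)) + (c * d / 2) * cos ((u + v) \<bullet> z + (\<alpha> + \<beta>)))"
      by (rule ext)
    show ?case unfolding eq by (rule trig.trig_add[OF trig.trig_cos trig.trig_cos])
  next
    case (trig_add q r)
    then show ?case using trig.trig_add by (simp add: distrib_left)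
  qed
next
  case (trig_add p r)
  then show ?case using trig.trig_add by (simp add: distrib_right)
qed

lemma trig_sum: "finite S \<Longrightarrow> (\<And>k. k \<in> S \<Longrightarrow> trig (p k)) \<Longrightarrow> trig (\<lambda>z. \<Sum>k\<in>S. p k z)"
  by (induction S rule: finite_induct) (auto intro: trig_const trig_add)

lemma trig_polynomial_sin:
  fixes p :: "'a::euclidean_space \<Rightarrow> real"
  assumes "real_polynomial_function p"
  shows "trig (\<lambda>z. p (\<Sum>b\<in>Basis. sin ((k *\<^sub>R b) \<bullet> z) *\<^sub>R b))"
  using assms
proof (induction rule: real_polynomial_function.induct)
  case (linear f)
  interpret bounded_linear f by fact
  show ?case
    unfolding sum scale real_scaleR_def
    by (intro trig_sum) (auto simp: mult.commute[of "sin _"] simp del: inner_scaleR_left intro!: trig_cmult trig_sin)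
qed (auto intro: trig_const trig_add trig_mult)

text \<open>A function of \<open>z\<close> is approximated by a polynomial in the \<open>sin (z\<^sub>b / n)\<close>; the polynomial is
  close to \<open>y \<mapsto> g (n arcsin y)\<close> on the whole unit cube, so its bounds hold for all \<open>z\<close>.\<close>

lemma trig_approx:
  fixes g :: "'a::euclidean_space \<Rightarrow> real"
  assumes S: "closed S" "continuous_on S g" and AB: "\<And>z. z \<in> S \<Longrightarrow> A \<le> g z \<and> g z \<le> B" "A \<le> B"
    and R: "R > 0" and e: "e > 0"
  obtains p where "trig p" "\<And>z. A - e \<le> p z" "\<And>z. p z \<le> B + e"
    "\<And>z. z \<in> S \<Longrightarrow> norm z \<le> R \<Longrightarrow> \<bar>p z - g z\<bar> \<le> e"
proof -
  \<comment> \<open>The extension keeps the range \<open>[A, B]\<close>, so \<open>H\<close>, and up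
    to \<open>e\<close> the polynomial, obeys these bounds on the whole cube and not only on the
    image of \<open>S\<close>.\<close>
  obtain h where h: "continuous_on UNIV h" "\<And>z. z \<in> S \<Longrightarrow> h z = g z" "\<And>z. h z \<in> cbox A B"
    using Tietze_closed_interval_1[of S g UNIV A B] S AB by auto
  define H where "H = (\<lambda>y. h (\<Sum>b\<in>Basis. (R * arcsin (y \<bullet> b)) *\<^sub>R b))"
  let ?C = "cbox (- One) (One::'a)"
  have "continuous_on ?C (\<lambda>y. \<Sum>b\<in>Basis. (R * arcsin (y \<bullet> b)) *\<^sub>R b)"
    by (intro continuous_on_sum continuous_on_scaleR continuous_on_mult continuous_on_arcsin continuous_intros)
       (auto simp: mem_box)
  then have "continuous_on ?C H"
    unfolding H_def by (intro continuous_on_compose2[OF h(1)]) auto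
  from Stone_Weierstrass_real_polynomial_function[OF compact_cbox this e]
  obtain q where q: "real_polynomial_function q" "\<And>y. y \<in> ?C \<Longrightarrow> \<bar>H y - q y\<bar> < e" by metis
  define \<Phi> where "\<Phi> = (\<lambda>z::'a. \<Sum>b\<in>Basis. sin ((inverse R *\<^sub>R b) \<bullet> z) *\<^sub>R b)"
  have \<Phi>b: "\<Phi> z \<bullet> b = sin (inverse R * (z \<bullet> b))" if "b \<in> Basis" for z b
    unfolding \<Phi>_def inner_sum_left_Basis[OF that] by (simp add: inner_commute)
  have \<Phi>C: "\<Phi> z \<in> ?C" for z by (auto simp: mem_box \<Phi>b)
  show ?thesis
  proof (rule that[of "\<lambda>z. q (\<Phi> z)"])
    show "trig (\<lambda>z. q (\<Phi> z))" unfolding \<Phi>_def by (rule trig_polynomial_sin[OF q(1)])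
    have "A \<le> H y" "H y \<le> B" for y using h(3) by (auto simp: H_def mem_box)
    then show "A - e \<le> q (\<Phi> z)" "q (\<Phi> z) \<le> B + e" for z
      using q(2)[OF \<Phi>C[of z]] by (smt (verit))+
    fix z assume z: "z \<in> S" "norm z \<le> R"
    \<comment> \<open>Inside the ball the angle is at most 1 < pi/2 in absolute value, so
      \<open>arcsin\<close> inverts \<open>sin\<close> and \<open>H (\<Phi> z)\<close> is
      \<open>g z\<close>.\<close>
    have "R * arcsin (\<Phi> z \<bullet> b) = z \<bullet> b" if b: "b \<in> Basis" for b
    proof -
      have "\<bar>z \<bullet> b\<bar> \<le> R" using Basis_le_norm[OF b, of z] z by linarith
      then have "\<bar>inverse R * (z \<bullet> b)\<bar> \<le> 1" using R by (simp add: abs_mult field_simps)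
      then have "arcsin (sin (inverse R * (z \<bullet> b))) = inverse R * (z \<bullet> b)"
        using pi_ge_two by (intro arcsin_sin) (auto simp: abs_le_iff)
      then show ?thesis using R by (simp add: \<Phi>b[OF b])
    qed
    then have "(\<Sum>b\<in>Basis. (R * arcsin (\<Phi> z \<bullet> b)) *\<^sub>R b) = (\<Sum>b\<in>Basis. (z \<bullet> b) *\<^sub>R b)"
      by (intro sum.cong) auto
    also have "\<dots> = z" by (rule euclidean_representation)
    finally have "H (\<Phi> z) = g z" by (simp add: H_def h(2)[OF z(1)])
    then show "\<bar>q (\<Phi> z) - g z\<bar> \<le> e" using q(2)[OF \<Phi>C[of z]] by linarith
  qed
qed

lemma caloric_on_add:
  assumes "caloric_on K v f" "caloric_on K w h"
  shows "caloric_on K (\<lambda>x t. v x t + w x t) (\<lambda>x t. f x t + h x t)"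
  using caloric_on_diff[OF assms(1) caloric_on_cmult[OF assms(2), of "-1"]] by simp

lemma caloric_on_cos:
  fixes a :: "real^'n::finite"
  shows "caloric_on K (\<lambda>x t. cos (a \<bullet> x + b * t + \<alpha>))
    (\<lambda>x t. - b * sin (a \<bullet> x + b * t + \<alpha>) + (norm a)\<^sup>2 * cos (a \<bullet> x + b * t + \<alpha>))"
  unfolding caloric_on_def
proof (intro conjI allI)
  show "continuous_on K (\<lambda>(x,t). cos (a \<bullet> x + b * t + \<alpha>))"
    unfolding case_prod_beta by (intro continuous_intros)
  have D: "((\<lambda>r. cos (a \<bullet> (x + r *\<^sub>R axis i 1) + b * t + \<alpha>)) has_real_derivative
      (- (a $ i) * sin (a \<bullet> (x + r *\<^sub>R axis i 1) + b * t + \<alpha>))) (at r)" for x t i r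
    by (auto intro!: derivative_eq_intros simp: inner_add_right inner_axis)
  have "heat_at (\<lambda>x t. cos (a \<bullet> x + b * t + \<alpha>)) x t
     (- b * sin (a \<bullet> x + b * t + \<alpha>) + (norm a)\<^sup>2 * cos (a \<bullet> x + b * t + \<alpha>))" for x t
  proof (rule heat_atI[where p = "- b * sin (a \<bullet> x + b * t + \<alpha>)"
        and g = "\<lambda>i r. - (a $ i) * sin (a \<bullet> (x + r *\<^sub>R axis i 1) + b * t + \<alpha>)"
        and A = "\<lambda>i. - (a $ i)\<^sup>2 * cos (a \<bullet> x + b * t + \<alpha>)"])
    show "((\<lambda>t. cos (a \<bullet> x + b * t + \<alpha>)) has_real_derivative - b * sin (a \<bullet> x + b * t + \<alpha>)) (at t)"
      by (auto intro!: derivative_eq_intros)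
    show "\<forall>\<^sub>F r in nhds 0. ((\<lambda>r. cos (a \<bullet> (x + r *\<^sub>R axis i 1) + b * t + \<alpha>)) has_real_derivative
      (- (a $ i) * sin (a \<bullet> (x + r *\<^sub>R axis i 1) + b * t + \<alpha>))) (at r)" for i
      using D by (intro always_eventually allI)
    show "((\<lambda>r. - (a $ i) * sin (a \<bullet> (x + r *\<^sub>R axis i 1) + b * t + \<alpha>)) has_real_derivative
      (- (a $ i)\<^sup>2 * cos (a \<bullet> x + b * t + \<alpha>))) (at 0)" for i
      by (auto intro!: derivative_eq_intros simp: inner_add_right inner_axis power2_eq_square)
    have "(norm a)\<^sup>2 = (\<Sum>i\<in>UNIV. (a $ i)\<^sup>2)"
      unfolding norm_vec_def L2_set_def by (subst real_sqrt_pow2) (auto intro: sum_nonneg)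
    then show "- b * sin (a \<bullet> x + b * t + \<alpha>) + (norm a)\<^sup>2 * cos (a \<bullet> x + b * t + \<alpha>)
      = - b * sin (a \<bullet> x + b * t + \<alpha>) - (\<Sum>i\<in>UNIV. - (a $ i)\<^sup>2 * cos (a \<bullet> x + b * t + \<alpha>))"
      by (simp add: sum_distrib_right sum_negf)
  qed
  then show "\<forall>(x,t)\<in>K. heat_at (\<lambda>x t. cos (a \<bullet> x + b * t + \<alpha>)) x t
     (- b * sin (a \<bullet> x + b * t + \<alpha>) + (norm a)\<^sup>2 * cos (a \<bullet> x + b * t + \<alpha>))" by auto
  have "pd i (\<lambda>x. cos (a \<bullet> x + b * t + \<alpha>)) x = - (a $ i) * sin (a \<bullet> x + b * t + \<alpha>)" for i t x
    unfolding pd_def using D[where r = 0] by (auto intro: DERIV_imp_deriv)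
  then show "continuous_on K (\<lambda>(x,t). pd i (\<lambda>x. cos (a \<bullet> x + b * t + \<alpha>)) x)" for i
    unfolding case_prod_beta by (simp, intro continuous_intros)
qed

text \<open>On the span of the cosine and sine of one phase the heat operator is a 2 by 2 matrix,
  invertible unless the frequency is zero. For frequency zero the potential is a multiple of
  \<open>t\<close>, which is the origin of the growth \<open>1 + |t|\<close>.\<close>

lemma trig_heat_potential:
  fixes p :: "(real^'n::finite) \<times> real \<Rightarrow> real"
  assumes "trig p"
  shows "\<exists>V. caloric_on UNIV V (\<lambda>x t. p (x,t)) \<and> (\<exists>B. \<forall>x t. \<bar>V x t\<bar> \<le> B * (1 + \<bar>t\<bar>))"
  using assms
proof (induction rule: trig.induct)
  case (trig_cos c u \<alpha>)
  obtain a b where u: "u = (a,b)" by fastforce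
  show ?case
  proof (cases "u = 0")
    case True
    have "caloric_on UNIV (\<lambda>(x::real^'n) t. c * cos \<alpha> * t) (\<lambda>x t. c * cos \<alpha>)"
      unfolding caloric_on_def
    proof (intro conjI allI)
      show "continuous_on UNIV (\<lambda>(x::real^'n, t). c * cos \<alpha> * t)"
        unfolding case_prod_beta by (intro continuous_intros)
      have "heat_at (\<lambda>(x::real^'n) t. c * cos \<alpha> * t) x t (c * cos \<alpha>)" for x t
        by (rule heat_at_time) (auto intro!: derivative_eq_intros)
      then show "\<forall>(x::real^'n, t)\<in>UNIV. heat_at (\<lambda>x t. c * cos \<alpha> * t) x t (c * cos \<alpha>)" by auto
      show "continuous_on UNIV (\<lambda>(x::real^'n, t). pd i (\<lambda>y. c * cos \<alpha> * t) x)" for i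
        by (simp add: pd_def case_prod_beta)
    qed
    moreover have "\<bar>c * cos \<alpha> * t\<bar> \<le> \<bar>c * cos \<alpha>\<bar> * (1 + \<bar>t\<bar>)" for t
      unfolding abs_mult[of "c * cos \<alpha>"] by (intro mult_left_mono) auto
    ultimately show ?thesis using True by (intro exI conjI) auto
  next
    case False
    \<comment> \<open>The heat operator sends cos to \<open>A cos - b sin\<close> and sin to
      \<open>A sin + b cos\<close>; the determinant of this system is
      \<open>D = A^2 + b^2\<close>.\<close>
    define A where "A = (norm a)\<^sup>2"
    define D where "D = A\<^sup>2 + b\<^sup>2"
    have "A \<noteq> 0 \<or> b \<noteq> 0" using False by (auto simp: u A_def zero_prod_def)
    then have D: "D > 0" unfolding D_def by (simp only: sum_power2_gt_zero_iff)
    let ?\<theta> = "\<lambda>x t. a \<bullet> x + b * t + \<alpha>"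
    have 1: "caloric_on UNIV (\<lambda>x t. cos (?\<theta> x t)) (\<lambda>x t. - b * sin (?\<theta> x t) + A * cos (?\<theta> x t))"
      unfolding A_def by (rule caloric_on_cos)
    have "cos (a \<bullet> x + b * t + (\<alpha> - pi / 2)) = sin (?\<theta> x t)"
      "sin (a \<bullet> x + b * t + (\<alpha> - pi / 2)) = - cos (?\<theta> x t)" for x t
      by (simp_all add: cos_add sin_add cos_diff sin_diff algebra_simps)
    with caloric_on_cos[of UNIV a b "\<alpha> - pi / 2"]
    have 2: "caloric_on UNIV (\<lambda>x t. sin (?\<theta> x t)) (\<lambda>x t. - b * - cos (?\<theta> x t) + A * sin (?\<theta> x t))"
      by (simp add: A_def)
    have e: "c * A / D * (- b * sin s + A * cos s) + c * b / D * (- b * - cos s + A * sin s) = c * cos s" for s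
    proof -
      have "c * A / D * (- b * sin s + A * cos s) + c * b / D * (- b * - cos s + A * sin s)
        = c * (A * (- b * sin s + A * cos s) + b * (- b * - cos s + A * sin s)) / D"
        by (simp only: distrib_left add_divide_distrib times_divide_eq_left times_divide_eq_right mult.assoc)
      also have "A * (- b * sin s + A * cos s) + b * (- b * - cos s + A * sin s) = D * cos s"
        by (simp add: D_def power2_eq_square algebra_simps)
      finally show ?thesis using D by simp
    qed
    have "caloric_on UNIV (\<lambda>x t. c * A / D * cos (?\<theta> x t) + c * b / D * sin (?\<theta> x t)) (\<lambda>x t. c * cos (?\<theta> x t))"
      using caloric_on_add[OF caloric_on_cmult[OF 1, of "c * A / D"] caloric_on_cmult[OF 2, of "c * b / D"]]
      unfolding e .
    moreover have "\<bar>c * A / D * cos (?\<theta> x t) + c * b / D * sin (?\<theta> x t)\<bar>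
        \<le> (\<bar>c * A / D\<bar> + \<bar>c * b / D\<bar>) * (1 + \<bar>t\<bar>)" for x t
    proof -
      have "\<bar>c * A / D * cos (?\<theta> x t) + c * b / D * sin (?\<theta> x t)\<bar>
          \<le> \<bar>c * A / D * cos (?\<theta> x t)\<bar> + \<bar>c * b / D * sin (?\<theta> x t)\<bar>"
        by (rule abs_triangle_ineq)
      also have "\<dots> \<le> \<bar>c * A / D\<bar> * 1 + \<bar>c * b / D\<bar> * 1"
        unfolding abs_mult[of _ "cos _"] abs_mult[of _ "sin _"] by (intro add_mono mult_left_mono) auto
      also have "\<dots> \<le> (\<bar>c * A / D\<bar> + \<bar>c * b / D\<bar>) * (1 + \<bar>t\<bar>)"
        unfolding distrib_right[symmetric] by (intro mult_left_mono) auto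
      finally show ?thesis .
    qed
    ultimately show ?thesis by (auto simp: u)
  qed
next
  case (trig_add p q)
  then obtain V W B C where VW: "caloric_on UNIV V (\<lambda>x t. p (x,t))" "\<And>x t. \<bar>V x t\<bar> \<le> B * (1 + \<bar>t\<bar>)"
    "caloric_on UNIV W (\<lambda>x t. q (x,t))" "\<And>x t. \<bar>W x t\<bar> \<le> C * (1 + \<bar>t\<bar>)" by auto
  have "\<bar>V x t + W x t\<bar> \<le> (B + C) * (1 + \<bar>t\<bar>)" for x t
    using VW(2)[of x t] VW(4)[of x t] unfolding distrib_right by linarith
  then show ?case using caloric_on_add[OF VW(1,3)] by blast
qed

lemma caloric_on_UNIV_compose_continuous:
  "caloric_on UNIV V f \<Longrightarrow> continuous_on S (\<lambda>z. g z) \<Longrightarrow> continuous_on S (\<lambda>z. h z) \<Longrightarrow>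
    continuous_on S (\<lambda>z. V (g z) (h z))"
  using continuous_on_compose2[of UNIV "\<lambda>(x,t). V x t" S "\<lambda>z. (g z, h z)"]
  by (auto simp: caloric_on_def intro: continuous_on_Pair)

text \<open>Data on the whole parabolic boundary come from one function of time: the initial value
  is the constant \<open>G 0\<close>, so initial and lateral values agree at time 0.\<close>

definition dirichlet_sol ::
  "(real^'n::finite) set \<Rightarrow> real \<Rightarrow> (real \<Rightarrow> real) \<Rightarrow> (real^'n \<Rightarrow> real \<Rightarrow> real) \<Rightarrow> (real^'n \<Rightarrow> real \<Rightarrow> real) \<Rightarrow> bool" where
  "dirichlet_sol \<Omega> T G w f \<longleftrightarrow> continuous_on (closure \<Omega> \<times> {0..T}) (\<lambda>(x,t). w x t) \<and>
     (\<exists>B. \<forall>x\<in>closure \<Omega>. \<forall>t\<in>{0..T}. \<bar>w x t\<bar> \<le> B) \<and>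
     caloric_on (\<Omega> \<times> {0<..}) w f \<and>
     (\<forall>x\<in>frontier \<Omega>. \<forall>t\<in>{0..T}. w x t = G t) \<and> (\<forall>x\<in>\<Omega>. w x 0 = G 0)"

text \<open>The trigonometric right-hand side is removed by the explicit potential; the parabolic Wiener
  criterion then corrects the boundary values, which are frozen after time \<open>T\<close> to keep them bounded.\<close>

lemma dirichlet_sol_exists:
  fixes \<Omega> :: "(real^'n::finite) set"
  assumes \<Omega>: "open \<Omega>" "PWC \<Omega>" and T: "T > 0" and p: "trig p"
    and G: "continuous_on {0..} G" "\<And>t. t \<ge> 0 \<Longrightarrow> \<bar>G t\<bar> \<le> M"
  obtains w where "dirichlet_sol \<Omega> T G w (\<lambda>x t. p (x,t))"
proof -
  obtain V B where V: "caloric_on UNIV V (\<lambda>x t. p (x,t))" "\<And>x t. \<bar>V x t\<bar> \<le> B * (1 + \<bar>t\<bar>)"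
    using trig_heat_potential[OF p] by auto
  have B: "B \<ge> 0" using V(2)[of 0 0] by simp
  have VB: "\<bar>V x t\<bar> \<le> B * (1 + T)" if "0 \<le> t" "t \<le> T" for x t
    using V(2)[of x t] mult_left_mono[OF _ B, of "1 + \<bar>t\<bar>" "1 + T"] that by auto
  define g where "g = (\<lambda>x t. G t - V x (min t T))"
  have S: "continuous_on (closure \<Omega> \<times> {0..}) (\<lambda>(x,t). g x t)"
    unfolding g_def case_prod_beta
    by (intro continuous_on_diff continuous_on_compose2[OF G(1)] caloric_on_UNIV_compose_continuous[OF V(1)] continuous_intros) auto
  have "\<bar>g x t\<bar> \<le> M + B * (1 + T)" if "t \<ge> 0" for x t
  proof -
    have "\<bar>V x (min t T)\<bar> \<le> B * (1 + T)" using VB[of "min t T" x] that T by auto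
    then show ?thesis using G(2)[OF that] unfolding g_def by linarith
  qed
  then have "bounded ((\<lambda>(x,t). g x t) ` (closure \<Omega> \<times> {0..}))"
    unfolding bounded_iff by (intro exI[of _ "M + B * (1 + T)"]) auto
  from \<Omega>(2)[unfolded PWC_def, THEN spec[of _ g], THEN mp, OF conjI[OF S this]]
  obtain h where h: "continuous_on (closure \<Omega> \<times> {0..}) (\<lambda>(x,t). h x t)"
    "bounded ((\<lambda>(x,t). h x t) ` (closure \<Omega> \<times> {0..}))" "C21 (\<Omega> \<times> {0<..}) h"
    "\<And>x t. x \<in> \<Omega> \<Longrightarrow> t > 0 \<Longrightarrow> dt h x t = lap h x t"
    "\<And>x t. x \<in> frontier \<Omega> \<Longrightarrow> t \<ge> 0 \<Longrightarrow> h x t = g x t" "\<And>x. x \<in> \<Omega> \<Longrightarrow> h x 0 = g x 0"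
    by blast
  obtain B' where B': "\<And>x t. x \<in> closure \<Omega> \<Longrightarrow> t \<ge> 0 \<Longrightarrow> \<bar>h x t\<bar> \<le> B'"
    using h(2) unfolding bounded_iff by auto
  show ?thesis
  proof (rule that[of "\<lambda>x t. V x t + h x t"], unfold dirichlet_sol_def, intro conjI)
    have "continuous_on (closure \<Omega> \<times> {0..T}) (\<lambda>z. V (fst z) (snd z) + (case z of (x,t) \<Rightarrow> h x t))"
      by (intro continuous_on_add caloric_on_UNIV_compose_continuous[OF V(1)] continuous_on_subset[OF h(1)] continuous_intros) auto
    then show "continuous_on (closure \<Omega> \<times> {0..T}) (\<lambda>(x,t). V x t + h x t)" by (simp add: case_prod_beta)
    show "\<exists>B. \<forall>x\<in>closure \<Omega>. \<forall>t\<in>{0..T}. \<bar>V x t + h x t\<bar> \<le> B"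
    proof (intro exI[of _ "B * (1 + T) + B'"] ballI)
      fix x t assume "x \<in> closure \<Omega>" "t \<in> {0..T}"
      then show "\<bar>V x t + h x t\<bar> \<le> B * (1 + T) + B'" using VB[of t x] B'[of x t] by auto
    qed
    have "caloric_on (\<Omega> \<times> {0<..}) h (\<lambda>x t. 0)"
      by (rule C21_caloric_on[OF h(3)]) (use \<Omega>(1) h(4) in \<open>auto intro: open_Times\<close>)
    from caloric_on_add[OF caloric_on_subset[OF V(1)] this]
    show "caloric_on (\<Omega> \<times> {0<..}) (\<lambda>x t. V x t + h x t) (\<lambda>x t. p (x,t))" by simp
    show "\<forall>x\<in>frontier \<Omega>. \<forall>t\<in>{0..T}. V x t + h x t = G t" using h(5) by (auto simp: g_def)
    show "\<forall>x\<in>\<Omega>. V x 0 + h x 0 = G 0" using h(6) T by (auto simp: g_def)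
  qed
qed

lemma dirichlet_sol_bounded:
  assumes "dirichlet_sol \<Omega> T G w f"
  obtains B where "\<And>x t. x \<in> closure \<Omega> \<Longrightarrow> 0 \<le> t \<Longrightarrow> t \<le> T \<Longrightarrow> \<bar>w x t\<bar> \<le> B"
proof -
  obtain B where "\<forall>x\<in>closure \<Omega>. \<forall>t\<in>{0..T}. \<bar>w x t\<bar> \<le> B"
    using assms unfolding dirichlet_sol_def by blast
  then show ?thesis using that[of B] by simp
qed

lemma dirichlet_sol_le:
  fixes \<Omega> :: "(real^'n::finite) set"
  assumes \<Omega>: "open \<Omega>" and w: "dirichlet_sol \<Omega> T G w f"
    and f: "\<And>x t. x \<in> \<Omega> \<Longrightarrow> 0 < t \<Longrightarrow> t \<le> T \<Longrightarrow> f x t \<le> s"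
    and G: "\<And>t. 0 \<le> t \<Longrightarrow> t \<le> T \<Longrightarrow> G t \<le> M" and s: "s \<ge> 0"
    and xt: "x \<in> closure \<Omega>" "0 \<le> t" "t \<le> T"
  shows "w x t \<le> M + s * t"
proof -
  obtain B where B: "\<And>x t. x \<in> closure \<Omega> \<Longrightarrow> 0 \<le> t \<Longrightarrow> t \<le> T \<Longrightarrow> \<bar>w x t\<bar> \<le> B"
    using dirichlet_sol_bounded[OF w] by blast
  have "w x t - (M + s * t) \<le> 0"
  proof (rule max_principle_unbounded[where \<Omega> = \<Omega> and a = 0 and b = T and x = x and t = t
        and w = "\<lambda>x t. w x t - (M + s * t)" and B = "B - M"])
    have "continuous_on (closure \<Omega> \<times> {0..T}) (\<lambda>z. (case z of (x,t) \<Rightarrow> w x t) - (M + s * snd z))"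
      using w unfolding dirichlet_sol_def by (intro continuous_intros) auto
    then show "continuous_on (closure \<Omega> \<times> {0..T}) (\<lambda>(x,t). w x t - (M + s * t))" by (simp add: case_prod_beta)
    show "w x t - (M + s * t) \<le> B - M" if "x \<in> closure \<Omega>" "0 \<le> t" "t \<le> T" for x t
      using B[OF that] mult_nonneg_nonneg[OF s that(2)] by linarith
    show "w x 0 - (M + s * 0) \<le> 0" if "x \<in> \<Omega>" for x
      using w G[of 0] xt that unfolding dirichlet_sol_def by auto
    show "w x t - (M + s * t) \<le> 0" if "x \<in> frontier \<Omega>" "0 \<le> t" "t \<le> T" for x t
      using w G[of t] s that unfolding dirichlet_sol_def by (auto intro: add_increasing2)
    show "\<exists>f\<le>0. heat_at (\<lambda>x t. w x t - (M + s * t)) x t f" if "x \<in> \<Omega>" "0 < t" "t \<le> T" for x t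
    proof -
      have 1: "heat_at w x t (f x t)"
        using w that unfolding dirichlet_sol_def by (auto intro: caloric_on_heat)
      have "heat_at (\<lambda>x t. M + s * t) x t s"
        by (rule heat_at_time) (auto intro!: derivative_eq_intros)
      from heat_at_diff[OF 1 this] show ?thesis using f[OF that] by (intro exI[of _ "f x t - s"]) auto
    qed
  qed (use xt \<Omega> in auto)
  then show ?thesis by simp
qed

lemma dirichlet_sol_minus:
  assumes "dirichlet_sol \<Omega> T G w f"
  shows "dirichlet_sol \<Omega> T (\<lambda>t. - G t) (\<lambda>x t. - w x t) (\<lambda>x t. - f x t)"
  using assms caloric_on_cmult[of _ w f "-1"] unfolding dirichlet_sol_def case_prod_beta
  by (auto intro!: continuous_on_minus)

section \<open>Weighted estimates on unbounded domains\<close>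

lemma heat_at_time_factor:
  assumes "heat_at v x t f" "(\<phi> has_real_derivative \<phi>') (at t)"
  shows "heat_at (\<lambda>x t. \<phi> t * v x t) x t (\<phi> t * f + \<phi>' * v x t)"
proof -
  obtain p A g where a: "((\<lambda>s. v x s) has_real_derivative p) (at t)"
    "\<And>i. \<forall>\<^sub>F r in nhds 0. ((\<lambda>r. v (x + r *\<^sub>R axis i 1) t) has_real_derivative g i r) (at r)"
    "\<And>i. (g i has_real_derivative A i) (at 0)" "f = p - (\<Sum>i\<in>UNIV. A i)"
    using heat_atE[OF assms(1)] by blast
  show ?thesis
  proof (rule heat_atI[where p = "\<phi>' * v x t + p * \<phi> t" and g = "\<lambda>i r. \<phi> t * g i r" and A = "\<lambda>i. \<phi> t * A i"])
    show "((\<lambda>s. \<phi> s * v x s) has_real_derivative \<phi>' * v x t + p * \<phi> t) (at t)"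
      by (rule DERIV_mult[OF assms(2) a(1)])
    show "\<forall>\<^sub>F r in nhds 0. ((\<lambda>r. \<phi> t * v (x + r *\<^sub>R axis i 1) t) has_real_derivative \<phi> t * g i r) (at r)" for i
      using a(2)[of i] by eventually_elim (auto intro!: DERIV_cmult)
    show "((\<lambda>r. \<phi> t * g i r) has_real_derivative \<phi> t * A i) (at 0)" for i by (rule DERIV_cmult[OF a(3)])
    show "\<phi> t * f + \<phi>' * v x t = \<phi>' * v x t + p * \<phi> t - (\<Sum>i\<in>UNIV. \<phi> t * A i)"
      by (simp add: a(4) sum_distrib_left algebra_simps)
  qed
qed

text \<open>The quadratic factor tolerates sources that are approximated only on balls; the
  exponential, with \<open>l\<close> large, makes the solution operator a contraction.\<close>

definition weight :: "real \<Rightarrow> real^'n::finite \<Rightarrow> real \<Rightarrow> real" where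
  "weight l x t = exp (l * t) * (1 + (norm x)\<^sup>2)"

lemma weight_pos: "weight l x t > 0"
  unfolding weight_def by (intro mult_pos_pos) (auto intro: add_pos_nonneg)

lemma weight_ge: "l \<ge> 0 \<Longrightarrow> t \<ge> 0 \<Longrightarrow> weight l x t \<ge> 1 + (norm x)\<^sup>2"
  unfolding weight_def using mult_right_mono[of 1 "exp (l * t)" "1 + (norm x)\<^sup>2"] by auto

lemma continuous_on_weight: "continuous_on S (\<lambda>(x,t). weight l x t)"
  unfolding weight_def case_prod_beta by (intro continuous_intros)

text \<open>The time derivative contributes \<open>l * weight l x t\<close>, and the Laplacian costs
  \<open>2 N exp (l t)\<close>, which is at most \<open>2 N\<close> times the weight.\<close>

lemma heat_at_weight:
  fixes x :: "real^'n::finite"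
  obtains h where "heat_at (weight l) x t h" "h \<ge> (l - 2 * real CARD('n)) * weight l x t"
proof -
  have e: "((\<lambda>t. exp (l * t)) has_real_derivative l * exp (l * t)) (at t)"
    by (auto intro!: derivative_eq_intros)
  have "heat_at (\<lambda>x t. 1 + (norm (x - 0))\<^sup>2) x t (0 + - 2 * real CARD('n))"
    by (rule heat_at_add[OF heat_at_const heat_at_sqdist])
  from heat_at_time_factor[OF this e]
  have "heat_at (weight l) x t (exp (l * t) * (0 + - 2 * real CARD('n)) + l * exp (l * t) * (1 + (norm (x - 0))\<^sup>2))"
    unfolding weight_def[abs_def] by simp
  moreover have "exp (l * t) * (0 + - 2 * real CARD('n)) + l * exp (l * t) * (1 + (norm (x - 0))\<^sup>2)
      = (l - 2 * real CARD('n)) * weight l x t + 2 * real CARD('n) * (exp (l * t) * (norm x)\<^sup>2)"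
    by (simp add: weight_def algebra_simps)
  moreover have "2 * real CARD('n) * (exp (l * t) * (norm x)\<^sup>2) \<ge> 0" by simp
  ultimately show ?thesis using that by (metis le_add_same_cancel1)
qed

text \<open>In the weighted norm, passing from sources to solutions gains the factor
  \<open>1 / (l - 2 N)\<close>. Boundedness of both solutions is what admits the maximum principle
  on an unbounded domain.\<close>

lemma dirichlet_sol_weighted_diff:
  fixes \<Omega> :: "(real^'n::finite) set"
  assumes \<Omega>: "open \<Omega>" and w: "dirichlet_sol \<Omega> T G w f" "dirichlet_sol \<Omega> T G w' f'"
    and f: "\<And>x t. x \<in> \<Omega> \<Longrightarrow> 0 < t \<Longrightarrow> t \<le> T \<Longrightarrow> f x t - f' x t \<le> c * (l - 2 * real CARD('n)) * weight l x t"
    and c: "c \<ge> 0" and xt: "x \<in> closure \<Omega>" "0 \<le> t" "t \<le> T"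
  shows "w x t - w' x t \<le> c * weight l x t"
proof -
  obtain B where B: "\<And>x t. x \<in> closure \<Omega> \<Longrightarrow> 0 \<le> t \<Longrightarrow> t \<le> T \<Longrightarrow> \<bar>w x t\<bar> \<le> B"
    using dirichlet_sol_bounded[OF w(1)] by blast
  obtain B' where B': "\<And>x t. x \<in> closure \<Omega> \<Longrightarrow> 0 \<le> t \<Longrightarrow> t \<le> T \<Longrightarrow> \<bar>w' x t\<bar> \<le> B'"
    using dirichlet_sol_bounded[OF w(2)] by blast
  have cw: "c * weight l x t \<ge> 0" for x :: "real^'n" and t using c weight_pos[of l x t] by simp
  have "w x t - w' x t - c * weight l x t \<le> 0"
  proof (rule max_principle_unbounded[where \<Omega> = \<Omega> and a = 0 and b = T and x = x and t = t
        and w = "\<lambda>x t. w x t - w' x t - c * weight l x t" and B = "B + B'"])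
    have "continuous_on (closure \<Omega> \<times> {0..T}) (\<lambda>z. (case z of (x,t) \<Rightarrow> w x t) - (case z of (x,t) \<Rightarrow> w' x t)
        - c * (case z of (x,t) \<Rightarrow> weight l x t))"
      using w unfolding dirichlet_sol_def by (intro continuous_intros continuous_on_weight) auto
    then show "continuous_on (closure \<Omega> \<times> {0..T}) (\<lambda>(x,t). w x t - w' x t - c * weight l x t)"
      by (simp add: case_prod_beta)
    show "w x t - w' x t - c * weight l x t \<le> B + B'" if "x \<in> closure \<Omega>" "0 \<le> t" "t \<le> T" for x t
      using B[OF that] B'[OF that] cw[of x t] by (auto simp: abs_le_iff)
    show "w x 0 - w' x 0 - c * weight l x 0 \<le> 0" if "x \<in> \<Omega>" for x
      using w that cw unfolding dirichlet_sol_def by auto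
    show "w x t - w' x t - c * weight l x t \<le> 0" if "x \<in> frontier \<Omega>" "0 \<le> t" "t \<le> T" for x t
      using w that cw unfolding dirichlet_sol_def by auto
    show "\<exists>f\<le>0. heat_at (\<lambda>x t. w x t - w' x t - c * weight l x t) x t f" if xt: "x \<in> \<Omega>" "0 < t" "t \<le> T" for x t
    proof -
      have 1: "heat_at w x t (f x t)" "heat_at w' x t (f' x t)"
        using w xt unfolding dirichlet_sol_def by (auto intro: caloric_on_heat)
      obtain h where h: "heat_at (weight l) x t h" "h \<ge> (l - 2 * real CARD('n)) * weight l x t"
        using heat_at_weight by blast
      have "f x t - f' x t - c * h \<le> 0"
        using f[OF xt] mult_left_mono[OF h(2) c] by (simp add: mult.assoc)
      with heat_at_diff[OF heat_at_diff[OF 1] heat_at_cmult[OF h(1)]] show ?thesis by blast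
    qed
  qed (use xt \<Omega> in auto)
  then show ?thesis by simp
qed

lemma geometric_increments_limit:
  fixes a :: "nat \<Rightarrow> real"
  assumes "\<And>n. \<bar>a (Suc n) - a n\<bar> \<le> c * (1/2) ^ n"
  shows "\<bar>lim a - a n\<bar> \<le> 2 * c * (1/2) ^ n"
proof -
  have c: "c \<ge> 0" using assms[of 0] by (auto intro: order_trans[OF abs_ge_zero])
  have inc: "\<bar>a (n + k) - a n\<bar> \<le> 2 * c * (1/2) ^ n * (1 - (1/2) ^ k)" for n k
  proof (induction k)
    case (Suc k)
    have "\<bar>a (n + Suc k) - a n\<bar> \<le> \<bar>a (Suc (n + k)) - a (n + k)\<bar> + \<bar>a (n + k) - a n\<bar>"
      using abs_triangle_ineq[of "a (Suc (n + k)) - a (n + k)" "a (n + k) - a n"] by simp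
    also have "\<dots> \<le> c * (1/2) ^ (n + k) + 2 * c * (1/2) ^ n * (1 - (1/2) ^ k)"
      by (intro add_mono assms Suc)
    also have "\<dots> = 2 * c * (1/2) ^ n * (1 - (1/2) ^ Suc k)"
      by (simp add: power_add algebra_simps)
    finally show ?case .
  qed simp
  have inc': "\<bar>a m - a n\<bar> \<le> 2 * c * (1/2) ^ n" if "m \<ge> n" for m n
  proof -
    have "2 * c * (1/2) ^ n * (1 - (1/2) ^ (m - n)) \<le> 2 * c * (1/2) ^ n * 1"
      using c by (intro mult_left_mono) auto
    then show ?thesis using inc[of n "m - n"] that by simp
  qed
  have z: "(\<lambda>n. 2 * c * (1/2) ^ n) \<longlonglongrightarrow> 0"
    using tendsto_mult_right_zero[OF LIMSEQ_power_zero[of "1/2::real"], of "2 * c"] by simp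
  have "Cauchy a"
    unfolding Cauchy_altdef
  proof (intro allI impI)
    fix e :: real assume "e > 0"
    then obtain N where N: "\<And>n. n \<ge> N \<Longrightarrow> 2 * c * (1/2) ^ n < e"
      using order_tendstoD(2)[OF z] unfolding eventually_sequentially by blast
    show "\<exists>M. \<forall>m\<ge>M. \<forall>n>m. dist (a m) (a n) < e"
    proof (intro exI[of _ N] allI impI)
      fix m n assume "m \<ge> N" "n > m"
      then show "dist (a m) (a n) < e"
        using inc'[of m n] N[of m] by (simp add: dist_real_def abs_minus_commute)
    qed
  qed
  then have "a \<longlonglongrightarrow> lim a" using Cauchy_convergent_iff convergent_LIMSEQ_iff by blast
  then have "(\<lambda>m. \<bar>a m - a n\<bar>) \<longlonglongrightarrow> \<bar>lim a - a n\<bar>" by (intro tendsto_intros)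
  then show ?thesis
    by (rule tendsto_upperbound) (use inc' in \<open>auto simp: eventually_sequentially\<close>)
qed

section \<open>The semilinear Dirichlet problem\<close>

text \<open>Accuracy is needed only on a ball: far out the weighted tolerance exceeds
  \<open>C + 1\<close>, which bounds the error anyway. The one-sided bound
  \<open>p z \<le> e\<close> is kept because it later yields the sharp upper bound on the
  solution.\<close>

lemma trig_approx_weighted:
  fixes g :: "(real^'n::finite) \<times> real \<Rightarrow> real"
  assumes S: "closed S" "continuous_on S g" "S \<subseteq> UNIV \<times> {0..T}"
    and g: "\<And>z. z \<in> S \<Longrightarrow> - C \<le> g z \<and> g z \<le> 0" and C: "C \<ge> 0"
    and e: "0 < e" "e \<le> 1" and T: "T > 0" and l: "l \<ge> 0"
  obtains p where "trig p" "\<And>z. - C - 1 \<le> p z" "\<And>z. p z \<le> e"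
    "\<And>x t. (x,t) \<in> S \<Longrightarrow> \<bar>p (x,t) - g (x,t)\<bar> \<le> e * weight l x t"
proof -
  \<comment> \<open>For \<open>norm x \<ge> k \<ge> 1\<close> one has
    \<open>e |x|^2 \<ge> e k = C + 1\<close>; here \<open>k \<ge> 1\<close> comes from
    \<open>e \<le> 1\<close>. Adding \<open>T\<close> in \<open>R\<close> allows for the time
    component of the norm.\<close>
  define k where "k = (C + 1) / e"
  have k: "k \<ge> 1" using C e by (simp add: k_def field_simps)
  define R where "R = T + k"
  have R: "R > 0" using T k by (simp add: R_def)
  obtain p where p: "trig p" "\<And>z. - C - e \<le> p z" "\<And>z. p z \<le> 0 + e"
    "\<And>z. z \<in> S \<Longrightarrow> norm z \<le> R \<Longrightarrow> \<bar>p z - g z\<bar> \<le> e"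
    using trig_approx[OF S(1,2), of "- C" 0 R e] g C R e(1) by auto
  show ?thesis
  proof (rule that[OF p(1)])
    show "- C - 1 \<le> p z" for z using p(2)[of z] e by linarith
    show "p z \<le> e" for z using p(3)[of z] by simp
    fix x t assume xt: "(x,t) \<in> S"
    then have t: "0 \<le> t" "t \<le> T" using S(3) by auto
    have w: "e * (1 + (norm x)\<^sup>2) \<le> e * weight l x t"
      using weight_ge[OF l t(1)] e by (intro mult_left_mono) auto
    show "\<bar>p (x,t) - g (x,t)\<bar> \<le> e * weight l x t"
    proof (cases "norm (x,t) \<le> R")
      case True
      have "e * 1 \<le> e * (1 + (norm x)\<^sup>2)" using e by (intro mult_left_mono) auto
      then show ?thesis using p(4)[OF xt True] w by linarith
    next
      case False
      have "norm (x,t) \<le> norm x + norm t" by (rule norm_Pair_le)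
      then have "k \<le> norm x" using False t by (simp add: R_def)
      then have "k * 1 \<le> norm x * norm x" using k by (intro mult_mono) auto
      then have "e * k \<le> e * (1 + (norm x)\<^sup>2)" using e by (intro mult_left_mono) (auto simp: power2_eq_square)
      moreover have "e * k = C + 1" using e by (simp add: k_def)
      moreover have "\<bar>p (x,t) - g (x,t)\<bar> \<le> C + 1"
        using p(2,3)[of "(x,t)"] g[OF xt] e C by (simp add: abs_le_iff)
      ultimately show ?thesis using w by linarith
    qed
  qed
qed

text \<open>On a bounded set the weight is bounded, so convergence in the weighted norm is uniform
  there.\<close>

lemma continuous_on_weighted_limit:
  fixes w :: "real^'n::finite \<Rightarrow> real \<Rightarrow> real"
  assumes c: "\<And>n. continuous_on (S \<inter> ball 0 R) (\<lambda>(x,t). u n x t)"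
    and lim: "\<And>n x t. (x,t) \<in> S \<Longrightarrow> \<bar>w x t - u n x t\<bar> \<le> c * (1/2) ^ n * weight l x t" and l: "l \<ge> 0"
    and c0: "c \<ge> 0"
  shows "continuous_on (S \<inter> ball 0 R) (\<lambda>(x,t). w x t)"
proof (rule continuous_on_uniform_approx)
  fix e :: real assume e: "e > 0"
  define M where "M = c * (exp (l * R) * (1 + R\<^sup>2))"
  have wM: "c * weight l x t \<le> M" if xt: "(x,t) \<in> ball 0 R" for x :: "real^'n" and t
  proof -
    have "norm x \<le> norm (x,t)" "norm t \<le> norm (x,t)"
      using norm_fst_le[of x t] norm_snd_le[of t x] by auto
    then have "norm x \<le> R" "t \<le> R" using xt by auto
    then have "exp (l * t) * (1 + (norm x)\<^sup>2) \<le> exp (l * R) * (1 + R\<^sup>2)"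
      using l by (intro mult_mono add_mono power_mono) (auto intro: mult_left_mono)
    then show ?thesis unfolding M_def weight_def using c0 by (intro mult_left_mono)
  qed
  have "(\<lambda>n. M * (1/2) ^ n) \<longlonglongrightarrow> 0"
    using tendsto_mult_right_zero[OF LIMSEQ_power_zero[of "1/2::real"], of M] by simp
  from order_tendstoD(2)[OF this e] obtain n where n: "M * (1/2) ^ n < e"
    unfolding eventually_sequentially by blast
  have "\<bar>u n x t - w x t\<bar> \<le> e" if "(x,t) \<in> S \<inter> ball 0 R" for x t
  proof -
    have "\<bar>w x t - u n x t\<bar> \<le> c * (1/2) ^ n * weight l x t" using lim that by auto
    also have "\<dots> = c * weight l x t * (1/2) ^ n" by simp
    also have "\<dots> \<le> M * (1/2) ^ n" using wM[of x t] that by (intro mult_right_mono) auto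
    finally show ?thesis using n by (simp add: abs_minus_commute)
  qed
  then show "\<exists>g. continuous_on (S \<inter> ball 0 R) g \<and> (\<forall>z\<in>S \<inter> ball 0 R. \<bar>g z - (case z of (x,t) \<Rightarrow> w x t)\<bar> \<le> e)"
    using c[of n] by (intro exI[of _ "\<lambda>(x,t). u n x t"]) auto
qed

lemma continuous_on_Int_balls:
  fixes f :: "'a::real_normed_vector \<Rightarrow> real"
  assumes "\<And>R. continuous_on (S \<inter> ball 0 R) f"
  shows "continuous_on S f"
  unfolding continuous_on_eq_continuous_within
proof
  fix z assume z: "z \<in> S"
  have "at z within (S \<inter> ball 0 (norm z + 1)) = at z within S"
    by (rule at_within_nhd[of z "ball 0 (norm z + 1)"]) auto
  moreover have "z \<in> S \<inter> ball 0 (norm z + 1)" using z by simp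
  ultimately show "continuous (at z within S) f"
    using assms[of "norm z + 1"] unfolding continuous_on_eq_continuous_within by metis
qed

text \<open>Picard iteration, with the right-hand side of each step replaced by a trigonometric sum; it
  contracts in the norm weighted by \<open>weight l\<close> for large \<open>l\<close>.\<close>

lemma semilinear_dirichlet_exists:
  fixes \<Omega> :: "(real^'n::finite) set"
  assumes \<Omega>: "open \<Omega>" "PWC \<Omega>" and T: "T > 0"
    and G: "continuous_on {0..} G" "\<And>t. t \<ge> 0 \<Longrightarrow> 0 \<le> G t \<and> G t \<le> M"
    and f: "\<And>s. - C \<le> f s \<and> f s \<le> 0" "\<And>s s'. \<bar>f s - f s'\<bar> \<le> L * \<bar>s - s'\<bar>"
  obtains w where "continuous_on (closure \<Omega> \<times> {0..T}) (\<lambda>(x,t). w x t)"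
    "wsol (\<Omega> \<times> {0<..<T}) w (\<lambda>x t. f (w x t))"
    "\<And>x t. x \<in> closure \<Omega> \<Longrightarrow> 0 \<le> t \<Longrightarrow> t \<le> T \<Longrightarrow> - (C + 1) * T \<le> w x t \<and> w x t \<le> M"
    "\<And>x t. x \<in> frontier \<Omega> \<Longrightarrow> 0 \<le> t \<Longrightarrow> t \<le> T \<Longrightarrow> w x t = G t"
    "\<And>x. x \<in> \<Omega> \<Longrightarrow> w x 0 = G 0"
proof -
  let ?S = "closure \<Omega> \<times> {0..T}"
  let ?N = "real CARD('n)"
  have C: "C \<ge> 0" using f(1)[of 0] by linarith
  have L: "L \<ge> 0" using f(2)[of 0 1] by simp
  \<comment> \<open>In units of \<open>(1/2) ^ Suc n\<close> times the weight, two consecutive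
    sources differ by \<open>3 + 2 L A\<close>: errors 1 and 2 of the trigonometric approximations,
    and \<open>2 L A\<close> from the Lipschitz bound. Since \<open>A \<ge> 1\<close>, this is at
    most \<open>A * (6 + 2 * L)\<close>.\<close>
  define l where "l = 2 * ?N + (6 + 2 * L)"
  have l: "l \<ge> 0" using L by (simp add: l_def)
  define good where "good = (\<lambda>w p. dirichlet_sol \<Omega> T G w (\<lambda>x t. p (x,t)) \<and> (\<forall>z. - C - 1 \<le> p z \<and> p z \<le> 1))"
  \<comment> \<open>Both the approximation error of the source and its possible positive part halve
    with each iterate; the latter gives \<open>w x t \<le> M\<close> in the limit.\<close>
  define step where "step = (\<lambda>n w p. (\<forall>z. p z \<le> (1/2) ^ n) \<and>
     (\<forall>(x,t)\<in>?S. \<bar>p (x,t) - f (w x t)\<bar> \<le> (1/2) ^ n * weight l x t))"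
  have cf: "continuous_on UNIV f"
  proof (rule continuous_onI)
    fix s e :: real assume e: "e > 0"
    show "\<exists>d>0. \<forall>s'\<in>UNIV. dist s' s < d \<longrightarrow> dist (f s') (f s) \<le> e"
    proof (intro exI[of _ "e / (L + 1)"] conjI ballI impI)
      show "e / (L + 1) > 0" using e L by simp
      fix s' assume "dist s' s < e / (L + 1)"
      then have "(L + 1) * \<bar>s' - s\<bar> \<le> e" using L by (simp add: dist_real_def pos_less_divide_eq mult.commute)
      then show "dist (f s') (f s) \<le> e" using f(2)[of s' s] by (simp add: dist_real_def algebra_simps)
    qed
  qed
  have ex: "\<exists>w' p'. good w' p' \<and> step n w p'" if c: "continuous_on ?S (\<lambda>(x,t). w x t)" for n w
  proof -
    have "continuous_on ?S (\<lambda>z. f (case z of (x,t) \<Rightarrow> w x t))"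
      by (rule continuous_on_compose2[OF cf c]) auto
    from trig_approx_weighted[OF _ this _ _ C _ _ T l, of "(1/2)^n"] f(1)
    obtain p where p: "trig p" "\<And>z. - C - 1 \<le> p z" "\<And>z. p z \<le> (1/2) ^ n"
      "\<And>x t. (x,t) \<in> ?S \<Longrightarrow> \<bar>p (x,t) - f (w x t)\<bar> \<le> (1/2) ^ n * weight l x t"
      by (auto simp: closed_Times power_le_one)
    obtain w' where "dirichlet_sol \<Omega> T G w' (\<lambda>x t. p (x,t))"
      using dirichlet_sol_exists[OF \<Omega> T p(1) G(1), of M] G(2) by auto
    moreover have "p z \<le> 1" for z using p(3)[of z] power_le_one[of "1/2::real" n] by linarith
    ultimately show ?thesis unfolding good_def step_def using p by (intro exI[of _ w'] exI[of _ p]) auto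
  qed
  have cg: "continuous_on ?S (\<lambda>(x,t). w x t)" if "good w p" for w p
    using that unfolding good_def dirichlet_sol_def by blast
  have "\<exists>w0 p0. good w0 p0" using ex[of "\<lambda>x t. 0" 0] by (auto simp: case_prod_beta)
  moreover have "\<exists>y. (case y of (w,p) \<Rightarrow> good w p) \<and> step n (fst x) (snd y)"
    if "case x of (w,p) \<Rightarrow> good w p" for x n
  proof -
    obtain w p where x: "x = (w,p)" by fastforce
    then have "good w p" using that by simp
    then obtain w' p' where "good w' p'" "step n w p'" using ex[OF cg] by blast
    then show ?thesis using x by (intro exI[of _ "(w',p')"]) auto
  qed
  ultimately obtain sq where sq: "\<And>n. (case sq n of (w,p) \<Rightarrow> good w p)" "\<And>n. step n (fst (sq n)) (snd (sq (Suc n)))"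
    using dependent_nat_choice[of "\<lambda>n y. case y of (w,p) \<Rightarrow> good w p" "\<lambda>n x y. step n (fst x) (snd y)"]
    by (metis (mono_tags, lifting) case_prodI)
  define u where "u = (\<lambda>n. fst (sq n))"
  define p where "p = (\<lambda>n. snd (sq n))"
  have good: "good (u n) (p n)" for n using sq(1)[of n] by (simp add: u_def p_def case_prod_beta)
  have ds: "dirichlet_sol \<Omega> T G (u n) (\<lambda>x t. p n (x,t))" for n using good[of n] by (simp add: good_def)
  have step1: "p (Suc n) z \<le> (1/2) ^ n" for n z using sq(2)[of n] unfolding step_def p_def by blast
  have step2: "\<bar>p (Suc n) (x,t) - f (u n x t)\<bar> \<le> (1/2) ^ n * weight l x t"
    if "x \<in> closure \<Omega>" "0 \<le> t" "t \<le> T" for n x t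
    using sq(2)[of n] that by (simp add: step_def p_def u_def)
  \<comment> \<open>All sources lie in \<open>[- C - 1, 1]\<close>, so two of them differ by at most
    \<open>C + 2\<close>, which is at most \<open>A\<close>; this starts the induction.\<close>
  define A where "A = 2 * C + 3"
  have A: "A \<ge> 1" using C by (simp add: A_def)
  have inc: "\<bar>u (Suc n) x t - u n x t\<bar> \<le> A * (1/2) ^ n * weight l x t"
    if "x \<in> closure \<Omega>" "0 \<le> t" "t \<le> T" for n x t
    using that
  proof (induction n arbitrary: x t)
    case 0
    have b: "\<bar>p (Suc 0) (x,t) - p 0 (x,t)\<bar> \<le> A * (l - 2 * ?N) * weight l x t" if "0 \<le> t" for x t
    proof -
      have "\<bar>p (Suc 0) (x,t) - p 0 (x,t)\<bar> \<le> A * 1 * 1"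
        using good[of 0] good[of "Suc 0"] C unfolding good_def A_def by (smt (verit))
      also have "\<dots> \<le> A * (l - 2 * ?N) * weight l x t"
        using A L weight_ge[OF l that, of x]
        by (intro mult_mono) (auto simp: l_def intro: order_trans[rotated])
      finally show ?thesis .
    qed
    have "u (Suc 0) x t - u 0 x t \<le> A * weight l x t"
      by (rule dirichlet_sol_weighted_diff[OF \<Omega>(1) ds ds]) (use b A 0 in \<open>auto simp: abs_le_iff\<close>)
    moreover have "u 0 x t - u (Suc 0) x t \<le> A * weight l x t"
      by (rule dirichlet_sol_weighted_diff[OF \<Omega>(1) ds ds]) (use b A 0 in \<open>auto simp: abs_le_iff\<close>)
    ultimately show ?case by (simp add: abs_le_iff)
  next
    case (Suc n)
    let ?c = "A * (1/2) ^ Suc n"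
    have c: "?c \<ge> 0" using A by simp
    have b: "\<bar>p (Suc (Suc n)) (x,t) - p (Suc n) (x,t)\<bar> \<le> ?c * (l - 2 * ?N) * weight l x t"
      if xt: "x \<in> \<Omega>" "0 < t" "t \<le> T" for x t
    proof -
      have xc: "x \<in> closure \<Omega>" "0 \<le> t" using xt closure_subset by auto
      let ?w = "(1/2) ^ Suc n * weight l x t"
      have w0: "?w \<ge> 0" using weight_pos[of l x t] by simp
      have "\<bar>p (Suc (Suc n)) (x,t) - f (u (Suc n) x t)\<bar> \<le> ?w" using step2[OF xc xt(3)] .
      moreover have "\<bar>p (Suc n) (x,t) - f (u n x t)\<bar> \<le> 2 * ?w" using step2[OF xc xt(3), of n] by simp
      moreover have "\<bar>f (u (Suc n) x t) - f (u n x t)\<bar> \<le> L * (A * (1/2) ^ n * weight l x t)"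
        using f(2) mult_left_mono[OF Suc.IH[OF xc xt(3)] L] by (rule order_trans)
      moreover have "L * (A * (1/2) ^ n * weight l x t) = 2 * L * A * ?w" by simp
      ultimately have "\<bar>p (Suc (Suc n)) (x,t) - p (Suc n) (x,t)\<bar> \<le> 3 * ?w + 2 * L * A * ?w" by linarith
      also have "\<dots> = (3 + 2 * L * A) * ?w" by (simp add: distrib_right)
      also have "\<dots> \<le> (A * (l - 2 * ?N)) * ?w"
        using A w0 by (intro mult_right_mono) (auto simp: l_def algebra_simps)
      finally show ?thesis by (simp add: mult_ac)
    qed
    note b' = b[unfolded abs_minus_commute[of "p (Suc (Suc n)) _"]]
    have "u (Suc (Suc n)) x t - u (Suc n) x t \<le> ?c * weight l x t"
      by (rule dirichlet_sol_weighted_diff[OF \<Omega>(1) ds ds _ c Suc.prems], rule abs_le_D1[OF b])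
    moreover have "u (Suc n) x t - u (Suc (Suc n)) x t \<le> ?c * weight l x t"
      by (rule dirichlet_sol_weighted_diff[OF \<Omega>(1) ds ds _ c Suc.prems], rule abs_le_D1[OF b'])
    ultimately show ?case by linarith
  qed
  define w where "w = (\<lambda>x t. lim (\<lambda>n. u n x t))"
  have wu: "\<bar>w x t - u n x t\<bar> \<le> 2 * A * (1/2) ^ n * weight l x t" if "(x,t) \<in> ?S" for n x t
    using geometric_increments_limit[of "\<lambda>n. u n x t" "A * weight l x t" n] inc that
    by (auto simp: w_def mult_ac)
  have A2: "2 * A \<ge> 0" using A by simp
  have half: "(\<lambda>n. c * (1/2) ^ n) \<longlonglongrightarrow> 0" for c :: real
    using tendsto_mult_right_zero[OF LIMSEQ_power_zero[of "1/2::real"], of c] by simp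
  have ulim: "(\<lambda>n. u n x t) \<longlonglongrightarrow> w x t" if "(x,t) \<in> ?S" for x t
  proof -
    have "(\<lambda>n. 2 * A * weight l x t * (1/2) ^ n) \<longlonglongrightarrow> 0" by (rule half)
    then have "(\<lambda>n. u n x t - w x t) \<longlonglongrightarrow> 0"
      by (rule Lim_null_comparison[rotated])
         (use wu[OF that] in \<open>auto simp: abs_minus_commute mult_ac intro!: always_eventually\<close>)
    then show ?thesis by (simp add: LIM_zero_iff)
  qed
  show ?thesis
  proof (rule that[of w])
    show "continuous_on ?S (\<lambda>(x,t). w x t)"
    proof (rule continuous_on_Int_balls)
      fix R
      show "continuous_on (?S \<inter> ball 0 R) (\<lambda>(x,t). w x t)"
        by (rule continuous_on_weighted_limit[OF _ wu l A2])
           (auto intro: continuous_on_subset[OF cg[OF good]])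
    qed
    \<comment> \<open>The crude lower bound serves only as the boundedness that later comparisons on
      \<open>\<Omega>\<close> require; nonnegativity is obtained from such a comparison.\<close>
    show "- (C + 1) * T \<le> w x t \<and> w x t \<le> M" if xt: "x \<in> closure \<Omega>" "0 \<le> t" "t \<le> T" for x t
    proof
      have "- C - 1 \<le> p n z" for n z using good[of n] unfolding good_def by blast
      then have pl: "- p n z \<le> C + 1" for n z by (smt (verit))
      have le: "- u n x t \<le> 0 + (C + 1) * t" for n
        by (rule dirichlet_sol_le[OF \<Omega>(1) dirichlet_sol_minus[OF ds]])
           (use pl G(2) xt C in auto)
      have "- (C + 1) * t \<le> u n x t" for n using le[of n] by (simp add: algebra_simps)
      then have "- (C + 1) * t \<le> w x t"
        using tendsto_lowerbound[OF ulim[of x t]] xt by auto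
      moreover have "(C + 1) * t \<le> (C + 1) * T" using C xt by (intro mult_left_mono) auto
      ultimately show "- (C + 1) * T \<le> w x t" by (simp add: algebra_simps)
      \<comment> \<open>The source of iterate \<open>Suc n\<close> may be positive, but by at most
        \<open>(1/2) ^ n\<close>, so the excess over \<open>M\<close> disappears in the
        limit.\<close>
      have "u (Suc n) x t \<le> M + (1/2) ^ n * t" for n
        by (rule dirichlet_sol_le[OF \<Omega>(1) ds]) (use step1 G(2) xt in auto)
      moreover have "(\<lambda>n. M + t * (1/2) ^ n) \<longlonglongrightarrow> M + 0" by (intro tendsto_add tendsto_const half)
      moreover have "(\<lambda>n. u (Suc n) x t) \<longlonglongrightarrow> w x t" using LIMSEQ_Suc[OF ulim] xt by auto
      ultimately show "w x t \<le> M"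
        using LIMSEQ_le[of "\<lambda>n. u (Suc n) x t" "w x t" "\<lambda>n. M + t * (1/2) ^ n" M] by (auto simp: mult.commute)
    qed
    show "w x t = G t" if "x \<in> frontier \<Omega>" "0 \<le> t" "t \<le> T" for x t
    proof -
      have "u n x t = G t" for n using ds[of n] that unfolding dirichlet_sol_def by auto
      then show ?thesis by (simp add: w_def)
    qed
    show "w x 0 = G 0" if "x \<in> \<Omega>" for x
    proof -
      have "u n x 0 = G 0" for n using ds[of n] that unfolding dirichlet_sol_def by auto
      then show ?thesis by (simp add: w_def)
    qed
    show "wsol (\<Omega> \<times> {0<..<T}) w (\<lambda>x t. f (w x t))"
      unfolding wsol_def
    proof (intro allI impI, elim conjE)
      fix K and e :: real assume K: "compact K" "K \<subseteq> \<Omega> \<times> {0<..<T}" and e: "e > 0"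
      have "\<Omega> \<times> {0<..<T} \<subseteq> ?S" using closure_subset[of \<Omega>] by auto
      with K(2) have KS: "K \<subseteq> ?S" by (rule order_trans)
      have "compact ((\<lambda>(x,t). weight l x t) ` K)"
        by (rule compact_continuous_image[OF continuous_on_weight K(1)])
      then have "bdd_above ((\<lambda>(x,t). weight l x t) ` K)"
        by (intro bounded_imp_bdd_above compact_imp_bounded)
      then obtain m where "\<forall>y\<in>(\<lambda>(x,t). weight l x t) ` K. y \<le> m" unfolding bdd_above_def by blast
      then have m: "\<And>x t. (x,t) \<in> K \<Longrightarrow> weight l x t \<le> m" by auto
      \<comment> \<open>Its summands cover the distance of the iterate from \<open>w\<close>, the
        error of its source, and the Lipschitz effect of replacing \<open>u n\<close> by
        \<open>w\<close>.\<close>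
      define c where "c = (2 * A + 1 + 2 * A * L)"
      have c: "c \<ge> 0" using A L by (simp add: c_def)
      obtain n where n: "c * m * (1/2) ^ n < e"
        using order_tendstoD(2)[OF half e] unfolding eventually_sequentially by blast
      have "\<bar>u (Suc n) x t - w x t\<bar> \<le> e \<and> \<bar>p (Suc n) (x,t) - f (w x t)\<bar> \<le> e" if xt: "(x,t) \<in> K" for x t
      proof -
        have xS: "(x,t) \<in> ?S" using xt KS by auto
        let ?w = "(1/2) ^ n * weight l x t"
        have w0: "?w \<ge> 0" using weight_pos[of l x t] by simp
        have "c * ?w \<le> c * ((1/2) ^ n * m)" using m[OF xt] c by (intro mult_left_mono) auto
        then have cw: "c * ?w \<le> e" using n by (simp add: mult_ac)
        have ce: "c * ?w = 2 * A * ?w + ?w + L * (2 * A * ?w)" by (simp add: c_def algebra_simps)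
        have p1: "2 * A * ?w \<ge> 0" "L * (2 * A * ?w) \<ge> 0" using A L w0 by auto
        have "\<bar>w x t - u (Suc n) x t\<bar> \<le> A * ?w" using wu[OF xS, of "Suc n"] by (simp add: mult_ac)
        then have 1: "\<bar>u (Suc n) x t - w x t\<bar> \<le> e" using p1 w0 cw ce by linarith
        have "\<bar>p (Suc n) (x,t) - f (u n x t)\<bar> \<le> ?w" using step2[of x t n] xS by auto
        moreover have "\<bar>f (u n x t) - f (w x t)\<bar> \<le> L * (2 * A * ?w)"
        proof -
          have "\<bar>u n x t - w x t\<bar> \<le> 2 * A * ?w" using wu[OF xS, of n] by (simp add: abs_minus_commute mult_ac)
          then show ?thesis using f(2)[of "u n x t" "w x t"] mult_left_mono[OF _ L] by (meson order_trans)
        qed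
        ultimately have "\<bar>p (Suc n) (x,t) - f (w x t)\<bar> \<le> e" using p1 cw ce by linarith
        with 1 show ?thesis by blast
      qed
      moreover have "caloric_on K (u (Suc n)) (\<lambda>x t. p (Suc n) (x,t))"
      proof (rule caloric_on_subset)
        show "caloric_on (\<Omega> \<times> {0<..}) (u (Suc n)) (\<lambda>x t. p (Suc n) (x,t))"
          using ds[of "Suc n"] unfolding dirichlet_sol_def by blast
        show "K \<subseteq> \<Omega> \<times> {0<..}" using K(2) by auto
      qed
      ultimately show "\<exists>v g. caloric_on K v g \<and> (\<forall>(x,t)\<in>K. \<bar>v x t - w x t\<bar> \<le> e \<and> \<bar>g x t - f (w x t)\<bar> \<le> e)"
        by blast
    qed
  qed
qed

section \<open>A priori bounds\<close>

definition ode_sol :: "real \<Rightarrow> real \<Rightarrow> real" where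
  "ode_sol q t = ((q - 1) * t) powr (- 1 / (q - 1))"

lemma ode_sol_nonneg: "0 \<le> ode_sol q t"
  by (simp add: ode_sol_def)

lemma ode_sol_pos: "q > 1 \<Longrightarrow> t > 0 \<Longrightarrow> ode_sol q t > 0"
  by (simp add: ode_sol_def)

lemma ode_sol_DERIV:
  assumes "q > 1" "t > 0"
  shows "(ode_sol q has_real_derivative - (ode_sol q t powr q)) (at t)"
proof -
  have e: "- 1 / (q - 1) - 1 = (- 1 / (q - 1)) * q" using assms by (simp add: field_simps)
  have "((\<lambda>t. ((q - 1) * t) powr (- 1 / (q - 1))) has_real_derivative
      (- 1 / (q - 1)) * ((q - 1) * t) powr (- 1 / (q - 1) - 1) * (q - 1)) (at t)"
    by (rule DERIV_chain2[OF has_real_derivative_powr]) (use assms in \<open>auto intro!: derivative_eq_intros\<close>)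
  then show ?thesis
    unfolding ode_sol_def[abs_def] powr_powr e using assms by simp
qed

lemma ode_sol_antimono:
  assumes "q > 1" "0 < s" "s \<le> t"
  shows "ode_sol q t \<le> ode_sol q s"
  unfolding ode_sol_def by (rule powr_mono2') (use assms in auto)

lemma powr_blowup:
  fixes c r B :: real
  assumes "c > 0" "r > 0"
  obtains d where "d > 0" "\<And>s. 0 < s \<Longrightarrow> s \<le> d \<Longrightarrow> B \<le> c * s powr (- r)"
proof -
  define d where "d = (c / (\<bar>B\<bar> + 1)) powr (1 / r)"
  have d: "d > 0" using assms by (simp add: d_def)
  show ?thesis
  proof (rule that[OF d])
    fix s assume s: "0 < s" "s \<le> d"
    have "s powr r \<le> d powr r" using s assms by (intro powr_mono2) auto
    also have "d powr r = c / (\<bar>B\<bar> + 1)" using assms by (simp add: d_def powr_powr)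
    finally have "s powr r * (\<bar>B\<bar> + 1) \<le> c" by (simp add: pos_le_divide_eq)
    then have "\<bar>B\<bar> + 1 \<le> c / s powr r" using s by (simp add: pos_le_divide_eq mult.commute)
    then show "B \<le> c * s powr (- r)" by (simp add: powr_minus divide_inverse)
  qed
qed

lemma ode_sol_blowup:
  assumes "q > 1"
  obtains d where "d > 0" "\<And>s. 0 < s \<Longrightarrow> s \<le> d \<Longrightarrow> B \<le> ode_sol q s"
proof -
  obtain d where d: "d > 0" "\<And>s. 0 < s \<Longrightarrow> s \<le> d \<Longrightarrow> B \<le> 1 * s powr (- (1 / (q - 1)))"
    using powr_blowup[of 1 "1 / (q - 1)" B] assms by auto
  show ?thesis
  proof (rule that[of "d / (q - 1)"])
    show "d / (q - 1) > 0" using d assms by simp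
    fix s assume "0 < s" "s \<le> d / (q - 1)"
    then show "B \<le> ode_sol q s"
      using d(2)[of "(q - 1) * s"] assms by (simp add: ode_sol_def pos_le_divide_eq mult.commute)
  qed
qed

text \<open>The solution \<open>A s^(- p)\<close> of \<open>z'' = z^q\<close> on the half-line:
  \<open>p = 2 / (q - 1)\<close> matches the powers, since \<open>p q = p + 2\<close>, and
  \<open>A^(q - 1) = p (p + 1)\<close> matches the constants.\<close>

definition stat_sol :: "real \<Rightarrow> real \<Rightarrow> real" where
  "stat_sol q s = (2 / (q - 1) * (2 / (q - 1) + 1)) powr (1 / (q - 1)) * s powr (- (2 / (q - 1)))"

lemma stat_sol_nonneg: "0 \<le> stat_sol q s"
  by (simp add: stat_sol_def)

lemma stat_sol_blowup:
  assumes "q > 1"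
  obtains d where "d > 0" "\<And>s. 0 < s \<Longrightarrow> s \<le> d \<Longrightarrow> B \<le> stat_sol q s"
proof -
  have "(2 / (q - 1) * (2 / (q - 1) + 1)) powr (1 / (q - 1)) > 0"
    using assms by (smt (verit) divide_pos_pos mult_pos_pos powr_gt_zero)
  then show ?thesis using powr_blowup[of _ "2 / (q - 1)" B] assms that unfolding stat_sol_def by (smt (verit) divide_pos_pos)
qed

lemma stat_sol_DERIV:
  fixes q :: real
  assumes q: "q > 1"
  obtains g where "\<And>s. s > 0 \<Longrightarrow> (stat_sol q has_real_derivative g s) (at s)"
    "\<And>s. s > 0 \<Longrightarrow> (g has_real_derivative stat_sol q s powr q) (at s)"
proof -
  define p where "p = 2 / (q - 1)"
  define A where "A = (p * (p + 1)) powr (1 / (q - 1))"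
  have p: "p > 0" using q by (simp add: p_def)
  have pq: "- p * q = - p - 1 - 1" using q by (simp add: p_def field_simps)
  have Z: "stat_sol q = (\<lambda>s. A * s powr (- p))" by (simp add: stat_sol_def p_def A_def fun_eq_iff)
  have "A > 0" using p by (simp add: A_def)
  then have "A powr q = A powr (q - 1) * A" using powr_add[of A "q - 1" 1] by simp
  also have "A powr (q - 1) = p * (p + 1)" using p q by (simp add: A_def powr_powr)
  finally have Aq: "A powr q = A * (p * (p + 1))" by simp
  have A0: "A \<ge> 0" by (simp add: A_def)
  show ?thesis
  proof (rule that[of "\<lambda>s. A * (- p * s powr (- p - 1))"])
    fix s :: real assume s: "s > 0"
    show "(stat_sol q has_real_derivative A * (- p * s powr (- p - 1))) (at s)"
      unfolding Z using s by (intro DERIV_cmult has_real_derivative_powr)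
    have "((\<lambda>s. A * (- p * s powr (- p - 1))) has_real_derivative A * (- p * ((- p - 1) * s powr (- p - 1 - 1)))) (at s)"
      using s by (intro DERIV_cmult has_real_derivative_powr)
    moreover have "stat_sol q s powr q = A powr q * s powr (- p * q)"
      unfolding Z using A0 s by (simp add: powr_mult powr_powr)
    then have "stat_sol q s powr q = A * (- p * ((- p - 1) * s powr (- p - 1 - 1)))"
      unfolding Aq pq by (simp add: algebra_simps)
    ultimately show "((\<lambda>s. A * (- p * s powr (- p - 1))) has_real_derivative stat_sol q s powr q) (at s)" by simp
  qed
qed

text \<open>Write \<open>a powr q\<close> as \<open>a * a powr (q - 1)\<close> and enlarge the
  second factor to \<open>(a + b) powr (q - 1)\<close>; likewise for \<open>b\<close>.\<close>

lemma powr_superadditive: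
  fixes a b q :: real
  assumes "a \<ge> 0" "b \<ge> 0" "q \<ge> 1"
  shows "a powr q + b powr q \<le> (a + b) powr q"
proof -
  have e: "c powr q = c * c powr (q - 1)" if "c \<ge> 0" for c
    using that by (cases "c = 0") (auto simp: powr_mult_base)
  have "a powr q + b powr q = a * a powr (q - 1) + b * b powr (q - 1)" using e assms by simp
  also have "\<dots> \<le> a * (a + b) powr (q - 1) + b * (a + b) powr (q - 1)"
    using assms by (intro add_mono mult_left_mono powr_mono2) auto
  also have "\<dots> = (a + b) powr q" using e[of "a + b"] assms by (simp add: distrib_right)
  finally show ?thesis .
qed

lemma powr_sum_superadditive:
  fixes f :: "'a \<Rightarrow> real"
  assumes "finite S" "\<And>i. i \<in> S \<Longrightarrow> f i \<ge> 0" "q \<ge> 1"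
  shows "(\<Sum>i\<in>S. f i powr q) \<le> (\<Sum>i\<in>S. f i) powr q"
  using assms
proof (induction S rule: finite_induct)
  case (insert i S)
  have "(\<Sum>i\<in>insert i S. f i powr q) \<le> f i powr q + (\<Sum>i\<in>S. f i) powr q" using insert by simp
  also have "\<dots> \<le> (f i + (\<Sum>i\<in>S. f i)) powr q" using insert by (intro powr_superadditive sum_nonneg) auto
  finally show ?case using insert by simp
qed simp

lemma J_heat_at:
  assumes "open \<Omega>" "v \<in> J q \<Omega>" "x \<in> \<Omega>" "t > 0"
  shows "heat_at v x t (- (v x t powr q))"
proof -
  have "heat_at v x t (dt v x t - lap v x t)"
    by (rule C21_heat_at[of "\<Omega> \<times> {0<..}"]) (use assms in \<open>auto simp: J_def open_Times\<close>)
  moreover have "dt v x t - lap v x t = - (v x t powr q)" using assms unfolding J_def by force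
  ultimately show ?thesis by simp
qed

text \<open>Keller--Osserman: the barrier adds to the solution of the ODE the one-dimensional stationary
  solutions that blow up on the faces of a cube; the sum is a supersolution since \<open>s\<^sup>q\<close> is superadditive.\<close>

lemma J_le_barrier:
  fixes \<Omega> :: "(real^'n::finite) set"
  assumes q: "q > 1" and \<Omega>: "open \<Omega>" and v: "v \<in> J q \<Omega>" and x0: "x0 \<in> closure \<Omega>"
    and e: "0 < e" "e < T" and R: "\<And>i. \<bar>x0 $ i\<bar> < R"
  shows "v x0 T \<le> ode_sol q (T - e) + (\<Sum>i\<in>UNIV. stat_sol q (R - x0 $ i) + stat_sol q (R + x0 $ i))"
proof -
  define Z where "Z = (\<lambda>x::real^'n. \<Sum>i\<in>UNIV. stat_sol q (R - x $ i) + stat_sol q (R + x $ i))"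
  define b where "b = (\<lambda>x t. ode_sol q (t - e) + Z x)"
  have vc: "continuous_on (closure \<Omega> \<times> {0<..}) (\<lambda>(x,t). v x t)" using v by (simp add: J_def)
  have comp: "compact (closure \<Omega> \<inter> cube 0 \<rho>)" for \<rho> by (simp add: closed_Int_compact compact_cube)
  have "continuous_on ((closure \<Omega> \<inter> cube 0 R) \<times> {e..T}) (\<lambda>(x,t). v x t)"
    by (rule continuous_on_subset[OF vc]) (use e in auto)
  then have "compact ((\<lambda>(x,t). v x t) ` ((closure \<Omega> \<inter> cube 0 R) \<times> {e..T}))"
    by (intro compact_continuous_image compact_Times comp) auto
  then have "bdd_above ((\<lambda>(x,t). v x t) ` ((closure \<Omega> \<inter> cube 0 R) \<times> {e..T}))"
    by (intro bounded_imp_bdd_above compact_imp_bounded)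
  then obtain B where "\<forall>y\<in>(\<lambda>(x,t). v x t) ` ((closure \<Omega> \<inter> cube 0 R) \<times> {e..T}). y \<le> B"
    unfolding bdd_above_def by blast
  then have B: "v x t \<le> B" if "x \<in> closure \<Omega>" "x \<in> cube 0 R" "e \<le> t" "t \<le> T" for x t
    using that by auto
  obtain d1 where d1: "d1 > 0" "\<And>s. 0 < s \<Longrightarrow> s \<le> d1 \<Longrightarrow> B \<le> ode_sol q s" using ode_sol_blowup[OF q] by blast
  obtain d2 where d2: "d2 > 0" "\<And>s. 0 < s \<Longrightarrow> s \<le> d2 \<Longrightarrow> B \<le> stat_sol q s" using stat_sol_blowup[OF q] by blast
  \<comment> \<open>The comparison starts slightly after \<open>e\<close>, at a time when the
    barrier is finite and already exceeds the bound \<open>B\<close> of \<open>v\<close>.\<close>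
  define a where "a = e + min d1 ((T - e) / 2)"
  have a: "e < a" "a \<le> T" "B \<le> ode_sol q (a - e)"
    using d1(1) e d1(2)[of "a - e"] by (auto simp: a_def min_def field_simps)
  define m where "m = Max (range (\<lambda>i. \<bar>x0 $ i\<bar>))"
  have "m \<in> range (\<lambda>i. \<bar>x0 $ i\<bar>)" unfolding m_def by (intro Max_in) auto
  then have "m < R" "0 \<le> m" using R by auto
  moreover have "\<bar>x0 $ i\<bar> \<le> m" for i unfolding m_def by (rule Max_ge) auto
  ultimately have m: "m < R" "0 \<le> m" "\<And>i. \<bar>x0 $ i\<bar> \<le> m" by auto
  \<comment> \<open>The cube is shrunk just inside the singular faces: it still contains
    \<open>x0\<close>, and on its own faces one stationary profile is finite and at least
    \<open>B\<close>.\<close>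
  define \<rho> where "\<rho> = max m (R - d2)"
  have \<rho>: "m \<le> \<rho>" "\<rho> < R" "R - \<rho> \<le> d2" "0 \<le> \<rho>" using m d2(1) by (auto simp: \<rho>_def)
  obtain g where g: "\<And>s. s > 0 \<Longrightarrow> (stat_sol q has_real_derivative g s) (at s)"
    "\<And>s. s > 0 \<Longrightarrow> (g has_real_derivative stat_sol q s powr q) (at s)"
    using stat_sol_DERIV[OF q] by blast
  have c1: "continuous_on {0<..} (stat_sol q)"
    by (rule DERIV_continuous_on, rule has_field_derivative_at_within, rule g(1)) simp
  have c2: "continuous_on {0<..} (ode_sol q)"
    by (rule DERIV_continuous_on, rule has_field_derivative_at_within, rule ode_sol_DERIV[OF q]) simp
  have Z0: "Z x \<ge> 0" for x unfolding Z_def by (intro sum_nonneg add_nonneg_nonneg stat_sol_nonneg)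
  have inR: "\<bar>x $ i\<bar> < R" if "x \<in> cube 0 \<rho>" for x :: "real^'n" and i
    using that \<rho>(2) unfolding mem_cube by (metis diff_zero order_le_less_trans zero_index)
  let ?K = "closure \<Omega> \<inter> cube 0 \<rho>"
  define lo :: "real^'n" where "lo = (\<chi> i. - \<rho>)"
  define hi :: "real^'n" where "hi = (\<chi> i. \<rho>)"
  have cu: "cube (0::real^'n) \<rho> = cbox lo hi" by (simp add: cube_def lo_def hi_def)
  have "v x0 T - b x0 T \<le> 0"
  proof (rule max_principle[where x = x0 and t = T and w = "\<lambda>x t. v x t - b x t"
        and K = ?K and W = "\<Omega> \<inter> box lo hi" and a = a and b = T])
    show "compact ?K" by (rule comp)
    show "open (\<Omega> \<inter> box lo hi)" using \<Omega> by (simp add: open_Int open_box)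
    show "\<Omega> \<inter> box lo hi \<subseteq> ?K" using closure_subset box_subset_cbox unfolding cu by blast
    have 1: "continuous_on (?K \<times> {a..T}) (\<lambda>z. case z of (x,t) \<Rightarrow> v x t)"
      by (rule continuous_on_subset[OF vc]) (use a e in auto)
    have 2: "continuous_on (?K \<times> {a..T}) (\<lambda>z. ode_sol q (snd z - e))"
      by (rule continuous_on_compose2[OF c2]) (use a in \<open>auto intro!: continuous_intros\<close>)
    have im: "R - x $ i \<in> {0<..}" "R + x $ i \<in> {0<..}" if "x \<in> cube 0 \<rho>" for x :: "real^'n" and i
      using inR[OF that, of i] by (auto simp: abs_less_iff)
    have 3: "continuous_on (?K \<times> {a..T}) (\<lambda>z. stat_sol q (R - fst z $ i))" for i
      by (rule continuous_on_compose2[OF c1]) (use im(1) in \<open>auto intro!: continuous_intros\<close>)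
    have 4: "continuous_on (?K \<times> {a..T}) (\<lambda>z. stat_sol q (R + fst z $ i))" for i
      by (rule continuous_on_compose2[OF c1]) (use im(2) in \<open>auto intro!: continuous_intros\<close>)
    have "continuous_on (?K \<times> {a..T}) (\<lambda>z. (case z of (x,t) \<Rightarrow> v x t) - b (fst z) (snd z))"
      unfolding b_def Z_def by (intro continuous_intros 1 2 3 4)
    then show "continuous_on (?K \<times> {a..T}) (\<lambda>(x,t). v x t - b x t)" by (simp add: case_prod_beta)
  next
    fix x t assume x: "x \<in> ?K" and t: "a \<le> t" "t \<le> T" and bd: "x \<notin> \<Omega> \<inter> box lo hi \<or> t = a"
    have "\<rho> \<le> R" using \<rho> by simp
    then have xR: "x \<in> cube 0 R" using x cube_mono[of \<rho> R 0] by blast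
    have vB: "v x t \<le> B" using B[of x t] x xR t a by auto
    have o: "ode_sol q (t - e) \<ge> 0" by (rule ode_sol_nonneg)
    consider "t = a" | "x \<notin> \<Omega>" | "x \<notin> box lo hi" using bd by auto
    then show "v x t - b x t \<le> 0"
    proof cases
      case 1 then show ?thesis using a vB Z0[of x] by (simp add: b_def)
    next
      case 2
      then have "x \<in> frontier \<Omega>" using x \<Omega> by (auto simp: frontier_def interior_open)
      then have "v x t = 0" using v t a e by (auto simp: J_def)
      then show ?thesis using o Z0[of x] by (simp add: b_def)
    next
      case 3
      then obtain i where i: "\<not> (- \<rho> < x $ i \<and> x $ i < \<rho>)" by (auto simp: mem_box_cart lo_def hi_def)
      have "- \<rho> \<le> x $ i \<and> x $ i \<le> \<rho>" using x by (auto simp: cu mem_box_cart lo_def hi_def)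
      then have "R - x $ i = R - \<rho> \<or> R + x $ i = R - \<rho>" using i by auto
      then have "B \<le> stat_sol q (R - x $ i) + stat_sol q (R + x $ i)"
        using d2(2)[of "R - \<rho>"] \<rho> stat_sol_nonneg[of q "R - x $ i"] stat_sol_nonneg[of q "R + x $ i"] by auto
      also have "\<dots> \<le> Z x"
        unfolding Z_def by (rule member_le_sum) (auto intro: add_nonneg_nonneg stat_sol_nonneg)
      finally show ?thesis using vB o by (simp add: b_def)
    qed
  next
    fix x t assume x: "x \<in> \<Omega> \<inter> box lo hi" and t: "a < t" "t \<le> T" and pos: "v x t - b x t > 0"
    have xc: "x \<in> cube 0 \<rho>" using x box_subset_cbox cu by blast
    have h1: "heat_at v x t (- (v x t powr q))" by (rule J_heat_at[OF \<Omega> v]) (use x t a e in auto)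
    have te: "t - e > 0" using t a by simp
    have "((\<lambda>t. ode_sol q (t - e)) has_real_derivative - (ode_sol q (t - e) powr q)) (at t)"
      using ode_sol_DERIV[OF q te] DERIV_shift[of "ode_sol q" _ t "- e"] by simp
    then have h2: "heat_at (\<lambda>x t. ode_sol q (t - e)) x t (- (ode_sol q (t - e) powr q))"
      by (rule heat_at_time)
    have chain: "((\<lambda>s. h (R - s)) has_real_derivative h' * (- 1)) (at s)"
      if "(h has_real_derivative h') (at (R - s))" for h h' s
      by (rule DERIV_chain2[where f = h and g = "\<lambda>s. R - s", OF that]) (auto intro!: derivative_eq_intros)
    have chain': "((\<lambda>s. h (R + s)) has_real_derivative h' * 1) (at s)"
      if "(h has_real_derivative h') (at (R + s))" for h h' s
      by (rule DERIV_chain2[where f = h and g = "\<lambda>s. R + s", OF that]) (auto intro!: derivative_eq_intros)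
    define r where "r = (\<lambda>i. stat_sol q (R - x $ i) powr q + stat_sol q (R + x $ i) powr q)"
    have h3: "heat_at (\<lambda>x t. stat_sol q (R - x $ i) + stat_sol q (R + x $ i)) x t (- r i)" for i
    proof (rule heat_at_coord[where g = "\<lambda>s. stat_sol q (R - s) + stat_sol q (R + s)"
          and ?g1.0 = "\<lambda>s. g (R - s) * (- 1) + g (R + s) * 1"])
      have ii: "x $ i \<in> {- R<..<R}" using inR[OF xc, of i] by (auto simp: abs_less_iff)
      have "\<forall>\<^sub>F s in nhds (x $ i). s \<in> {- R<..<R}"
        by (rule eventually_nhds_in_open) (use ii in auto)
      then show "\<forall>\<^sub>F s in nhds (x $ i). ((\<lambda>s. stat_sol q (R - s) + stat_sol q (R + s)) has_real_derivative
          g (R - s) * (- 1) + g (R + s) * 1) (at s)"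
      proof eventually_elim
        case (elim s)
        show ?case
          by (intro DERIV_add chain chain' g(1)) (use elim in auto)
      qed
      have "((\<lambda>s. g (R - s) * (- 1) + g (R + s) * 1) has_real_derivative
          (stat_sol q (R - x $ i) powr q * (- 1)) * (- 1) + (stat_sol q (R + x $ i) powr q * 1) * 1) (at (x $ i))"
        by (intro DERIV_add DERIV_cmult_right chain chain' g(2)) (use ii in auto)
      then show "((\<lambda>s. g (R - s) * (- 1) + g (R + s) * 1) has_real_derivative r i) (at (x $ i))"
        by (simp add: r_def)
    qed
    have h4: "heat_at (\<lambda>x t. Z x) x t (\<Sum>i\<in>UNIV. - r i)"
      unfolding Z_def by (rule heat_at_sum) (use h3 in auto)
    have hb: "heat_at b x t (- (ode_sol q (t - e) powr q) + (\<Sum>i\<in>UNIV. - r i))"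
      unfolding b_def by (rule heat_at_add[OF h2 h4])
    \<comment> \<open>Superadditivity enters three times: for opposite faces, over the coordinates,
      and for adding the time profile. It shows that the barrier is a supersolution.\<close>
    have "(\<Sum>i\<in>UNIV. r i) \<le> (\<Sum>i\<in>UNIV. (stat_sol q (R - x $ i) + stat_sol q (R + x $ i)) powr q)"
      unfolding r_def by (intro sum_mono powr_superadditive stat_sol_nonneg) (use q in auto)
    also have "\<dots> \<le> Z x powr q"
      unfolding Z_def by (intro powr_sum_superadditive add_nonneg_nonneg stat_sol_nonneg) (use q in auto)
    finally have "ode_sol q (t - e) powr q + (\<Sum>i\<in>UNIV. r i) \<le> ode_sol q (t - e) powr q + Z x powr q" by simp
    also have "\<dots> \<le> b x t powr q"
      unfolding b_def by (intro powr_superadditive ode_sol_nonneg Z0) (use q in auto)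
    also have "\<dots> \<le> v x t powr q"
      by (rule powr_mono2) (use q pos Z0[of x] ode_sol_nonneg[of q "t - e"] in \<open>auto simp: b_def\<close>)
    finally have "- (v x t powr q) - (- (ode_sol q (t - e) powr q) + (\<Sum>i\<in>UNIV. - r i)) \<le> 0"
      by (simp add: sum_negf)
    with heat_at_diff[OF h1 hb] show "\<exists>f\<le>0. heat_at (\<lambda>x t. v x t - b x t) x t f" by blast
  next
    have "\<bar>x0 $ i\<bar> \<le> \<rho>" for i using m(3)[of i] \<rho>(1) by linarith
    then show "x0 \<in> ?K" using x0 by (simp add: mem_cube)
  qed (use a in auto)
  then show ?thesis by (simp add: b_def Z_def)
qed

text \<open>First the faces of the cube go to infinity, where the stationary profiles vanish, then
  the shift \<open>e\<close> goes to 0. The shift is there because a member of \<open>J\<close> may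
  be unbounded as time tends to 0.\<close>

lemma J_le_ode_sol:
  fixes \<Omega> :: "(real^'n::finite) set"
  assumes q: "q > 1" and \<Omega>: "open \<Omega>" and v: "v \<in> J q \<Omega>" and x: "x \<in> closure \<Omega>" and T: "T > 0"
  shows "v x T \<le> ode_sol q T"
proof -
  have le: "v x T \<le> ode_sol q (T - e)" if e: "0 < e" "e < T" for e
  proof -
    have z1: "((\<lambda>R. stat_sol q (R - x $ i)) \<longlongrightarrow> 0) at_top" "((\<lambda>R. stat_sol q (R + x $ i)) \<longlongrightarrow> 0) at_top" for i
    proof -
      have "filterlim (\<lambda>R. R - x $ i) at_top at_top" "filterlim (\<lambda>R. R + x $ i) at_top at_top"
        using filterlim_tendsto_add_at_top[OF tendsto_const[of "- x $ i"] filterlim_ident]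
          filterlim_tendsto_add_at_top[OF tendsto_const[of "x $ i"] filterlim_ident]
        by (auto simp: add.commute)
      then show "((\<lambda>R. stat_sol q (R - x $ i)) \<longlongrightarrow> 0) at_top" "((\<lambda>R. stat_sol q (R + x $ i)) \<longlongrightarrow> 0) at_top"
        unfolding stat_sol_def by (auto intro!: tendsto_mult_right_zero tendsto_neg_powr simp: q)
    qed
    have "((\<lambda>R. ode_sol q (T - e) + (\<Sum>i\<in>UNIV. stat_sol q (R - x $ i) + stat_sol q (R + x $ i)))
        \<longlongrightarrow> ode_sol q (T - e) + (\<Sum>i\<in>(UNIV::'n set). 0 + 0)) at_top"
      by (intro tendsto_intros z1)
    moreover have "\<forall>\<^sub>F R in at_top. v x T \<le> ode_sol q (T - e) + (\<Sum>i\<in>UNIV. stat_sol q (R - x $ i) + stat_sol q (R + x $ i))"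
      using eventually_gt_at_top[of "norm x"]
    proof eventually_elim
      case (elim R)
      show ?case
        by (rule J_le_barrier[OF q \<Omega> v x e]) (use elim component_le_norm_cart[of x] le_less_trans in blast)
    qed
    ultimately show ?thesis using tendsto_lowerbound[of _ _ at_top] by fastforce
  qed
  have c: "isCont (ode_sol q) T" using ode_sol_DERIV[OF q T] by (rule DERIV_isCont)
  have "isCont (\<lambda>e. T - e) 0" by (intro continuous_intros)
  from isCont_o2[OF this, of "ode_sol q"] c have "((\<lambda>e. ode_sol q (T - e)) \<longlongrightarrow> ode_sol q T) (at 0)"
    by (simp add: isCont_def)
  then have "((\<lambda>e. ode_sol q (T - e)) \<longlongrightarrow> ode_sol q T) (at_right 0)"
    by (rule tendsto_within_subset) simp
  moreover have "\<forall>\<^sub>F e in at_right 0. v x T \<le> ode_sol q (T - e)"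
    unfolding eventually_at_right_field using le T by blast
  ultimately show ?thesis by (rule tendsto_lowerbound) simp
qed

section \<open>Approximation from above\<close>

text \<open>Extending the power by 0 to negative arguments gives, for \<open>q > 1\<close>, a
  monotone C^1 nonlinearity on the whole line, so regularity and comparison apply before the sign of
  a solution is known.\<close>

definition pospow :: "real \<Rightarrow> real \<Rightarrow> real" where
  "pospow q s = (max 0 s) powr q"

lemma pospow_nonneg: "0 \<le> pospow q s"
  by (simp add: pospow_def)

lemma pospow_eq: "0 \<le> s \<Longrightarrow> pospow q s = s powr q"
  by (simp add: pospow_def)

lemma pospow_mono: "q \<ge> 0 \<Longrightarrow> s \<le> t \<Longrightarrow> pospow q s \<le> pospow q t"
  unfolding pospow_def by (intro powr_mono2) auto

lemma pospow_DERIV: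
  assumes q: "q > 1"
  shows "(pospow q has_real_derivative q * pospow (q - 1) s) (at s)"
proof -
  consider "s > 0" | "s < 0" | "s = 0" by linarith
  then show ?thesis
  proof cases
    case 1
    have "((\<lambda>s. s powr q) has_real_derivative q * s powr (q - 1)) (at s)"
      by (rule has_real_derivative_powr[OF 1])
    then have "(pospow q has_real_derivative q * s powr (q - 1)) (at s)"
      by (rule has_field_derivative_transform_within_open[where S = "{0<..}"]) (use 1 in \<open>auto simp: pospow_def\<close>)
    then show ?thesis using 1 by (simp add: pospow_def)
  next
    case 2
    have "(pospow q has_real_derivative 0) (at s)"
      by (rule has_field_derivative_transform_within_open[where f = "\<lambda>_. 0" and S = "{..<0}"]) (use 2 in \<open>auto simp: pospow_def\<close>)
    then show ?thesis using 2 by (simp add: pospow_def)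
  next
    case 3
    \<comment> \<open>At 0 the difference quotient is bounded by \<open>|h|^(q - 1)\<close>, which
      tends to 0 because \<open>q > 1\<close>.\<close>
    have "((\<lambda>h::real. \<bar>h\<bar> powr (q - 1)) \<longlongrightarrow> 0) (at 0)"
    proof (rule tendsto_zero_powrI)
      show "((\<lambda>h::real. \<bar>h\<bar>) \<longlongrightarrow> 0) (at 0)" using tendsto_rabs_zero[OF tendsto_ident_at] by simp
    qed (use q in auto)
    moreover have "\<forall>\<^sub>F h in at 0. norm (pospow q h / h) \<le> \<bar>h\<bar> powr (q - 1)"
    proof (rule always_eventually, rule allI)
      fix h :: real
      show "norm (pospow q h / h) \<le> \<bar>h\<bar> powr (q - 1)"
      proof (cases "h > 0")
        case False
        then have "pospow q h = 0" by (simp add: pospow_def max_def)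
        then show ?thesis by simp
      qed (simp add: pospow_def powr_diff)
    qed
    ultimately have "((\<lambda>h. pospow q h / h) \<longlongrightarrow> 0) (at 0)" by (rule Lim_null_comparison[rotated])
    then show ?thesis using 3 by (simp add: has_field_derivative_iff pospow_def)
  qed
qed

lemma continuous_on_pospow: "q > 1 \<Longrightarrow> continuous_on UNIV (\<lambda>s. q * pospow (q - 1) s)"
  unfolding pospow_def
  by (intro continuous_on_mult continuous_on_const continuous_on_powr' continuous_on_max continuous_on_id) auto

lemma pospow_lipschitz:
  assumes q: "q > 1" and s: "0 \<le> s" "s \<le> M" "0 \<le> t" "t \<le> M"
  shows "\<bar>pospow q s - pospow q t\<bar> \<le> q * M powr (q - 1) * \<bar>s - t\<bar>"
proof -
  have *: "\<bar>pospow q s - pospow q t\<bar> \<le> q * M powr (q - 1) * \<bar>s - t\<bar>" if "0 \<le> s" "s < t" "t \<le> M" for s t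
  proof -
    have "\<exists>z>s. z < t \<and> pospow q t - pospow q s = (t - s) * (q * pospow (q - 1) z)"
      by (rule MVT2) (use that pospow_DERIV[OF q] in auto)
    then obtain z where z: "s < z" "z < t" "pospow q t - pospow q s = (t - s) * (q * pospow (q - 1) z)" by blast
    have "q * pospow (q - 1) z \<le> q * M powr (q - 1)"
      unfolding pospow_def using q z that by (intro mult_left_mono powr_mono2) auto
    then have "(t - s) * (q * pospow (q - 1) z) \<le> (t - s) * (q * M powr (q - 1))"
      by (rule mult_left_mono) (use that in simp)
    moreover have "(t - s) * (q * pospow (q - 1) z) \<ge> 0" using that q by (simp add: pospow_nonneg)
    ultimately have "\<bar>pospow q t - pospow q s\<bar> \<le> (t - s) * (q * M powr (q - 1))" using z(3) by linarith
    moreover have "\<bar>s - t\<bar> = t - s" using that by simp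
    ultimately show ?thesis by (simp only: abs_minus_commute[of "pospow q s"] mult.commute)
  qed
  show ?thesis using *[of s t] *[of t s] s by (cases s t rule: linorder_cases) (auto simp: abs_minus_commute)
qed

text \<open>Where \<open>v\<close> exceeds \<open>u\<close> it is also absorbed more strongly, so
  \<open>v - u\<close> is a subsolution on exactly the set where the maximum principle asks for
  one.\<close>

lemma semilinear_comparison:
  fixes \<Omega> :: "(real^'n::finite) set"
  assumes "open \<Omega>" "q \<ge> 0"
    and "continuous_on (closure \<Omega> \<times> {a..b}) (\<lambda>(x,t). v x t)" "continuous_on (closure \<Omega> \<times> {a..b}) (\<lambda>(x,t). u x t)"
    and "\<And>x t. x \<in> closure \<Omega> \<Longrightarrow> a \<le> t \<Longrightarrow> t \<le> b \<Longrightarrow> v x t - u x t \<le> B"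
    and "\<And>x. x \<in> \<Omega> \<Longrightarrow> v x a \<le> u x a"
    and "\<And>x t. x \<in> frontier \<Omega> \<Longrightarrow> a \<le> t \<Longrightarrow> t \<le> b \<Longrightarrow> v x t \<le> u x t"
    and "\<And>x t. x \<in> \<Omega> \<Longrightarrow> a < t \<Longrightarrow> t \<le> b \<Longrightarrow> heat_at v x t (- pospow q (v x t))"
    and "\<And>x t. x \<in> \<Omega> \<Longrightarrow> a < t \<Longrightarrow> t \<le> b \<Longrightarrow> heat_at u x t (- pospow q (u x t))"
    and "x \<in> closure \<Omega>" "a \<le> t" "t \<le> b"
  shows "v x t \<le> u x t"
proof -
  have "v x t - u x t \<le> 0"
  proof (rule max_principle_unbounded[where \<Omega> = \<Omega> and a = a and b = b and w = "\<lambda>x t. v x t - u x t" and B = B])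
    have "continuous_on (closure \<Omega> \<times> {a..b}) (\<lambda>z. (case z of (x,t) \<Rightarrow> v x t) - (case z of (x,t) \<Rightarrow> u x t))"
      by (intro continuous_on_diff assms)
    then show "continuous_on (closure \<Omega> \<times> {a..b}) (\<lambda>(x,t). v x t - u x t)" by (simp add: case_prod_beta)
    show "\<exists>f\<le>0. heat_at (\<lambda>x t. v x t - u x t) x t f"
      if "x \<in> \<Omega>" "a < t" "t \<le> b" "v x t - u x t > 0" for x t
    proof -
      have "pospow q (u x t) \<le> pospow q (v x t)" using that assms(2) by (intro pospow_mono) auto
      then show ?thesis
        using heat_at_diff[OF assms(8)[OF that(1-3)] assms(9)[OF that(1-3)]] by (intro exI conjI) auto
    qed
  qed (use assms in auto)
  then show ?thesis by simp
qed

lemma wsol_time_shift: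
  fixes w :: "real^'n::finite \<Rightarrow> real \<Rightarrow> real"
  assumes w: "wsol U w F" and V: "\<And>x t. (x,t) \<in> V \<Longrightarrow> (x, t + a) \<in> U"
  shows "wsol V (\<lambda>x t. w x (t + a)) (\<lambda>x t. F x (t + a))"
  unfolding wsol_def
proof (intro allI impI, elim conjE)
  fix K and e :: real assume K: "compact K" "K \<subseteq> V" "e > 0"
  let ?K = "(\<lambda>z. (fst z, snd z + a)) ` K"
  have "compact ?K" by (intro compact_continuous_image K continuous_intros)
  moreover have "?K \<subseteq> U"
  proof
    fix z assume "z \<in> ?K"
    then obtain x t where "(x,t) \<in> K" "z = (x, t + a)" by auto
    then show "z \<in> U" using V K(2) by blast
  qed
  ultimately have "compact ?K" "?K \<subseteq> U" by auto
  from wsolE[OF w this K(3)] obtain v f where v: "caloric_on ?K v f"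
    "\<And>x t. (x,t) \<in> ?K \<Longrightarrow> \<bar>v x t - w x t\<bar> \<le> e" "\<And>x t. (x,t) \<in> ?K \<Longrightarrow> \<bar>f x t - F x t\<bar> \<le> e"
    by blast
  have im: "(x, t + a) \<in> ?K" if "(x,t) \<in> K" for x t using that by force
  have "caloric_on K (\<lambda>x t. v (x + 0) (t + a)) (\<lambda>x t. f (x + 0) (t + a))"
    by (rule caloric_on_shift[OF v(1)]) (use im in auto)
  then show "\<exists>v f. caloric_on K v f \<and> (\<forall>(x,t)\<in>K. \<bar>v x t - w x (t + a)\<bar> \<le> e \<and> \<bar>f x t - F x (t + a)\<bar> \<le> e)"
    using v(2,3)[OF im] by (intro exI[of _ "\<lambda>x t. v x (t + a)"] exI[of _ "\<lambda>x t. f x (t + a)"]) auto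
qed

lemma wsol_cong:
  assumes "wsol U w F" "\<And>x t. (x,t) \<in> U \<Longrightarrow> F x t = F' x t"
  shows "wsol U w F'"
  unfolding wsol_def
proof (intro allI impI, elim conjE)
  fix K and e :: real assume K: "compact K" "K \<subseteq> U" "e > 0"
  from wsolE[OF assms(1) this] obtain v f where "caloric_on K v f"
    "\<And>x t. (x,t) \<in> K \<Longrightarrow> \<bar>v x t - w x t\<bar> \<le> e" "\<And>x t. (x,t) \<in> K \<Longrightarrow> \<bar>f x t - F x t\<bar> \<le> e" by metis
  moreover have "F x t = F' x t" if "(x,t) \<in> K" for x t using assms(2) K(2) that by blast
  ultimately show "\<exists>v f. caloric_on K v f \<and> (\<forall>(x,t)\<in>K. \<bar>v x t - w x t\<bar> \<le> e \<and> \<bar>f x t - F' x t\<bar> \<le> e)"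
    by (intro exI[of _ v] exI[of _ f]) auto
qed

lemma wsol_pospow_regular:
  fixes w :: "real^'n::finite \<Rightarrow> real \<Rightarrow> real"
  assumes "q > 1" "open U" "wsol U w (\<lambda>x t. - pospow q (w x t))"
  shows "C21 U w" "\<And>x t. (x,t) \<in> U \<Longrightarrow> dt w x t - lap w x t = - pospow q (w x t)"
    "\<And>x t. (x,t) \<in> U \<Longrightarrow> heat_at w x t (- pospow q (w x t))"
proof -
  have f: "((\<lambda>s. - pospow q s) has_real_derivative - (q * pospow (q - 1) s)) (at s)" for s
    by (rule DERIV_minus[OF pospow_DERIV[OF assms(1)]])
  have c: "continuous_on UNIV (\<lambda>s. - (q * pospow (q - 1) s))"
    by (rule continuous_on_minus[OF continuous_on_pospow[OF assms(1)]])
  note reg = wsol_semilinear_regular[where f = "\<lambda>s. - pospow q s", OF assms(2,3) f c]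
  show "C21 U w" by (rule reg(1))
  show "dt w x t - lap w x t = - pospow q (w x t)" if "(x,t) \<in> U" for x t by (rule reg(2)[OF that])
  then show "heat_at w x t (- pospow q (w x t))" if "(x,t) \<in> U" for x t
    using C21_heat_at[OF reg(1) assms(2) that] that by simp
qed

text \<open>The lateral data join the initial value \<open>ode_sol q a\<close> to \<open>0\<close> continuously, so that no
  compatibility condition is violated at time \<open>a\<close>.\<close>

definition lateral_data :: "real \<Rightarrow> real \<Rightarrow> real \<Rightarrow> real" where
  "lateral_data q a t = ode_sol q t * max 0 (2 - t / a)"

text \<open>The final time \<open>b\<close> is excluded because the equation is obtained at interior
  times only. Later \<open>b\<close> grows to infinity while \<open>a\<close> decreases to
  0.\<close>

definition approx_sol :: "real \<Rightarrow> (real^'n::finite) set \<Rightarrow> real \<Rightarrow> real \<Rightarrow> (real^'n \<Rightarrow> real \<Rightarrow> real) \<Rightarrow> bool" where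
  "approx_sol q \<Omega> a b u \<longleftrightarrow> continuous_on (closure \<Omega> \<times> {a..<b}) (\<lambda>(x,t). u x t) \<and>
     caloric_on (\<Omega> \<times> {a<..<b}) u (\<lambda>x t. - pospow q (u x t)) \<and>
     (\<forall>x\<in>closure \<Omega>. \<forall>t\<in>{a..<b}. 0 \<le> u x t \<and> u x t \<le> ode_sol q t) \<and>
     (\<forall>x\<in>\<Omega>. u x a = ode_sol q a) \<and>
     (\<forall>x\<in>frontier \<Omega>. \<forall>t\<in>{a..<b}. u x t = lateral_data q a t)"

lemma lateral_data_bounds:
  assumes "0 < a" "a \<le> t"
  shows "0 \<le> lateral_data q a t" "lateral_data q a t \<le> ode_sol q t"
proof -
  have "max 0 (2 - t / a) \<le> 1" using assms by (simp add: field_simps)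
  then have "ode_sol q t * max 0 (2 - t / a) \<le> ode_sol q t * 1"
    by (intro mult_left_mono ode_sol_nonneg) auto
  then show "lateral_data q a t \<le> ode_sol q t" by (simp add: lateral_data_def)
  show "0 \<le> lateral_data q a t" by (simp add: lateral_data_def ode_sol_nonneg)
qed

lemma approx_sol_exists:
  fixes \<Omega> :: "(real^'n::finite) set"
  assumes q: "q > 1" and \<Omega>: "open \<Omega>" "PWC \<Omega>" and ab: "0 < a" "a < b"
  obtains u where "approx_sol q \<Omega> a b u"
proof -
  define M where "M = ode_sol q a"
  have M: "M > 0" unfolding M_def by (rule ode_sol_pos) (use q ab in auto)
  \<comment> \<open>Cutting off at \<open>M\<close> and at 0 makes the source bounded and Lipschitz.
    The solution stays below \<open>M\<close>, and \<open>pospow\<close> ignores negative values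
    anyway, so the truncated equation is the original one.\<close>
  define f where "f = (\<lambda>s. - pospow q (min M (max 0 s)))"
  define G where "G = (\<lambda>t. lateral_data q a (t + a))"
  have f1: "- (M powr q) \<le> f s \<and> f s \<le> 0" for s
    using M pospow_mono[of q "min M (max 0 s)" M] q by (auto simp: f_def pospow_nonneg pospow_eq)
  have f2: "\<bar>f s - f s'\<bar> \<le> q * M powr (q - 1) * \<bar>s - s'\<bar>" for s s'
  proof -
    have "\<bar>f s - f s'\<bar> = \<bar>pospow q (min M (max 0 s)) - pospow q (min M (max 0 s'))\<bar>"
      by (simp add: f_def abs_minus_commute)
    also have "\<dots> \<le> q * M powr (q - 1) * \<bar>min M (max 0 s) - min M (max 0 s')\<bar>"
      by (rule pospow_lipschitz[OF q]) (use M in auto)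
    also have "\<dots> \<le> q * M powr (q - 1) * \<bar>s - s'\<bar>" using q by (intro mult_left_mono) auto
    finally show ?thesis .
  qed
  have c: "continuous_on {a..} (ode_sol q)"
    by (rule DERIV_continuous_on, rule has_field_derivative_at_within, rule ode_sol_DERIV[OF q]) (use ab in auto)
  have G1: "continuous_on {0..} G"
    unfolding G_def lateral_data_def
    by (intro continuous_intros continuous_on_compose2[OF c]) (use ab in auto)
  have G2: "0 \<le> G t \<and> G t \<le> M" if "t \<ge> 0" for t
    using lateral_data_bounds[of a "t + a" q] ode_sol_antimono[of q a "t + a"] q ab that
    by (auto simp: G_def M_def)
  have "b - a > 0" using ab by simp
  from semilinear_dirichlet_exists[OF \<Omega> this G1 G2 f1 f2]
  obtain w where w: "continuous_on (closure \<Omega> \<times> {0..b - a}) (\<lambda>(x,t). w x t)"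
    "wsol (\<Omega> \<times> {0<..<b - a}) w (\<lambda>x t. f (w x t))"
    "\<And>x t. x \<in> closure \<Omega> \<Longrightarrow> 0 \<le> t \<Longrightarrow> t \<le> b - a \<Longrightarrow> - (M powr q + 1) * (b - a) \<le> w x t \<and> w x t \<le> M"
    "\<And>x t. x \<in> frontier \<Omega> \<Longrightarrow> 0 \<le> t \<Longrightarrow> t \<le> b - a \<Longrightarrow> w x t = G t"
    "\<And>x. x \<in> \<Omega> \<Longrightarrow> w x 0 = G 0" by blast
  define u where "u = (\<lambda>x t. w x (t + - a))"
  have u1: "continuous_on (closure \<Omega> \<times> {a..b}) (\<lambda>(x,t). u x t)"
  proof -
    have "continuous_on (closure \<Omega> \<times> {a..b}) (\<lambda>z. (\<lambda>(x,t). w x t) (fst z, snd z + - a))"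
      by (rule continuous_on_compose2[OF w(1)]) (auto intro!: continuous_intros)
    then show ?thesis by (simp add: u_def case_prod_beta)
  qed
  have u3: "- (M powr q + 1) * (b - a) \<le> u x t \<and> u x t \<le> M" if "x \<in> closure \<Omega>" "a \<le> t" "t \<le> b" for x t
    unfolding u_def by (rule w(3)) (use that in auto)
  have u4: "u x t = lateral_data q a t" if "x \<in> frontier \<Omega>" "a \<le> t" "t \<le> b" for x t
    unfolding u_def using w(4)[of x "t + - a"] that by (simp add: G_def)
  have "G 0 = ode_sol q a" using ab by (simp add: G_def lateral_data_def)
  then have u5: "u x a = ode_sol q a" if "x \<in> \<Omega>" for x using w(5)[OF that] by (simp add: u_def)
  have "wsol (\<Omega> \<times> {a<..<b}) u (\<lambda>x t. f (u x t))"
    unfolding u_def by (rule wsol_time_shift[OF w(2)]) auto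
  then have u2: "wsol (\<Omega> \<times> {a<..<b}) u (\<lambda>x t. - pospow q (u x t))"
  proof (rule wsol_cong)
    fix x t assume "(x,t) \<in> \<Omega> \<times> {a<..<b}"
    then have "u x t \<le> M" using u3[of x t] subsetD[OF closure_subset, of x \<Omega>] by auto
    then show "f (u x t) = - pospow q (u x t)" using M by (simp add: f_def pospow_def min_absorb2)
  qed
  have op: "open (\<Omega> \<times> {a<..<b})" using \<Omega> by (simp add: open_Times)
  note reg = wsol_pospow_regular[OF q op u2]
  have bounds: "0 \<le> u x t \<and> u x t \<le> ode_sol q t" if x: "x \<in> closure \<Omega>" and t: "a \<le> t" "t < b" for x t
  proof
    have cu: "continuous_on (closure \<Omega> \<times> {a..t}) (\<lambda>(x,t). u x t)"
      by (rule continuous_on_subset[OF u1]) (use t in auto)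
    show "0 \<le> u x t"
    proof (rule semilinear_comparison[where v = "\<lambda>x t. 0" and u = u and a = a and b = t and q = q, OF \<Omega>(1)])
      show "continuous_on (closure \<Omega> \<times> {a..t}) (\<lambda>(x::real^'n, t::real). 0::real)" by (simp add: case_prod_beta)
      show "0 - u x s \<le> (M powr q + 1) * (b - a)" if "x \<in> closure \<Omega>" "a \<le> s" "s \<le> t" for x s
        using u3[of x s] that t by (simp add: algebra_simps)
      show "0 \<le> u x a" if "x \<in> \<Omega>" for x using u5[OF that] by (simp add: ode_sol_nonneg)
      show "0 \<le> u x s" if "x \<in> frontier \<Omega>" "a \<le> s" "s \<le> t" for x s
        using u4[of x s] lateral_data_bounds[of a s q] that t ab by auto
      show "heat_at (\<lambda>x t. 0) x s (- pospow q 0)" for x s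
        using heat_at_const[of 0] by (simp add: pospow_def)
      show "heat_at u x s (- pospow q (u x s))" if "x \<in> \<Omega>" "a < s" "s \<le> t" for x s
        by (rule reg(3)) (use that t in auto)
    qed (use q cu x t in auto)
    show "u x t \<le> ode_sol q t"
    proof (rule semilinear_comparison[where u = "\<lambda>x. ode_sol q" and v = u and a = a and b = t and q = q and x = x and B = M, OF \<Omega>(1)])
      show "continuous_on (closure \<Omega> \<times> {a..t}) (\<lambda>(x::real^'n, t). ode_sol q t)"
        unfolding case_prod_beta by (rule continuous_on_compose2[OF c]) (auto intro!: continuous_intros)
      show "u x s - ode_sol q s \<le> M" if "x \<in> closure \<Omega>" "a \<le> s" "s \<le> t" for x s
        using u3[of x s] that t ode_sol_nonneg[of q s] by auto
      show "u x a \<le> ode_sol q a" if "x \<in> \<Omega>" for x using u5[OF that] by simp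
      show "u x s \<le> ode_sol q s" if "x \<in> frontier \<Omega>" "a \<le> s" "s \<le> t" for x s
        using u4[of x s] lateral_data_bounds[of a s q] that t ab by auto
      show "heat_at (\<lambda>x. ode_sol q) x s (- pospow q (ode_sol q s))" if "x \<in> \<Omega>" "a < s" "s \<le> t" for x s
        unfolding pospow_eq[OF ode_sol_nonneg]
        by (rule heat_at_time, rule ode_sol_DERIV[OF q]) (use that ab in auto)
      show "heat_at u x s (- pospow q (u x s))" if "x \<in> \<Omega>" "a < s" "s \<le> t" for x s
        by (rule reg(3)) (use that t in auto)
    qed (use q cu x t in auto)
  qed
  have "caloric_on (\<Omega> \<times> {a<..<b}) u (\<lambda>x t. - pospow q (u x t))"
    by (rule C21_caloric_on[OF reg(1) op _ reg(2)]) auto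
  moreover have "continuous_on (closure \<Omega> \<times> {a..<b}) (\<lambda>(x,t). u x t)"
    by (rule continuous_on_subset[OF u1]) auto
  ultimately have "approx_sol q \<Omega> a b u"
    unfolding approx_sol_def using bounds u4 u5 by auto
  then show ?thesis by (rule that)
qed

lemma approx_sol_heat_at:
  "approx_sol q \<Omega> a b u \<Longrightarrow> x \<in> \<Omega> \<Longrightarrow> a < t \<Longrightarrow> t < b \<Longrightarrow> heat_at u x t (- pospow q (u x t))"
  unfolding approx_sol_def by (auto intro: caloric_on_heat)

text \<open>At time \<open>a\<close> the solution started earlier already lies below
  \<open>ode_sol q a\<close>, the initial value of the other one, and its lateral data have
  decreased further.\<close>

lemma approx_sol_antimono:
  fixes \<Omega> :: "(real^'n::finite) set"
  assumes q: "q > 1" and \<Omega>: "open \<Omega>"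
    and u: "approx_sol q \<Omega> a b u" and u': "approx_sol q \<Omega> a' b' u'"
    and a: "0 < a'" "a' \<le> a" and b: "b \<le> b'" and x: "x \<in> closure \<Omega>" and t: "a \<le> t" "t < b"
  shows "u' x t \<le> u x t"
proof (rule semilinear_comparison[where u = u and v = u' and a = a and b = t and q = q and x = x and B = "ode_sol q a", OF \<Omega>])
  have "continuous_on (closure \<Omega> \<times> {a'..<b'}) (\<lambda>(x,t). u' x t)"
    "continuous_on (closure \<Omega> \<times> {a..<b}) (\<lambda>(x,t). u x t)"
    using u u' unfolding approx_sol_def by blast+
  note c = this
  show "continuous_on (closure \<Omega> \<times> {a..t}) (\<lambda>(x,t). u' x t)"
    by (rule continuous_on_subset[OF c(1)]) (use a b t in auto)
  show "continuous_on (closure \<Omega> \<times> {a..t}) (\<lambda>(x,t). u x t)"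
    by (rule continuous_on_subset[OF c(2)]) (use a b t in auto)
  have bd: "u' x s \<le> ode_sol q s" if "x \<in> closure \<Omega>" "a \<le> s" "s \<le> t" for x s
    using u' that a b t unfolding approx_sol_def by auto
  show "u' x s - u x s \<le> ode_sol q a" if "x \<in> closure \<Omega>" "a \<le> s" "s \<le> t" for x s
  proof -
    have "u x s \<ge> 0" using u that t unfolding approx_sol_def by auto
    then show ?thesis using bd[OF that] ode_sol_antimono[OF q, of a s] a that by auto
  qed
  show "u' x a \<le> u x a" if "x \<in> \<Omega>" for x
    using bd[of x a] u that t closure_subset unfolding approx_sol_def by auto
  show "u' x s \<le> u x s" if xs: "x \<in> frontier \<Omega>" "a \<le> s" "s \<le> t" for x s
  proof -
    have "u' x s = lateral_data q a' s" "u x s = lateral_data q a s"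
      using u u' xs a b t unfolding approx_sol_def by auto
    moreover have "s / a \<le> s / a'" using a xs by (intro divide_left_mono) auto
    then have "lateral_data q a' s \<le> lateral_data q a s"
      unfolding lateral_data_def by (intro mult_left_mono ode_sol_nonneg) auto
    ultimately show ?thesis by simp
  qed
  show "heat_at u' x s (- pospow q (u' x s))" if "x \<in> \<Omega>" "a < s" "s \<le> t" for x s
    by (rule approx_sol_heat_at[OF u']) (use that a b t in auto)
  show "heat_at u x s (- pospow q (u x s))" if "x \<in> \<Omega>" "a < s" "s \<le> t" for x s
    by (rule approx_sol_heat_at[OF u]) (use that t in auto)
qed (use q x t in auto)

text \<open>The universal bound by \<open>ode_sol\<close> orders the two functions at time
  \<open>a\<close>; on the lateral boundary \<open>v\<close> vanishes and the data of
  \<open>u\<close> are nonnegative.\<close>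

lemma J_le_approx_sol:
  fixes \<Omega> :: "(real^'n::finite) set"
  assumes q: "q > 1" and \<Omega>: "open \<Omega>"
    and u: "approx_sol q \<Omega> a b u" and v: "v \<in> J q \<Omega>"
    and a: "0 < a" and x: "x \<in> closure \<Omega>" and t: "a \<le> t" "t < b"
  shows "v x t \<le> u x t"
proof (rule semilinear_comparison[where u = u and v = v and a = a and b = t and q = q and x = x and B = "ode_sol q a", OF \<Omega>])
  have "continuous_on (closure \<Omega> \<times> {0<..}) (\<lambda>(x,t). v x t)" using v by (simp add: J_def)
  then show "continuous_on (closure \<Omega> \<times> {a..t}) (\<lambda>(x,t). v x t)"
    by (rule continuous_on_subset) (use a in auto)
  have "continuous_on (closure \<Omega> \<times> {a..<b}) (\<lambda>(x,t). u x t)" using u unfolding approx_sol_def by blast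
  then show "continuous_on (closure \<Omega> \<times> {a..t}) (\<lambda>(x,t). u x t)"
    by (rule continuous_on_subset) (use t in auto)
  show "v x s - u x s \<le> ode_sol q a" if "x \<in> closure \<Omega>" "a \<le> s" "s \<le> t" for x s
  proof -
    have "u x s \<ge> 0" using u that t unfolding approx_sol_def by auto
    then show ?thesis using J_le_ode_sol[OF q \<Omega> v that(1), of s] ode_sol_antimono[OF q, of a s] a that by auto
  qed
  show "v x a \<le> u x a" if "x \<in> \<Omega>" for x
    using J_le_ode_sol[OF q \<Omega> v, of x a] u that a closure_subset unfolding approx_sol_def by auto
  show "v x s \<le> u x s" if xs: "x \<in> frontier \<Omega>" "a \<le> s" "s \<le> t" for x s
  proof -
    have "v x s = 0" using v xs a by (simp add: J_def)
    moreover have "u x s = lateral_data q a s" using u xs t unfolding approx_sol_def by auto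
    ultimately show ?thesis using lateral_data_bounds(1)[of a s q] a xs by simp
  qed
  show "heat_at v x s (- pospow q (v x s))" if "x \<in> \<Omega>" "a < s" "s \<le> t" for x s
  proof -
    have "v x s \<ge> 0" using v that a subsetD[OF closure_subset that(1)] by (auto simp: J_def)
    then show ?thesis using J_heat_at[OF \<Omega> v that(1), of s] that a by (simp add: pospow_eq)
  qed
  show "heat_at u x s (- pospow q (u x s))" if "x \<in> \<Omega>" "a < s" "s \<le> t" for x s
    by (rule approx_sol_heat_at[OF u]) (use that t in auto)
qed (use q x t in auto)

section \<open>Equicontinuity and passage to the limit\<close>

text \<open>The path from \<open>x\<close> to \<open>y\<close> changes one coordinate at a time,
  each leg being controlled by the gradient estimate around its midpoint.\<close>

lemma caloric_cube_oscillation: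
  fixes v :: "real^'n::finite \<Rightarrow> real \<Rightarrow> real"
  assumes d: "d > 0" and \<rho>: "0 \<le> \<rho>" "\<rho> \<le> d"
    and v: "caloric_on (cube x (2 * d) \<times> {t - d\<^sup>2..t}) v f"
    and M: "\<And>z s. z \<in> cube x (2 * d) \<Longrightarrow> t - d\<^sup>2 \<le> s \<Longrightarrow> s \<le> t \<Longrightarrow> \<bar>v z s\<bar> \<le> M"
    and F: "\<And>z s. z \<in> cube x (2 * d) \<Longrightarrow> t - d\<^sup>2 \<le> s \<Longrightarrow> s \<le> t \<Longrightarrow> \<bar>f z s\<bar> \<le> F"
    and y: "y \<in> cube x \<rho>"
  shows "\<bar>v y t - v x t\<bar> \<le> real CARD('n) * (\<rho> * (F * d + (2 * real CARD('n) + 3) * M / d))"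
proof -
  let ?B = "F * d + (2 * real CARD('n) + 3) * M / d"
  have xc: "x \<in> cube x (2 * d)" using d by (simp add: mem_cube)
  have "M \<ge> 0" "F \<ge> 0" using M[OF xc, of t] F[OF xc, of t] by (auto intro: order_trans[OF abs_ge_zero])
  then have B: "?B \<ge> 0" using d by (intro add_nonneg_nonneg) auto
  \<comment> \<open>\<open>Y S\<close> has the coordinates in \<open>S\<close> already moved to
    those of \<open>y\<close>.\<close>
  define Y where "Y = (\<lambda>S. (\<chi> j. if j \<in> S then y $ j else x $ j) :: real^'n)"
  have "\<bar>v (Y S) t - v x t\<bar> \<le> real (card S) * (\<rho> * ?B)" if "finite S" for S
    using that
  proof (induction S rule: finite_induct)
    case empty
    have "Y {} = x" by (simp add: Y_def vec_eq_iff)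
    then show ?case by simp
  next
    case (insert i S)
    define r where "r = (y $ i - x $ i) / 2"
    define m where "m = Y S + r *\<^sub>R axis i 1"
    have yj: "\<bar>y $ j - x $ j\<bar> \<le> \<rho>" for j using y by (simp add: mem_cube)
    have r: "\<bar>r\<bar> \<le> \<rho>" using yj[of i] \<rho> by (simp add: r_def)
    have mp: "m + r *\<^sub>R axis i 1 = Y (insert i S)" and mm: "m - r *\<^sub>R axis i 1 = Y S"
      using insert(2) by (auto simp: m_def Y_def vec_eq_iff axis_def r_def field_simps)
    have mx: "\<bar>m $ j - x $ j\<bar> \<le> d" for j
    proof (cases "j = i")
      case True
      then show ?thesis using insert(2) r \<rho> by (simp add: m_def Y_def axis_def)
    next
      case False
      then show ?thesis using yj[of j] \<rho> by (simp add: m_def Y_def axis_def)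
    qed
    have sub: "cube m d \<subseteq> cube x (2 * d)"
    proof
      fix z assume z: "z \<in> cube m d"
      show "z \<in> cube x (2 * d)" unfolding mem_cube
      proof
        fix j
        have "\<bar>z $ j - m $ j\<bar> \<le> d" using z by (simp add: mem_cube)
        then show "\<bar>z $ j - x $ j\<bar> \<le> 2 * d" using mx[of j] by linarith
      qed
    qed
    have "\<bar>v (m + r *\<^sub>R axis i 1) t - v (m - r *\<^sub>R axis i 1) t\<bar> \<le> \<bar>r\<bar> * ?B"
      by (rule caloric_lipschitz[OF d _ caloric_on_subset[OF v]]) (use r \<rho> sub M F in auto)
    also have "\<dots> \<le> \<rho> * ?B" using r B by (intro mult_right_mono)
    finally have "\<bar>v (Y (insert i S)) t - v x t\<bar> \<le> \<rho> * ?B + real (card S) * (\<rho> * ?B)"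
      using insert.IH unfolding mp mm by linarith
    then show ?case using insert by (simp add: distrib_right)
  qed
  moreover have "Y UNIV = y" by (simp add: Y_def vec_eq_iff)
  ultimately show ?thesis by (metis finite_code)
qed

text \<open>\<open>time_barrier\<close> with a constant profile: the value at the centre raised by
  the spatial oscillation at time \<open>s\<close>. The slack on the faces is \<open>2 * M\<close>,
  whence the coefficient \<open>4 N M / \<rho>^2\<close>. A small \<open>\<rho>\<close> followed by
  a much smaller \<open>t - s\<close> makes the bound small.\<close>

lemma caloric_time_oscillation_le:
  fixes v :: "real^'n::finite \<Rightarrow> real \<Rightarrow> real"
  assumes d: "d > 0" and \<rho>: "0 < \<rho>" "\<rho> \<le> d" and st: "s \<le> t"
    and v: "caloric_on (cube x (2 * d) \<times> {s - d\<^sup>2..t}) v f"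
    and M: "\<And>z \<tau>. z \<in> cube x (2 * d) \<Longrightarrow> s - d\<^sup>2 \<le> \<tau> \<Longrightarrow> \<tau> \<le> t \<Longrightarrow> \<bar>v z \<tau>\<bar> \<le> M"
    and F: "\<And>z \<tau>. z \<in> cube x (2 * d) \<Longrightarrow> s - d\<^sup>2 \<le> \<tau> \<Longrightarrow> \<tau> \<le> t \<Longrightarrow> \<bar>f z \<tau>\<bar> \<le> F"
  shows "v x t \<le> v x s + real CARD('n) * (\<rho> * (F * d + (2 * real CARD('n) + 3) * M / d))
     + (t - s) * (F + 4 * real CARD('n) * M / \<rho>\<^sup>2)"
proof -
  let ?N = "real CARD('n)"
  let ?o = "?N * (\<rho> * (F * d + (2 * ?N + 3) * M / d))"
  have xc: "x \<in> cube x (2 * d)" using d by (simp add: mem_cube)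
  have MF: "M \<ge> 0" "F \<ge> 0" using M[OF xc, of s] F[OF xc, of s] st by (auto intro: order_trans[OF abs_ge_zero])
  then have o: "?o \<ge> 0" using d \<rho> by (intro mult_nonneg_nonneg add_nonneg_nonneg) auto
  have sub: "cube x \<rho> \<subseteq> cube x (2 * d)" using \<rho> d by (intro cube_mono) auto
  have d2: "s - d\<^sup>2 \<le> s" by simp
  have osc: "\<bar>v z s - v x s\<bar> \<le> ?o" if "z \<in> cube x \<rho>" for z
    by (rule caloric_cube_oscillation[OF d _ \<rho>(2) caloric_on_subset[OF v] _ _ that]) (use \<rho> st M F in auto)
  have v': "caloric_on (cube x \<rho> \<times> {s..t}) v f"
    by (rule caloric_on_subset[OF v]) (use sub in \<open>auto intro: order_trans[OF d2]\<close>)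
  have "v x t \<le> (v x s + ?o) + (t - s) * (F + 0 + 2 * ?N * (2 * M) / \<rho>\<^sup>2)"
  proof (rule time_barrier[where v = v and f = f and g = "\<lambda>_. v x s + ?o" and ?x0.0 = x and F = F
        and D = 0 and m = "2 * M", OF st \<rho>(1)])
    show "continuous_on (cube x \<rho> \<times> {s..t}) (\<lambda>(x,t). v x t)" using v' by (simp add: caloric_on_def)
    show "\<exists>l\<le>0. heat_at (\<lambda>z \<tau>. v x s + ?o) z \<tau> (- l)" for z \<tau>
      by (rule exI[of _ 0]) (simp add: heat_at_const)
    fix z assume z: "z \<in> cube x \<rho>"
    show "v z s \<le> v x s + ?o" using osc[OF z] by (simp add: abs_le_iff)
    fix \<tau> assume \<tau>: "s \<le> \<tau>" "\<tau> \<le> t"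
    have t': "s - d\<^sup>2 \<le> \<tau>" using \<tau> d2 by linarith
    have zc: "z \<in> cube x (2 * d)" using z sub by auto
    show "heat_at v z \<tau> (f z \<tau>)" by (rule caloric_on_heat[OF v']) (use z \<tau> in auto)
    show "f z \<tau> \<le> F" using F[OF zc t' \<tau>(2)] by simp
    have "(\<tau> - s) * (F + 0) \<ge> 0" using \<tau> MF by simp
    then show "v z \<tau> \<le> v x s + ?o + (\<tau> - s) * (F + 0) + 2 * M"
      using M[OF zc t' \<tau>(2)] M[OF xc d2 st] o by linarith
  qed (use MF in auto)
  then show ?thesis by (simp add: mult.assoc)
qed

lemma caloric_time_oscillation:
  fixes v :: "real^'n::finite \<Rightarrow> real \<Rightarrow> real"
  assumes d: "d > 0" and \<rho>: "0 < \<rho>" "\<rho> \<le> d" and st: "s \<le> t"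
    and v: "caloric_on (cube x (2 * d) \<times> {s - d\<^sup>2..t}) v f"
    and M: "\<And>z \<tau>. z \<in> cube x (2 * d) \<Longrightarrow> s - d\<^sup>2 \<le> \<tau> \<Longrightarrow> \<tau> \<le> t \<Longrightarrow> \<bar>v z \<tau>\<bar> \<le> M"
    and F: "\<And>z \<tau>. z \<in> cube x (2 * d) \<Longrightarrow> s - d\<^sup>2 \<le> \<tau> \<Longrightarrow> \<tau> \<le> t \<Longrightarrow> \<bar>f z \<tau>\<bar> \<le> F"
  shows "\<bar>v x t - v x s\<bar> \<le> real CARD('n) * (\<rho> * (F * d + (2 * real CARD('n) + 3) * M / d))
     + (t - s) * (F + 4 * real CARD('n) * M / \<rho>\<^sup>2)"
proof -
  have 1: "v x t \<le> v x s + real CARD('n) * (\<rho> * (F * d + (2 * real CARD('n) + 3) * M / d))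
     + (t - s) * (F + 4 * real CARD('n) * M / \<rho>\<^sup>2)"
    by (rule caloric_time_oscillation_le[OF d \<rho> st v M F])
  have "(-1) * v x t \<le> (-1) * v x s + real CARD('n) * (\<rho> * (F * d + (2 * real CARD('n) + 3) * M / d))
     + (t - s) * (F + 4 * real CARD('n) * M / \<rho>\<^sup>2)"
    by (rule caloric_time_oscillation_le[OF d \<rho> st caloric_on_cmult[OF v]]) (use M F in auto)
  with 1 show ?thesis by linarith
qed

text \<open>\<open>L\<close> is fixed before the bounds, and \<open>\<delta>\<close> depends only on
  \<open>M\<close>, \<open>F\<close> and \<open>e\<close>, so a whole sequence of bounded solutions
  shares one modulus of continuity on \<open>K\<close>.\<close>

lemma caloric_equicontinuous:
  fixes K :: "((real^'n::finite) \<times> real) set"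
  assumes K: "compact K" "K \<subseteq> U" and U: "open U"
  obtains L where "compact L" "K \<subseteq> L" "L \<subseteq> U"
    "\<And>M F e. e > 0 \<Longrightarrow> \<exists>\<delta>>0. \<forall>v f. caloric_on L v f \<and> (\<forall>(x,t)\<in>L. \<bar>v x t\<bar> \<le> M \<and> \<bar>f x t\<bar> \<le> F) \<longrightarrow>
       (\<forall>x t y s. (x,t) \<in> K \<and> dist (y,s) (x,t) < \<delta> \<longrightarrow> \<bar>v y s - v x t\<bar> \<le> e)"
proof -
  let ?N = "real CARD('n)"
  obtain d0 L where d0: "0 < d0" "d0 \<le> 1" and L: "compact L" "K \<subseteq> L" "L \<subseteq> U"
    "\<And>x t y s. (x,t) \<in> K \<Longrightarrow> y \<in> cube x (2 * d0) \<Longrightarrow> \<bar>s - t\<bar> \<le> d0 \<Longrightarrow> (y,s) \<in> L"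
    using compact_cylinder_neighbourhood[OF K(1) U K(2)] by metis
  define d where "d = d0 / 2"
  have d: "d > 0" "2 * d \<le> 2 * d0" using d0 by (auto simp: d_def)
  have "d * d \<le> d * 1" using d d0 by (intro mult_left_mono) (auto simp: d_def)
  then have dd: "d\<^sup>2 + d \<le> d0" by (simp add: power2_eq_square d_def)
  show ?thesis
  proof (rule that[OF L(1-3)])
    fix M F e :: real assume e: "e > 0"
    define M' where "M' = \<bar>M\<bar>"
    define F' where "F' = \<bar>F\<bar>"
    define B where "B = F' * d + (2 * ?N + 3) * M' / d"
    have B: "B \<ge> 0" using d unfolding B_def M'_def F'_def by (intro add_nonneg_nonneg) auto
    \<comment> \<open>The spatial oscillation becomes at most \<open>e / 4\<close>. It is spent
      twice, for moving in space and inside the bound for moving in time; \<open>\<delta>\<close>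
      spends the remaining \<open>e / 2\<close>.\<close>
    define \<rho> where "\<rho> = min d (e / (4 * (?N * B + 1)))"
    have NB: "?N * B \<ge> 0" using B by simp
    have \<rho>: "0 < \<rho>" "\<rho> \<le> d" using d e NB by (auto simp: \<rho>_def intro!: divide_pos_pos mult_pos_pos add_nonneg_pos)
    have "\<rho> \<le> e / (4 * (?N * B + 1))" by (simp add: \<rho>_def)
    then have "\<rho> * (4 * (?N * B + 1)) \<le> e" using NB by (simp add: pos_le_divide_eq)
    then have NrB: "4 * (?N * (\<rho> * B)) \<le> e" using \<rho> by (simp add: algebra_simps)
    define C where "C = F' + 4 * ?N * M' / \<rho>\<^sup>2"
    have C: "C \<ge> 0" unfolding C_def F'_def M'_def by (intro add_nonneg_nonneg) auto
    define \<delta> where "\<delta> = min \<rho> (e / (2 * (C + 1)))"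
    have \<delta>: "\<delta> > 0" "\<delta> \<le> \<rho>" using \<rho> e C by (auto simp: \<delta>_def)
    have "\<delta> \<le> e / (2 * (C + 1))" by (simp add: \<delta>_def)
    then have "\<delta> * (2 * (C + 1)) \<le> e" using C by (simp add: pos_le_divide_eq)
    then have \<delta>C: "\<delta> * C \<le> e / 2" using \<delta> by (simp add: algebra_simps)
    show "\<exists>\<delta>>0. \<forall>v f. caloric_on L v f \<and> (\<forall>(x,t)\<in>L. \<bar>v x t\<bar> \<le> M \<and> \<bar>f x t\<bar> \<le> F) \<longrightarrow>
       (\<forall>x t y s. (x,t) \<in> K \<and> dist (y,s) (x,t) < \<delta> \<longrightarrow> \<bar>v y s - v x t\<bar> \<le> e)"
    proof (intro exI[of _ \<delta>] conjI \<delta>(1) allI impI, elim conjE)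
      fix v f x t y s
      assume v: "caloric_on L v f" and bd: "\<forall>(x,t)\<in>L. \<bar>v x t\<bar> \<le> M \<and> \<bar>f x t\<bar> \<le> F"
        and xt: "(x,t) \<in> K" and dst: "dist (y,s) (x,t) < \<delta>"
      have "dist y x \<le> dist (y,s) (x,t)" "dist s t \<le> dist (y,s) (x,t)"
        using dist_fst_le[of "(y,s)" "(x,t)"] dist_snd_le[of "(y,s)" "(x,t)"] by auto
      then have yx: "norm (y - x) < \<delta>" and sm: "\<bar>s - t\<bar> < \<delta>" using dst by (auto simp: dist_norm)
      have y: "y \<in> cube x \<rho>"
        unfolding mem_cube
      proof
        fix j show "\<bar>y $ j - x $ j\<bar> \<le> \<rho>"
          using component_le_norm_cart[of "y - x" j] yx \<delta>(2) by simp
      qed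
      have cc: "cube x (2 * d) \<subseteq> cube x (2 * d0)" by (rule cube_mono[OF d(2)])
      have inL: "(z,\<tau>) \<in> L" if "z \<in> cube x (2 * d)" "min s t - d\<^sup>2 \<le> \<tau>" "\<tau> \<le> max s t" for z \<tau>
      proof (rule L(4)[OF xt])
        show "z \<in> cube x (2 * d0)" using that cc by auto
        have "d\<^sup>2 \<ge> 0" by simp
        then show "\<bar>\<tau> - t\<bar> \<le> d0" using that(2,3) sm \<delta> \<rho> dd by linarith
      qed
      have vM: "\<bar>v z \<tau>\<bar> \<le> M'" "\<bar>f z \<tau>\<bar> \<le> F'"
        if "z \<in> cube x (2 * d)" "min s t - d\<^sup>2 \<le> \<tau>" "\<tau> \<le> max s t" for z \<tau>
        using bd inL[OF that] unfolding M'_def F'_def by fastforce+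
      have "cube x (2 * d) \<times> {min s t - d\<^sup>2..max s t} \<subseteq> L" using inL by auto
      from caloric_on_subset[OF v this]
      have vc: "caloric_on (cube x (2 * d) \<times> {min s t - d\<^sup>2..max s t}) v f" .
      have "\<bar>v x (max s t) - v x (min s t)\<bar> \<le> ?N * (\<rho> * (F' * d + (2 * ?N + 3) * M' / d))
          + (max s t - min s t) * (F' + 4 * ?N * M' / \<rho>\<^sup>2)"
        by (rule caloric_time_oscillation[OF d(1) \<rho> _ vc vM]) auto
      moreover have "(max s t - min s t) * C \<le> \<delta> * C" using sm C by (intro mult_right_mono) auto
      moreover have "\<bar>v x s - v x t\<bar> = \<bar>v x (max s t) - v x (min s t)\<bar>" by (cases "s \<le> t") auto
      ultimately have 1: "\<bar>v x s - v x t\<bar> \<le> ?N * (\<rho> * B) + \<delta> * C" unfolding B_def C_def by linarith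
      have "\<bar>v y s - v x s\<bar> \<le> ?N * (\<rho> * (F' * d + (2 * ?N + 3) * M' / d))"
      proof (rule caloric_cube_oscillation[OF d(1) _ \<rho>(2) caloric_on_subset[OF vc] _ _ y])
        show "cube x (2 * d) \<times> {s - d\<^sup>2..s} \<subseteq> cube x (2 * d) \<times> {min s t - d\<^sup>2..max s t}" by auto
      qed (use \<rho> in \<open>auto intro!: vM\<close>)
      then show "\<bar>v y s - v x t\<bar> \<le> e" using 1 NrB \<delta>C unfolding B_def by linarith
    qed
  qed
qed

text \<open>The bound \<open>ode_sol\<close> at the earliest time of \<open>L\<close> makes the
  functions and their sources uniformly bounded, hence equicontinuous, and pointwise convergence
  becomes uniform on \<open>K\<close>. One late \<open>u k\<close> then serves as
  approximant.\<close>

lemma approx_sol_limit_wsol: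
  fixes \<Omega> :: "(real^'n::finite) set"
  assumes q: "q > 1" and \<Omega>: "open \<Omega>"
    and ab: "\<And>t. t > 0 \<Longrightarrow> \<forall>\<^sub>F k in sequentially. a k < t" "\<And>t. \<forall>\<^sub>F k in sequentially. t < b k"
      "\<And>k. 0 < a k"
    and u: "\<And>k. approx_sol q \<Omega> (a k) (b k) (u k)"
    and lim: "\<And>x t. x \<in> \<Omega> \<Longrightarrow> t > 0 \<Longrightarrow> (\<lambda>k. u k x t) \<longlonglongrightarrow> w x t"
  shows "wsol (\<Omega> \<times> {0<..}) w (\<lambda>x t. - pospow q (w x t))"
  unfolding wsol_def
proof (intro allI impI, elim conjE)
  fix K :: "((real^'n) \<times> real) set" and e :: real assume K: "compact K" "K \<subseteq> \<Omega> \<times> {0<..}" and e: "e > 0"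
  have "open (\<Omega> \<times> {0::real<..})" using \<Omega> by (simp add: open_Times)
  from caloric_equicontinuous[OF K this] obtain L where L: "compact L" "K \<subseteq> L" "L \<subseteq> \<Omega> \<times> {0<..}" and eq:
    "\<And>M F e. e > 0 \<Longrightarrow> \<exists>\<delta>>0. \<forall>v f. caloric_on L v f \<and> (\<forall>(x,t)\<in>L. \<bar>v x t\<bar> \<le> M \<and> \<bar>f x t\<bar> \<le> F) \<longrightarrow>
       (\<forall>x t y s. (x,t) \<in> K \<and> dist (y,s) (x,t) < \<delta> \<longrightarrow> \<bar>v y s - v x t\<bar> \<le> e)"
    by blast
  have "\<exists>\<tau>1 \<tau>2. 0 < \<tau>1 \<and> (\<forall>(x,t)\<in>L. \<tau>1 \<le> t \<and> t \<le> \<tau>2)"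
  proof (cases "L = {}")
    case True then show ?thesis by (intro exI[of _ 1]) auto
  next
    case False
    have c: "compact (snd ` L)" by (intro compact_continuous_image L continuous_intros)
    obtain m where m: "m \<in> snd ` L" "\<And>t. t \<in> snd ` L \<Longrightarrow> m \<le> t"
      using compact_attains_inf[OF c] False by auto
    obtain m' where m': "\<And>t. t \<in> snd ` L \<Longrightarrow> t \<le> m'"
      using compact_attains_sup[OF c] False by auto
    have "m > 0" using m(1) L(3) by auto
    moreover have "m \<le> t \<and> t \<le> m'" if "(x,t) \<in> L" for x t
    proof -
      have "t \<in> snd ` L" using that by (metis image_eqI snd_conv)
      then show ?thesis using m(2) m' by blast
    qed
    ultimately show ?thesis by blast
  qed
  then obtain \<tau>1 \<tau>2 where \<tau>: "0 < \<tau>1" "\<And>x t. (x,t) \<in> L \<Longrightarrow> \<tau>1 \<le> t \<and> t \<le> \<tau>2" by blast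
  define M where "M = ode_sol q \<tau>1"
  have M0: "M \<ge> 0" by (simp add: M_def ode_sol_nonneg)
  have ev: "\<forall>\<^sub>F k in sequentially. a k < \<tau>1 \<and> \<tau>2 < b k" by (intro eventually_conj ab \<tau>)
  have bd: "0 \<le> u k x t \<and> u k x t \<le> M" if k: "a k < \<tau>1 \<and> \<tau>2 < b k" and xt: "(x,t) \<in> L" for k x t
  proof -
    have "x \<in> closure \<Omega>" using xt L(3) closure_subset by blast
    then have "0 \<le> u k x t \<and> u k x t \<le> ode_sol q t"
      using u[of k] \<tau>(2)[OF xt] k unfolding approx_sol_def by auto
    moreover have "ode_sol q t \<le> M" unfolding M_def using ode_sol_antimono[OF q \<tau>(1)] \<tau>(2)[OF xt] by blast
    ultimately show ?thesis by simp
  qed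
  have cal: "caloric_on L (u k) (\<lambda>x t. - pospow q (u k x t))" if k: "a k < \<tau>1 \<and> \<tau>2 < b k" for k
  proof (rule caloric_on_subset)
    show "caloric_on (\<Omega> \<times> {a k<..<b k}) (u k) (\<lambda>x t. - pospow q (u k x t))"
      using u[of k] unfolding approx_sol_def by blast
    show "L \<subseteq> \<Omega> \<times> {a k<..<b k}" using L(3) \<tau>(2) k by fastforce
  qed
  define c where "c = q * M powr (q - 1)"
  have c: "c \<ge> 0" using q by (simp add: c_def)
  \<comment> \<open>Three errors \<open>\<eta>\<close> add up: the oscillations of
    \<open>u k\<close> and of \<open>w\<close>, and convergence at a net point. The source
    multiplies them by the Lipschitz constant \<open>c\<close> of \<open>pospow\<close> on
    \<open>[0, M]\<close>.\<close>
  define \<eta> where "\<eta> = e / (3 * (c + 1))"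
  have \<eta>: "\<eta> > 0" using e c by (simp add: \<eta>_def)
  have \<eta>e: "3 * \<eta> \<le> e" "c * (3 * \<eta>) \<le> e" using e c by (simp_all add: \<eta>_def field_simps)
  obtain \<delta> where \<delta>: "\<delta> > 0" "\<And>v f x t y s. caloric_on L v f \<Longrightarrow> (\<forall>(x,t)\<in>L. \<bar>v x t\<bar> \<le> M \<and> \<bar>f x t\<bar> \<le> M powr q) \<Longrightarrow>
       (x,t) \<in> K \<Longrightarrow> dist (y,s) (x,t) < \<delta> \<Longrightarrow> \<bar>v y s - v x t\<bar> \<le> \<eta>"
    using eq[OF \<eta>, of M "M powr q"] by blast
  have osc: "\<bar>u k y s - u k x t\<bar> \<le> \<eta>"
    if k: "a k < \<tau>1 \<and> \<tau>2 < b k" and xt: "(x,t) \<in> K" "dist (y,s) (x,t) < \<delta>" for k x t y s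
  proof (rule \<delta>(2)[OF cal[OF k] _ xt])
    have "\<bar>u k x t\<bar> \<le> M \<and> \<bar>- pospow q (u k x t)\<bar> \<le> M powr q" if "(x,t) \<in> L" for x t
      using bd[OF k that] pospow_mono[of q "u k x t" M] q M0 by (simp add: pospow_nonneg pospow_eq)
    then show "\<forall>(x,t)\<in>L. \<bar>u k x t\<bar> \<le> M \<and> \<bar>- pospow q (u k x t)\<bar> \<le> M powr q" by blast
  qed
  have limK: "(\<lambda>k. u k x t) \<longlonglongrightarrow> w x t" if "(x,t) \<in> K" for x t using lim that K(2) by auto
  have wosc: "\<bar>w y s - w x t\<bar> \<le> \<eta>" if "(x,t) \<in> K" "(y,s) \<in> K" "dist (y,s) (x,t) < \<delta>" for x t y s
  proof (rule tendsto_upperbound)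
    show "(\<lambda>k. \<bar>u k y s - u k x t\<bar>) \<longlonglongrightarrow> \<bar>w y s - w x t\<bar>" using that by (intro tendsto_intros limK)
    show "\<forall>\<^sub>F k in sequentially. \<bar>u k y s - u k x t\<bar> \<le> \<eta>"
      using ev by eventually_elim (use osc that in blast)
  qed simp
  obtain C where C: "C \<subseteq> K" "finite C" "K \<subseteq> (\<Union>z\<in>C. ball z \<delta>)"
  proof (rule compactE_image[OF K(1), of K "\<lambda>z. ball z \<delta>"])
    show "K \<subseteq> (\<Union>z\<in>K. ball z \<delta>)" using \<delta>(1) by auto
  qed auto
  have "\<forall>\<^sub>F k in sequentially. \<forall>z\<in>C. \<bar>u k (fst z) (snd z) - w (fst z) (snd z)\<bar> < \<eta>"
  proof (rule eventually_ball_finite[OF C(2)], rule ballI)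
    fix z assume "z \<in> C"
    then have "(fst z, snd z) \<in> K" using C(1) by auto
    from tendstoD[OF limK[OF this] \<eta>]
    show "\<forall>\<^sub>F k in sequentially. \<bar>u k (fst z) (snd z) - w (fst z) (snd z)\<bar> < \<eta>" by (simp add: dist_real_def)
  qed
  then obtain k where k: "a k < \<tau>1 \<and> \<tau>2 < b k" "\<And>x t. (x,t) \<in> C \<Longrightarrow> \<bar>u k x t - w x t\<bar> < \<eta>"
    using eventually_happens'[OF sequentially_bot eventually_conj[OF ev]] by force
  have "\<bar>u k y s - w y s\<bar> \<le> e \<and> \<bar>- pospow q (u k y s) - - pospow q (w y s)\<bar> \<le> e" if ys: "(y,s) \<in> K" for y s
  proof -
    obtain x t where xt: "(x,t) \<in> C" "dist (y,s) (x,t) < \<delta>"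
      using C(3) ys by (force simp: dist_commute)
    have xK: "(x,t) \<in> K" using xt(1) C(1) by auto
    have 1: "\<bar>u k y s - w y s\<bar> \<le> 3 * \<eta>"
      using osc[OF k(1) xK xt(2)] wosc[OF xK ys xt(2)] k(2)[OF xt(1)] by linarith
    have w0: "0 \<le> w y s \<and> w y s \<le> M"
    proof
      have ysL: "(y,s) \<in> L" using ys L(2) by auto
      show "0 \<le> w y s"
        by (rule tendsto_lowerbound[OF limK[OF ys]]) (use ev in eventually_elim, use bd[OF _ ysL] in \<open>auto\<close>)
      show "w y s \<le> M"
        by (rule tendsto_upperbound[OF limK[OF ys]]) (use ev in eventually_elim, use bd[OF _ ysL] in \<open>auto\<close>)
    qed
    have "\<bar>pospow q (u k y s) - pospow q (w y s)\<bar> \<le> c * \<bar>u k y s - w y s\<bar>"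
      unfolding c_def by (rule pospow_lipschitz[OF q]) (use bd[OF k(1), of y s] ys L(2) w0 in auto)
    also have "\<dots> \<le> c * (3 * \<eta>)" using 1 c by (intro mult_left_mono)
    finally have "\<bar>pospow q (u k y s) - pospow q (w y s)\<bar> \<le> e" using \<eta>e by linarith
    then show ?thesis using 1 \<eta>e by (simp add: abs_minus_commute)
  qed
  then show "\<exists>v f. caloric_on K v f \<and> (\<forall>(x,t)\<in>K. \<bar>v x t - w x t\<bar> \<le> e \<and> \<bar>f x t - - pospow q (w x t)\<bar> \<le> e)"
    using caloric_on_subset[OF cal[OF k(1)] L(2)] by blast
qed

section \<open>The maximal element as a decreasing limit\<close>

theorem theorem2p11:
  fixes \<Omega> :: "(real^'n::finite) set" and q :: real
  assumes "q > 1"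
    and "open \<Omega>" and "connected \<Omega>"
    and "frontier \<Omega> \<noteq> {}" and "compact (frontier \<Omega>)"
    and "PWC \<Omega>"
  shows "\<exists>ub\<in>J q \<Omega>. \<forall>u\<in>J q \<Omega>. \<forall>x\<in>\<Omega>. \<forall>t>0. u x t \<le> ub x t"
proof -
  define a where "a = (\<lambda>k. inverse (real (Suc k)))"
  \<comment> \<open>\<open>k + 2\<close> exceeds \<open>a k \<le> 1\<close>, so every interval is
    nonempty, and the nested intervals exhaust the positive times.\<close>
  define b where "b = (\<lambda>k. real k + 2)"
  have a0: "0 < a k" for k by (simp add: a_def)
  have a1: "a k \<le> 1" for k by (simp add: a_def field_simps)
  have amono: "a j \<le> a k" if "k \<le> j" for j k using that by (simp add: a_def le_imp_inverse_le)
  have bmono: "b k \<le> b j" if "k \<le> j" for j k using that by (simp add: b_def)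
  have ab: "a k < b k" for k using a1[of k] by (simp add: b_def)
  have ev_a: "\<forall>\<^sub>F k in sequentially. a k < t" if "t > 0" for t
    unfolding a_def using order_tendstoD(2)[OF LIMSEQ_inverse_real_of_nat that] .
  have ev_b: "\<forall>\<^sub>F k in sequentially. t < b k" for t
  proof -
    obtain n where "t < real n" using reals_Archimedean2 by blast
    then show ?thesis by (intro eventually_sequentiallyI[of n]) (simp add: b_def)
  qed
  have "\<forall>k. \<exists>u. approx_sol q \<Omega> (a k) (b k) u"
    using approx_sol_exists[OF assms(1,2,6) a0 ab] by metis
  then obtain u where u: "\<And>k. approx_sol q \<Omega> (a k) (b k) (u k)" by metis
  have mono: "u j x t \<le> u k x t" if "k \<le> j" "x \<in> closure \<Omega>" "a k \<le> t" "t < b k" for j k x t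
    by (rule approx_sol_antimono[OF assms(1,2) u u a0 amono bmono]) (use that in auto)
  have u0: "0 \<le> u k x t" if "x \<in> closure \<Omega>" "a k \<le> t" "t < b k" for k x t
    using u[of k] that unfolding approx_sol_def by auto
  define w where "w = (\<lambda>x t. lim (\<lambda>k. u k x t))"
  have lim: "(\<lambda>k. u k x t) \<longlonglongrightarrow> w x t" if x: "x \<in> closure \<Omega>" and t: "t > 0" for x t
  proof -
    obtain m where m: "\<And>k. k \<ge> m \<Longrightarrow> a k < t \<and> t < b k"
      using eventually_conj[OF ev_a[OF t] ev_b[of t]] unfolding eventually_sequentially by blast
    \<comment> \<open>\<open>u k x t\<close> is controlled only once
      \<open>a k \<le> t < b k\<close>, so monotone convergence is applied to a tail.\<close>
    have "decseq (\<lambda>k. u (k + m) x t)"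
      unfolding decseq_def by (intro allI impI mono x) (use m m[THEN conjunct1, THEN less_imp_le] in auto)
    moreover have "0 \<le> u (k + m) x t" for k by (rule u0[OF x]) (use m m[THEN conjunct1, THEN less_imp_le] in auto)
    ultimately obtain l where "(\<lambda>k. u (k + m) x t) \<longlonglongrightarrow> l" using decseq_convergent by blast
    then have "(\<lambda>k. u k x t) \<longlonglongrightarrow> l" by (rule LIMSEQ_offset)
    then show ?thesis unfolding w_def by (simp add: limI)
  qed
  have w0: "0 \<le> w x t" if x: "x \<in> closure \<Omega>" and t: "t > 0" for x t
    by (rule tendsto_lowerbound[OF lim[OF x t]])
       (use eventually_conj[OF ev_a[OF t] ev_b[of t]] in eventually_elim, use u0[OF x] in auto)
  have wu: "w x t \<le> u k x t" if x: "x \<in> closure \<Omega>" and t: "a k \<le> t" "t < b k" for k x t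
  proof (rule LIMSEQ_le_const2[OF lim[OF x]])
    show "t > 0" using t a0[of k] by linarith
    show "\<exists>N. \<forall>n\<ge>N. u n x t \<le> u k x t" using mono x t by blast
  qed
  have wsol: "wsol (\<Omega> \<times> {0<..}) w (\<lambda>x t. - pospow q (w x t))"
    by (rule approx_sol_limit_wsol[OF assms(1,2) ev_a ev_b a0 u lim]) (use closure_subset in auto)
  have op: "open (\<Omega> \<times> {0::real<..})" using assms(2) by (simp add: open_Times)
  note reg = wsol_pospow_regular[OF assms(1) op wsol]
  \<comment> \<open>The lateral data of \<open>u k\<close> vanish from time \<open>2 * a k\<close>
    on; every positive time lies beyond that for large \<open>k\<close>.\<close>
  have small: "\<exists>k. a k < t \<and> t < b k \<and> 2 * a k < t" if t: "t > 0" for t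
  proof -
    have "t / 2 > 0" using t by simp
    from eventually_happens'[OF sequentially_bot eventually_conj[OF ev_a[OF this] ev_b[of t]]]
    obtain k where "a k < t / 2" "t < b k" by blast
    then show ?thesis using a0[of k] by (intro exI[of _ k]) auto
  qed
  have lat: "u k x t = 0" if "x \<in> frontier \<Omega>" "2 * a k \<le> t" "t < b k" for k x t
  proof -
    have "t \<in> {a k..<b k}" using that a0[of k] by auto
    then have "u k x t = lateral_data q (a k) t" using u[of k] that(1) unfolding approx_sol_def by blast
    then show ?thesis using that(2) a0[of k] by (simp add: lateral_data_def pos_le_divide_eq)
  qed
  have fr: "frontier \<Omega> \<subseteq> closure \<Omega>" by (auto simp: frontier_def)
  have wfr: "w x t = 0" if x: "x \<in> frontier \<Omega>" and t: "t > 0" for x t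
  proof -
    obtain k where k: "a k < t" "t < b k" "2 * a k < t" using small[OF t] by blast
    have "w x t \<le> 0" using wu[of x k t] lat[OF x, of k t] k x fr by auto
    then show ?thesis using w0[of x t] x fr t by fastforce
  qed
  have "continuous_on (closure \<Omega> \<times> {0<..}) (\<lambda>(x,t). w x t)"
    unfolding continuous_on_eq_continuous_within
  proof safe
    fix x and t :: real assume x: "x \<in> closure \<Omega>" and t: "t > 0"
    show "continuous (at (x,t) within closure \<Omega> \<times> {0<..}) (\<lambda>(x,t). w x t)"
    proof (cases "x \<in> \<Omega>")
      case True
      have "continuous_on (\<Omega> \<times> {0<..}) (\<lambda>(x,t). w x t)" by (rule wsol_continuous[OF op wsol])
      then have "isCont (\<lambda>(x,t). w x t) (x,t)" using op True t by (simp add: continuous_on_eq_continuous_at)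
      then show ?thesis by (rule continuous_at_imp_continuous_at_within)
    next
      case False
      then have xf: "x \<in> frontier \<Omega>" using x assms(2) by (simp add: frontier_def interior_open)
      obtain k where k: "a k < t" "t < b k" "2 * a k < t" using small[OF t] by blast
      let ?S = "closure \<Omega> \<times> {0<..}"
      let ?V = "UNIV \<times> {a k<..<b k}"
      have oV: "open ?V" by (intro open_Times) auto
      have atV: "at (x,t) within (closure \<Omega> \<times> {a k<..<b k}) = at (x,t) within ?S"
        by (rule at_within_nhd[OF _ oV]) (use k a0[of k] in auto)
      have "continuous_on (closure \<Omega> \<times> {a k..<b k}) (\<lambda>(x,t). u k x t)"
        using u[of k] unfolding approx_sol_def by blast
      then have "continuous_on (closure \<Omega> \<times> {a k<..<b k}) (\<lambda>(x,t). u k x t)"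
        by (rule continuous_on_subset) auto
      then have "((\<lambda>(x,t). u k x t) \<longlongrightarrow> u k x t) (at (x,t) within (closure \<Omega> \<times> {a k<..<b k}))"
        using x k by (auto simp: continuous_on_def)
      then have ul: "((\<lambda>(x,t). u k x t) \<longlongrightarrow> 0) (at (x,t) within ?S)"
        unfolding atV using lat[OF xf, of k t] k by simp
      have ev: "\<forall>\<^sub>F z in at (x,t) within ?S. z \<in> closure \<Omega> \<times> {a k<..<b k}"
        unfolding atV[symmetric] by (simp add: eventually_at_topological, blast)
      \<comment> \<open>At the lateral boundary continuity is inherited from a single approximant:
        \<open>w\<close> is squeezed between 0 and \<open>u k\<close>, which is continuous and
        vanishes at this point. No uniform convergence up to the boundary is required.\<close>
      have "((\<lambda>(x,t). w x t) \<longlongrightarrow> 0) (at (x,t) within ?S)"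
      proof (rule tendsto_sandwich[OF _ _ tendsto_const ul])
        show "\<forall>\<^sub>F z in at (x,t) within ?S. 0 \<le> (case z of (x,t) \<Rightarrow> w x t)"
          using ev by eventually_elim (use w0 a0[of k] in \<open>auto intro: less_trans\<close>)
        show "\<forall>\<^sub>F z in at (x,t) within ?S. (case z of (x,t) \<Rightarrow> w x t) \<le> (case z of (x,t) \<Rightarrow> u k x t)"
          using ev by eventually_elim (use wu in auto)
      qed
      then show ?thesis using wfr[OF xf t] by (simp add: continuous_within)
    qed
  qed
  moreover have "dt w x t - lap w x t + w x t powr q = 0" if "x \<in> \<Omega>" "t > 0" for x t
  proof -
    have "w x t \<ge> 0" using w0 that closure_subset by blast
    then show ?thesis using reg(2)[of x t] that by (simp add: pospow_eq)
  qed
  ultimately have "w \<in> J q \<Omega>" unfolding J_def using w0 wfr reg(1) by blast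
  moreover have "v x t \<le> w x t" if v: "v \<in> J q \<Omega>" and x: "x \<in> \<Omega>" and t: "t > 0" for v x t
  proof (rule tendsto_lowerbound[OF lim[OF _ t]])
    show xc: "x \<in> closure \<Omega>" using x closure_subset by blast
    show "\<forall>\<^sub>F k in sequentially. v x t \<le> u k x t"
      using eventually_conj[OF ev_a[OF t] ev_b[of t]]
      by eventually_elim (rule J_le_approx_sol[OF assms(1,2) u v a0 xc], auto)
  qed simp
  ultimately show ?thesis by blast
qed

end
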